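(* There is an efficient randomized algorithm that, given an $n$-vertex graph $G$ and a tree packing $\mathcal{T}$ of $k$ spanning trees of $G$ with congestion $\eta-1$ and diameter $D$, where $\eta\in[2,k+1]$, computes a $(d,c,\eta,k')$-cycle cover of $G$ with $c=O(k\cdot\eta\cdot\log^3 n)$, $d=O(D\log n)$ and $k'=k-\eta+1$. The bound on the congestion $c$ and the $(k',\eta)$ covering property hold with high probability, while the cycle length bound holds with probability $1$.
   Context: Graphs are finite, undirected, unweighted and simple. A tree packing is a collection of spanning trees of $G$; its congestion is at most $x$ if every edge of $G$ lies in at most $x$ of the trees, and its diameter is the maximum diameter of any of its trees. A $(d,c,\eta,k)$-cycle cover for a graph $G=(V,E)$ is a collection $\mathcal{C}$ of simple cycles of $G$ satisfying: (Congestion) each edge $e\in E(G)$ appears on at most $c$ cycles of $\mathcal{C}$; ($(k,\eta)$ Covering) for each edge $e\in E(G)$ there is a collection $\mathcal{C}_e=\{C_{e,1},\ldots,C_{e,k}\}\subseteq\mathcal{C}$ of $k$ cycles that contain $e$, such that each edge $e'\in E(G)\setminus\{e\}$ appears on at most $\eta$ cycles of $\mathcal{C}_e$; (Length) each cycle of $\mathcal{C}$ has length at most $d$. "Efficient" means running time polynomial in the input size. "With high probability" means with probability at least $1-1/n^c$ for some constant $c$. *)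

theory Defs
  imports
    "HOL-Probability.Probability"
    "HOL-Computational_Algebra.Polynomial"
    "HOL-Library.Multiset"
    "HOL-Library.Log_Nat"
begin

section \<open>Undirected graphs\<close>

text \<open>A graph is given by its vertex set \<open>V\<close> and its set \<open>E\<close> of two-element edges; a subgraph
  spanning \<open>V\<close> is identified with its edge set.\<close>

definition simple_graph :: "'a set \<Rightarrow> 'a set set \<Rightarrow> bool" where
  "simple_graph V E \<longleftrightarrow> finite V \<and> (\<forall>e\<in>E. e \<subseteq> V \<and> card e = 2)"

definition walk_between :: "'a set \<Rightarrow> 'a set set \<Rightarrow> 'a \<Rightarrow> 'a list \<Rightarrow> 'a \<Rightarrow> bool" where
  "walk_between V E u p v \<longleftrightarrow>
     p \<noteq> [] \<and> hd p = u \<and> last p = v \<and> set p \<subseteq> V \<and> successively (\<lambda>x y. {x, y} \<in> E) p"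

definition connected_graph :: "'a set \<Rightarrow> 'a set set \<Rightarrow> bool" where
  "connected_graph V E \<longleftrightarrow> V \<noteq> {} \<and> (\<forall>u\<in>V. \<forall>v\<in>V. \<exists>p. walk_between V E u p v)"

text \<open>A cycle is the list of its vertices in cyclic order, so its length (number of edges) is the
  length of the list.\<close>

definition cycle_edges :: "'a list \<Rightarrow> 'a set set" where
  "cycle_edges c = {{c ! i, c ! (Suc i mod length c)} | i. i < length c}"

definition simple_cycle :: "'a set set \<Rightarrow> 'a list \<Rightarrow> bool" where
  "simple_cycle E c \<longleftrightarrow> 3 \<le> length c \<and> distinct c \<and> cycle_edges c \<subseteq> E"

definition spanning_tree :: "'a set \<Rightarrow> 'a set set \<Rightarrow> 'a set set \<Rightarrow> bool" where
  "spanning_tree V E T \<longleftrightarrow> T \<subseteq> E \<and> connected_graph V T \<and> \<not> (\<exists>c. simple_cycle T c)"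

definition graph_dist :: "'a set \<Rightarrow> 'a set set \<Rightarrow> 'a \<Rightarrow> 'a \<Rightarrow> nat" where
  "graph_dist V E u v = (LEAST l. \<exists>p. walk_between V E u p v \<and> length p = Suc l)"

definition diameter :: "'a set \<Rightarrow> 'a set set \<Rightarrow> nat" where
  "diameter V E = Max {graph_dist V E u v | u v. u \<in> V \<and> v \<in> V}"

section \<open>Tree packings and cycle covers\<close>

text \<open>Collections (of trees and of cycles) are multisets: the same tree may be packed several
  times, and different trees may contribute the same cycle, which is then counted with
  multiplicity in all congestion bounds.\<close>

definition tree_packing :: "'a set \<Rightarrow> 'a set set \<Rightarrow> 'a set set multiset \<Rightarrow> bool" where
  "tree_packing V E \<T> \<longleftrightarrow> (\<forall>T\<in>#\<T>. spanning_tree V E T)"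

definition packing_congestion_le :: "'a set set \<Rightarrow> 'a set set multiset \<Rightarrow> nat \<Rightarrow> bool" where
  "packing_congestion_le E \<T> x \<longleftrightarrow> (\<forall>e\<in>E. size {#T \<in># \<T>. e \<in> T#} \<le> x)"

definition packing_diameter :: "'a set \<Rightarrow> 'a set set multiset \<Rightarrow> nat" where
  "packing_diameter V \<T> = Max (diameter V ` set_mset \<T>)"

definition covers_edge :: "'a set set \<Rightarrow> nat \<Rightarrow> nat \<Rightarrow> 'a list multiset \<Rightarrow> 'a set \<Rightarrow> bool" where
  "covers_edge E \<eta> k \<C> e \<longleftrightarrow>
     (\<exists>\<C>\<^sub>e. \<C>\<^sub>e \<subseteq># \<C> \<and> size \<C>\<^sub>e = k \<and> (\<forall>c\<in>#\<C>\<^sub>e. e \<in> cycle_edges c) \<and>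
        (\<forall>e'\<in>E - {e}. size {#c \<in># \<C>\<^sub>e. e' \<in> cycle_edges c#} \<le> \<eta>))"

definition cycle_collection :: "'a set set \<Rightarrow> 'a list multiset \<Rightarrow> bool" where
  "cycle_collection E \<C> \<longleftrightarrow> (\<forall>c\<in>#\<C>. simple_cycle E c)"

definition length_bound :: "real \<Rightarrow> 'a list multiset \<Rightarrow> bool" where
  "length_bound d \<C> \<longleftrightarrow> (\<forall>c\<in>#\<C>. real (length c) \<le> d)"

definition cycle_congestion_le :: "'a set set \<Rightarrow> 'a list multiset \<Rightarrow> real \<Rightarrow> bool" where
  "cycle_congestion_le E \<C> x \<longleftrightarrow> (\<forall>e\<in>E. real (size {#c \<in># \<C>. e \<in> cycle_edges c#}) \<le> x)"

definition cycle_cover ::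
  "real \<Rightarrow> real \<Rightarrow> nat \<Rightarrow> nat \<Rightarrow> 'a set set \<Rightarrow> 'a list multiset \<Rightarrow> bool" where
  "cycle_cover d c \<eta> k E \<C> \<longleftrightarrow>
     cycle_collection E \<C> \<and> cycle_congestion_le E \<C> c \<and>
     (\<forall>e\<in>E. covers_edge E \<eta> k \<C> e) \<and> length_bound d \<C>"

section \<open>Randomized algorithms and their running time\<close>

text \<open>Algorithms are programs of a WHILE language with fair coin flips over binary trees whose
  leaves are natural numbers. Every execution step has unit cost. The only arithmetic is
  addition, truncated subtraction and comparison, and an expression refers to boundedly many
  stored values; hence after \<open>t\<close> steps all numbers have \<open>O(input size + t)\<close> bits and all trees
  are DAGs with \<open>O(input size + t)\<close> nodes, so that polynomially many steps are the same as
  polynomial time on a probabilistic Turing machine. Ill-typed operations yield \<open>Atom 0\<close> or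
  treat a non-number as \<open>0\<close>.\<close>

datatype val = Atom nat | Cell val val

text \<open>The size of a value is, up to a constant factor, the length of its binary encoding.\<close>

fun val_size :: "val \<Rightarrow> nat" where
  "val_size (Atom n) = 1 + floorlog 2 n"
| "val_size (Cell v w) = 1 + val_size v + val_size w"

datatype expr =
    Var nat | Const nat | Mk expr expr | Fst expr | Snd expr | Is_cell expr
  | Plus expr expr | Minus expr expr | Less expr expr

type_synonym store = "nat \<Rightarrow> val"

fun num_of :: "val \<Rightarrow> nat" where
  "num_of (Atom n) = n"
| "num_of (Cell _ _) = 0"

fun fst_of :: "val \<Rightarrow> val" where
  "fst_of (Cell v _) = v"
| "fst_of (Atom _) = Atom 0"

fun snd_of :: "val \<Rightarrow> val" where
  "snd_of (Cell _ w) = w"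
| "snd_of (Atom _) = Atom 0"

definition bool_val :: "bool \<Rightarrow> val" where
  "bool_val b = Atom (of_bool b)"

fun is_true :: "val \<Rightarrow> bool" where
  "is_true (Atom n) \<longleftrightarrow> n \<noteq> 0"
| "is_true (Cell _ _) \<longleftrightarrow> True"

fun is_cell :: "val \<Rightarrow> bool" where
  "is_cell (Atom _) \<longleftrightarrow> False"
| "is_cell (Cell _ _) \<longleftrightarrow> True"

fun eval_expr :: "expr \<Rightarrow> store \<Rightarrow> val" where
  "eval_expr (Var x) s = s x"
| "eval_expr (Const n) s = Atom n"
| "eval_expr (Mk a b) s = Cell (eval_expr a s) (eval_expr b s)"
| "eval_expr (Fst a) s = fst_of (eval_expr a s)"
| "eval_expr (Snd a) s = snd_of (eval_expr a s)"
| "eval_expr (Is_cell a) s = bool_val (is_cell (eval_expr a s))"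
| "eval_expr (Plus a b) s = Atom (num_of (eval_expr a s) + num_of (eval_expr b s))"
| "eval_expr (Minus a b) s = Atom (num_of (eval_expr a s) - num_of (eval_expr b s))"
| "eval_expr (Less a b) s = bool_val (num_of (eval_expr a s) < num_of (eval_expr b s))"

datatype com =
    Skip | Assign nat expr | Flip nat | Seq com com | Cond expr com com | While expr com

text \<open>One step as a Markov kernel; \<open>Skip\<close> is the halted program.\<close>

fun step :: "com \<Rightarrow> store \<Rightarrow> (com \<times> store) pmf" where
  "step Skip s = return_pmf (Skip, s)"
| "step (Assign x a) s = return_pmf (Skip, s(x := eval_expr a s))"
| "step (Flip x) s = map_pmf (\<lambda>b. (Skip, s(x := bool_val b))) (bernoulli_pmf (1/2))"
| "step (Seq p q) s =
     (if p = Skip then return_pmf (q, s)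
      else map_pmf (\<lambda>(p', s'). (Seq p' q, s')) (step p s))"
| "step (Cond b p q) s = return_pmf (if is_true (eval_expr b s) then p else q, s)"
| "step (While b p) s =
     return_pmf (if is_true (eval_expr b s) then Seq p (While b p) else Skip, s)"

fun run :: "nat \<Rightarrow> com \<times> store \<Rightarrow> (com \<times> store) pmf" where
  "run 0 cf = return_pmf cf"
| "run (Suc t) cf = bind_pmf (step (fst cf) (snd cf)) (run t)"

text \<open>The input is passed in, and the output read off, variable \<open>0\<close>.\<close>

definition initial :: "com \<Rightarrow> val \<Rightarrow> com \<times> store" where
  "initial p v = (p, (\<lambda>_. Atom 0)(0 := v))"

definition halts_within :: "com \<Rightarrow> val \<Rightarrow> nat \<Rightarrow> bool" where
  "halts_within p v t \<longleftrightarrow> (\<forall>cf \<in> set_pmf (run t (initial p v)). fst cf = Skip)"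

definition output_within :: "com \<Rightarrow> val \<Rightarrow> nat \<Rightarrow> val pmf" where
  "output_within p v t = map_pmf (\<lambda>cf. snd cf 0) (run t (initial p v))"

section \<open>Encoding of inputs and outputs\<close>

definition enc_list :: "('a \<Rightarrow> val) \<Rightarrow> 'a list \<Rightarrow> val" where
  "enc_list f xs = foldr (\<lambda>x. Cell (f x)) xs (Atom 0)"

definition enc_edges :: "(nat \<times> nat) list \<Rightarrow> val" where
  "enc_edges = enc_list (\<lambda>(u, v). Cell (Atom u) (Atom v))"

definition enc_input :: "nat \<Rightarrow> (nat \<times> nat) list \<Rightarrow> (nat \<times> nat) list list \<Rightarrow> val" where
  "enc_input n es ts = Cell (Atom n) (Cell (enc_edges es) (enc_list enc_edges ts))"

definition enc_cycles :: "nat list list \<Rightarrow> val" where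
  "enc_cycles = enc_list (enc_list Atom)"

text \<open>A list of vertex pairs represents an edge set if it lists every edge exactly once, in either
  orientation.\<close>

definition edge_list :: "('a \<times> 'a) list \<Rightarrow> 'a set set \<Rightarrow> bool" where
  "edge_list es E \<longleftrightarrow> distinct (map (\<lambda>(u, v). {u, v}) es) \<and> set (map (\<lambda>(u, v). {u, v}) es) = E"

definition represents_input ::
  "nat \<Rightarrow> nat set set \<Rightarrow> nat set set multiset \<Rightarrow> val \<Rightarrow> bool" where
  "represents_input n E \<T> v \<longleftrightarrow>
     (\<exists>es ts Ts. v = enc_input n es ts \<and> edge_list es E \<and> mset Ts = \<T> \<and> list_all2 edge_list ts Ts)"

definition represents_output :: "nat list multiset \<Rightarrow> val \<Rightarrow> bool" where
  "represents_output \<C> v \<longleftrightarrow> (\<exists>cs. mset cs = \<C> \<and> v = enc_cycles cs)"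

end

theory Submission
  imports Defs
begin

text \<open>The algorithm is deterministic. It treats the trees one after the other. For a tree \<open>T\<close> it
  repeatedly picks, among the uncovered non-tree edges \<open>uv\<close>, one with a cheapest \<open>u\<close>-\<open>v\<close> path, where a
  path may use all edges of \<open>T\<close> and \<open>O(log n)\<close> non-tree edges, and outputs the cycle of path and edge.
  Edges that served as non-tree edges on a path for \<open>uv\<close> in an earlier tree are forbidden, so that
  every edge meets the cycles of \<open>uv\<close> at most \<open>\<eta> - 1\<close> times as a tree edge and once as a non-tree edge.
  Congestion is controlled by weights: a tree edge doubles its weight after \<open>k\<close> uses, a non-tree edge
  after each use, and a potential of order \<open>k\<close> times the total weight grows by exactly the cost of the
  chosen path.

  The cheapest path is cheap: embed \<open>T\<close> into a line of length \<open>2 w(T)\<close> by depth-first order and cut the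
  line into blocks. If \<open>r\<close> edges are uncovered, \<open>\<Omega>(r / (k log n))\<close> of them have small weight and are pairwise
  compatible, so with fewer than half as many blocks the Moore bound gives a cycle through \<open>O(log n)\<close>
  blocks. Its cost is \<open>O(log\<^sup>2 n / r)\<close> times the potential; summing over \<open>r\<close> shows that the potential ends
  up at most \<open>k n\<^sup>2 exp(O(log\<^sup>3 n))\<close>, which bounds the load of tree edges by \<open>O(k log\<^sup>3 n)\<close> and that of
  non-tree edges by \<open>O(log\<^sup>3 n)\<close> per tree.\<close>

section \<open>Deterministic executions\<close>

text \<open>The obstacle is that compatibility is one-sided and crowded: earlier trees may leave an
  edge up to \<open>k * R\<close> forbidden partners, so only a fraction of order 1/(k log n) of the
  uncovered edges can be kept pairwise compatible, and blocks on the line must be longer by that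
  factor. Starting tree edges at weight 1 and non-tree edges at weight \<open>k\<close> absorbs the
  \<open>k\<close>, because the potential counts a tree edge with about \<open>k\<close> times its
  weight. The price, \<open>k\<close> times the load on tree edges, is affordable: by the packing
  bound an edge is a tree edge in at most \<eta> - 1 stages, so both roles together stay within k *
  \<eta> times a polylogarithm. Of the three logarithms one comes from the O(log n) blocks on a
  cycle, one from the O(log n) partners added per tree, one from the harmonic sum over r. No coin is
  flipped, so the output is a point mass and the probabilistic claims concern a single run. The size
  bookkeeping for the program only shows that no fold is cut short by its clock.\<close>

inductive steps :: "com \<Rightarrow> store \<Rightarrow> nat \<Rightarrow> store \<Rightarrow> bool" where
  steps_Skip: "steps Skip s 0 s"
| steps_step: "c \<noteq> Skip \<Longrightarrow> step c s = return_pmf (c', s') \<Longrightarrow> steps c' s' t s'' \<Longrightarrow> steps c s (Suc t) s''"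

lemma run_Skip: "run t (Skip, s) = return_pmf (Skip, s)"
  by (induction t) (auto simp: bind_return_pmf)

lemma run_steps: "steps c s t s' \<Longrightarrow> t \<le> u \<Longrightarrow> run u (c, s) = return_pmf (Skip, s')"
proof (induction arbitrary: u rule: steps.induct)
  case (steps_Skip s)
  then show ?case by (simp add: run_Skip)
next
  case (steps_step c s c' s' t s'')
  then show ?case by (cases u) (auto simp: bind_return_pmf)
qed

text \<open>The extra step is the one that discards the finished first component, from
  \<open>Seq Skip q\<close> to \<open>q\<close>.\<close>

lemma steps_Seq:
  "steps p s t s' \<Longrightarrow> steps q s' u s'' \<Longrightarrow> steps (Seq p q) s (t + u + 1) s''"
proof (induction rule: steps.induct)
  case (steps_Skip s)
  then show ?case by (auto intro: steps.intros)
next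
  case (steps_step c s c' s' t s3)
  then show ?case
    using steps.steps_step[of "Seq c q" s "Seq c' q" s' "t + u + 1" s''] by simp
qed

text \<open>Only an upper bound on the steps is recorded. Halted programs idle under
  \<open>run\<close>, so a larger budget gives the same result and branches of different length can
  share one bound.\<close>

definition exec :: "com \<Rightarrow> store \<Rightarrow> nat \<Rightarrow> store \<Rightarrow> bool" where
  "exec c s t s' \<longleftrightarrow> (\<exists>t'\<le>t. steps c s t' s')"

lemma exec_run: "exec c s t s' \<Longrightarrow> run t (c, s) = return_pmf (Skip, s')"
  by (auto simp: exec_def run_steps)

lemma exec_mono: "exec c s t s' \<Longrightarrow> t \<le> u \<Longrightarrow> exec c s u s'"
  by (auto simp: exec_def intro: le_trans)

lemma exec_step:
  "c \<noteq> Skip \<Longrightarrow> step c s = return_pmf (c', s') \<Longrightarrow> exec c' s' t s'' \<Longrightarrow> exec c s (t + 1) s''"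
  unfolding exec_def by (metis Suc_eq_plus1 Suc_le_mono steps_step)

lemma exec_Skip: "exec Skip s 0 s"
  by (auto simp: exec_def intro: steps.intros)

lemma exec_Assign: "exec (Assign x a) s 1 (s(x := eval_expr a s))"
  using exec_step[OF _ _ exec_Skip, of "Assign x a" s] by simp

lemma exec_Assign': "s' = s(x := eval_expr a s) \<Longrightarrow> exec (Assign x a) s 1 s'"
  by (metis exec_Assign)

lemma exec_Seq:
  assumes "exec p s t s'" "exec q s' u s''"
  shows "exec (Seq p q) s (t + u + 1) s''"
proof -
  from assms obtain t' u' where "t' \<le> t" "u' \<le> u" "steps (Seq p q) s (t' + u' + 1) s''"
    unfolding exec_def using steps_Seq by blast
  then show ?thesis unfolding exec_def by (intro exI[of _ "t' + u' + 1"]) auto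
qed

lemma exec_Cond:
  "exec (if is_true (eval_expr b s) then p else q) s t s' \<Longrightarrow> exec (Cond b p q) s (t + 1) s'"
  by (rule exec_step) auto

lemma exec_While_False: "\<not> is_true (eval_expr b s) \<Longrightarrow> exec (While b p) s 1 s"
  using exec_step[OF _ _ exec_Skip, of "While b p" s s] by simp

lemma exec_While_True:
  assumes "is_true (eval_expr b s)" "exec p s t s'" "exec (While b p) s' u s''"
  shows "exec (While b p) s (t + u + 2) s''"
proof -
  have "exec (Seq p (While b p)) s (t + u + 1) s''"
    using assms by (intro exec_Seq)
  then show ?thesis
    using exec_step[of "While b p" s "Seq p (While b p)" s "t + u + 1" s''] assms(1) by simp
qed

section \<open>A functional language with clocked folds\<close>

text \<open>Programs are written in a first-order functional language and compiled. Every fold makes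
  at most \<open>M\<close> iterations, where the clock \<open>M\<close> is kept in store variable 1. This makes the running
  time a polynomial in \<open>M\<close> that depends only on the syntax, so that no size analysis of
  intermediate values is needed for termination. Variables are de Bruijn levels.\<close>

datatype fe =
    Arg nat | Lit nat | Pr fe fe | Hd fe | Tl fe | Isc fe | Add fe fe | Lt fe fe
  | Ite fe fe fe | Bind fe fe | Fold fe fe fe | Call fe "fe list"

fun elems :: "val \<Rightarrow> val list" where
  "elems (Atom n) = []"
| "elems (Cell v w) = v # elems w"

text \<open>Truncation by the clock is part of the meaning, so compiled loops agree with this
  function for every input. That nothing is really cut off is proved later, program by
  program.\<close>

definition fold_elems :: "nat \<Rightarrow> (val \<Rightarrow> val \<Rightarrow> val) \<Rightarrow> val \<Rightarrow> val \<Rightarrow> val" where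
  "fold_elems M f a l = foldl f a (take M (elems l))"

fun den :: "nat \<Rightarrow> fe \<Rightarrow> val list \<Rightarrow> val" and dens :: "nat \<Rightarrow> fe list \<Rightarrow> val list \<Rightarrow> val list" where
  "den M (Arg i) \<rho> = (if i < length \<rho> then \<rho> ! i else Atom 0)"
| "den M (Lit n) \<rho> = Atom n"
| "den M (Pr a b) \<rho> = Cell (den M a \<rho>) (den M b \<rho>)"
| "den M (Hd a) \<rho> = fst_of (den M a \<rho>)"
| "den M (Tl a) \<rho> = snd_of (den M a \<rho>)"
| "den M (Isc a) \<rho> = bool_val (is_cell (den M a \<rho>))"
| "den M (Add a b) \<rho> = Atom (num_of (den M a \<rho>) + num_of (den M b \<rho>))"
| "den M (Lt a b) \<rho> = bool_val (num_of (den M a \<rho>) < num_of (den M b \<rho>))"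
| "den M (Ite c a b) \<rho> = (if is_true (den M c \<rho>) then den M a \<rho> else den M b \<rho>)"
| "den M (Bind a b) \<rho> = den M b (\<rho> @ [den M a \<rho>])"
| "den M (Fold l a b) \<rho> =
     fold_elems M (\<lambda>acc v. den M b (\<rho> @ [acc, v])) (den M a \<rho>) (den M l \<rho>)"
| "den M (Call f as) \<rho> = den M f (dens M as \<rho>)"
| "dens M [] \<rho> = []"
| "dens M (a # as) \<rho> = den M a \<rho> # dens M as \<rho>"

text \<open>In \<open>cmp e vs d\<close> the environment is held in the store variables \<open>vs\<close>, all of them below \<open>d\<close>;
  the result is left in \<open>d\<close> and no variable below \<open>d\<close> is changed. A fold keeps the remaining
  list in \<open>d\<close>, the countdown in \<open>d + 1\<close>, the accumulator in \<open>d + 2\<close> and the current element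
  in \<open>d + 3\<close>.\<close>

fun cmp :: "fe \<Rightarrow> nat list \<Rightarrow> nat \<Rightarrow> com" and cmps :: "fe list \<Rightarrow> nat list \<Rightarrow> nat \<Rightarrow> com" where
  "cmp (Arg i) vs d = Assign d (if i < length vs then Var (vs ! i) else Const 0)"
| "cmp (Lit n) vs d = Assign d (Const n)"
| "cmp (Pr a b) vs d = Seq (Seq (cmp a vs d) (cmp b vs (d + 1))) (Assign d (Mk (Var d) (Var (d + 1))))"
| "cmp (Hd a) vs d = Seq (cmp a vs d) (Assign d (Fst (Var d)))"
| "cmp (Tl a) vs d = Seq (cmp a vs d) (Assign d (Snd (Var d)))"
| "cmp (Isc a) vs d = Seq (cmp a vs d) (Assign d (Is_cell (Var d)))"
| "cmp (Add a b) vs d = Seq (Seq (cmp a vs d) (cmp b vs (d + 1))) (Assign d (Plus (Var d) (Var (d + 1))))"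
| "cmp (Lt a b) vs d = Seq (Seq (cmp a vs d) (cmp b vs (d + 1))) (Assign d (Less (Var d) (Var (d + 1))))"
| "cmp (Ite c a b) vs d = Seq (cmp c vs d) (Cond (Var d) (cmp a vs d) (cmp b vs d))"
| "cmp (Bind a b) vs d =
     Seq (Seq (cmp a vs d) (cmp b (vs @ [d]) (d + 1))) (Assign d (Var (d + 1)))"
| "cmp (Fold l a b) vs d =
     Seq (Seq (Seq (cmp l vs d) (cmp a vs (d + 2))) (Assign (d + 1) (Var 1)))
       (Seq (While (Var (d + 1))
         (Seq (Assign (d + 1) (Minus (Var (d + 1)) (Const 1)))
           (Cond (Is_cell (Var d))
             (Seq (Seq (Seq (Assign (d + 3) (Fst (Var d))) (Assign d (Snd (Var d))))
                (cmp b (vs @ [d + 2, d + 3]) (d + 4))) (Assign (d + 2) (Var (d + 4))))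
             Skip)))
         (Assign d (Var (d + 2))))"
| "cmp (Call f as) vs d =
     Seq (Seq (cmps as vs d) (cmp f [d..<d + length as] (d + length as)))
       (Assign d (Var (d + length as)))"
| "cmps [] vs d = Skip"
| "cmps (a # as) vs d = Seq (cmp a vs d) (cmps as vs (d + 1))"

text \<open>Only \<open>Fold\<close> multiplies by the clock; its \<open>[:11:]\<close> covers the
  bookkeeping of one iteration around the body.\<close>

fun cost :: "fe \<Rightarrow> nat poly" and costs :: "fe list \<Rightarrow> nat poly" where
  "cost (Arg i) = [:1:]"
| "cost (Lit n) = [:1:]"
| "cost (Pr a b) = cost a + cost b + [:3:]"
| "cost (Hd a) = cost a + [:2:]"
| "cost (Tl a) = cost a + [:2:]"
| "cost (Isc a) = cost a + [:2:]"
| "cost (Add a b) = cost a + cost b + [:3:]"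
| "cost (Lt a b) = cost a + cost b + [:3:]"
| "cost (Ite c a b) = cost c + cost a + cost b + [:2:]"
| "cost (Bind a b) = cost a + cost b + [:3:]"
| "cost (Fold l a b) = cost l + cost a + [:0, 1:] * (cost b + [:11:]) + [:10:]"
| "cost (Call f as) = costs as + cost f + [:3:]"
| "costs [] = 0"
| "costs (a # as) = cost a + costs as + [:1:]"

section \<open>Correctness of the compiler, by induction on expressions\<close>

definition env_ok :: "nat \<Rightarrow> val list \<Rightarrow> nat list \<Rightarrow> nat \<Rightarrow> store \<Rightarrow> bool" where
  "env_ok M \<rho> vs d s \<longleftrightarrow> 1 < d \<and> s 1 = Atom M \<and> length vs = length \<rho> \<and>
     (\<forall>i<length \<rho>. vs ! i < d \<and> s (vs ! i) = \<rho> ! i)"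

lemma env_ok_agree:
  "env_ok M \<rho> vs d s \<Longrightarrow> \<forall>i<d. s' i = s i \<Longrightarrow> d \<le> d' \<Longrightarrow> env_ok M \<rho> vs d' s'"
  unfolding env_ok_def by auto

lemma env_ok_snoc:
  "env_ok M \<rho> vs d s \<Longrightarrow> x < d \<Longrightarrow> s x = v \<Longrightarrow> env_ok M (\<rho> @ [v]) (vs @ [x]) d s"
  unfolding env_ok_def by (auto simp: nth_append less_Suc_eq)

text \<open>The frame clause makes the pieces compose: earlier results, loop variables and, because
  \<open>1 < d\<close>, the clock lie below \<open>d\<close> and survive the evaluation of a
  subexpression. Quantifying over all environments and all \<open>d\<close> gives the induction its
  strength.\<close>

definition comp_ok :: "nat \<Rightarrow> fe \<Rightarrow> bool" where
  "comp_ok M e \<longleftrightarrow> (\<forall>\<rho> vs d s. env_ok M \<rho> vs d s \<longrightarrow>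
     (\<exists>s'. exec (cmp e vs d) s (poly (cost e) M) s' \<and> s' d = den M e \<rho> \<and> (\<forall>i<d. s' i = s i)))"

definition comps_ok :: "nat \<Rightarrow> fe list \<Rightarrow> bool" where
  "comps_ok M es \<longleftrightarrow> (\<forall>\<rho> vs d s. env_ok M \<rho> vs d s \<longrightarrow>
     (\<exists>s'. exec (cmps es vs d) s (poly (costs es) M) s' \<and>
       (\<forall>i<length es. s' (d + i) = dens M es \<rho> ! i) \<and> (\<forall>i<d. s' i = s i)))"

lemma comp_okE:
  assumes "comp_ok M e" "env_ok M \<rho> vs d s"
  obtains s' where "exec (cmp e vs d) s (poly (cost e) M) s'" "s' d = den M e \<rho>" "\<forall>i<d. s' i = s i"
  using assms unfolding comp_ok_def by blast

lemma comp_ok_unary: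
  assumes "comp_ok M a"
    and "\<And>vs d. cmp e vs d = Seq (cmp a vs d) (Assign d (f (Var d)))"
    and "cost e = cost a + [:2:]"
    and "\<And>s d. eval_expr (f (Var d)) s = g (s d)" "\<And>\<rho>. den M e \<rho> = g (den M a \<rho>)"
  shows "comp_ok M e"
  unfolding comp_ok_def
proof (intro allI impI)
  fix \<rho> vs d s assume ok: "env_ok M \<rho> vs d s"
  obtain s' where s': "exec (cmp a vs d) s (poly (cost a) M) s'" "s' d = den M a \<rho>" "\<forall>i<d. s' i = s i"
    by (rule comp_okE[OF assms(1) ok])
  have "exec (cmp e vs d) s (poly (cost e) M) (s'(d := g (s' d)))"
    using exec_Seq[OF s'(1) exec_Assign[of d "f (Var d)"]] by (simp add: assms)
  then show "\<exists>s'. exec (cmp e vs d) s (poly (cost e) M) s' \<and> s' d = den M e \<rho> \<and> (\<forall>i<d. s' i = s i)"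
    using s'(2,3) assms(5)[of \<rho>]
    by (intro exI[of _ "s'(d := g (s' d))"]) (simp del: fun_upd_apply, simp)
qed

lemma comp_ok_binary:
  assumes "comp_ok M a" "comp_ok M b"
    and "\<And>vs d. cmp e vs d = Seq (Seq (cmp a vs d) (cmp b vs (d + 1))) (Assign d (f (Var d) (Var (d + 1))))"
    and "cost e = cost a + cost b + [:3:]"
    and "\<And>s d. eval_expr (f (Var d) (Var (d + 1))) s = g (s d) (s (d + 1))"
    and "\<And>\<rho>. den M e \<rho> = g (den M a \<rho>) (den M b \<rho>)"
  shows "comp_ok M e"
  unfolding comp_ok_def
proof (intro allI impI)
  fix \<rho> vs d s assume ok: "env_ok M \<rho> vs d s"
  obtain s' where s': "exec (cmp a vs d) s (poly (cost a) M) s'" "s' d = den M a \<rho>" "\<forall>i<d. s' i = s i"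
    by (rule comp_okE[OF assms(1) ok])
  have ok': "env_ok M \<rho> vs (d + 1) s'"
    using env_ok_agree[OF ok s'(3)] by simp
  obtain s2 where s2: "exec (cmp b vs (d + 1)) s' (poly (cost b) M) s2" "s2 (d + 1) = den M b \<rho>"
      "\<forall>i<d + 1. s2 i = s' i"
    by (rule comp_okE[OF assms(2) ok'])
  have "exec (cmp e vs d) s (poly (cost e) M) (s2(d := g (s2 d) (s2 (d + 1))))"
    unfolding assms(3,4)
    by (rule exec_mono[OF exec_Seq[OF exec_Seq[OF s'(1) s2(1)]
          exec_Assign[of d "f (Var d) (Var (d + 1))", unfolded assms(5)]]]) simp
  then show "\<exists>s'. exec (cmp e vs d) s (poly (cost e) M) s' \<and> s' d = den M e \<rho> \<and> (\<forall>i<d. s' i = s i)"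
    using s'(2,3) s2(2,3) assms(6)[of \<rho>]
    by (intro exI[of _ "s2(d := g (s2 d) (s2 (d + 1)))"]) (simp del: fun_upd_apply, simp)
qed

lemma comp_ok_fold:
  assumes l: "comp_ok M l" and a: "comp_ok M a" and b: "comp_ok M b"
  shows "comp_ok M (Fold l a b)"
  unfolding comp_ok_def
proof (intro allI impI)
  fix \<rho> vs d s assume ok: "env_ok M \<rho> vs d s"
  let ?body = "Seq (Assign (d + 1) (Minus (Var (d + 1)) (Const 1)))
           (Cond (Is_cell (Var d))
             (Seq (Seq (Seq (Assign (d + 3) (Fst (Var d))) (Assign d (Snd (Var d))))
                (cmp b (vs @ [d + 2, d + 3]) (d + 4))) (Assign (d + 2) (Var (d + 4))))
             Skip)"
  let ?f = "\<lambda>acc v. den M b (\<rho> @ [acc, v])"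
  let ?B = "poly (cost b) M"
  \<comment> \<open>The induction is on the countdown, not on the list: the loop always performs
    \<open>c\<close> iterations, and once the list has become an atom the remaining ones leave the
    accumulator alone.\<close>
  have loop: "\<exists>s'. exec (While (Var (d + 1)) ?body) s (c * (?B + 11) + 1) s' \<and>
      s' (d + 2) = foldl ?f acc (take c (elems v)) \<and> (\<forall>i<d. s' i = s i)"
    if "env_ok M \<rho> vs d s" "s d = v" "s (d + 1) = Atom c" "s (d + 2) = acc" for s c v acc
    using that
  proof (induction c arbitrary: s v acc)
    case 0
    have "exec (While (Var (d + 1)) ?body) s 1 s"
      by (rule exec_While_False) (use 0 in auto)
    with 0 show ?case by (intro exI[of _ s]) auto
  next
    case (Suc c)
    let ?s1 = "s(d + 1 := Atom c)"
    have e1: "exec (Assign (d + 1) (Minus (Var (d + 1)) (Const 1))) s 1 ?s1"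
      using exec_Assign[of "d + 1" "Minus (Var (d + 1)) (Const 1)" s] Suc.prems by simp
    obtain s2 where s2: "exec ?body s (?B + 9) s2" "\<forall>i<d. s2 i = s i" "s2 (d + 1) = Atom c"
      "elems (s2 d) = tl (elems v)" "s2 (d + 2) = (case elems v of x # _ \<Rightarrow> ?f acc x | _ \<Rightarrow> acc)"
    proof (cases v)
      case (Atom n)
      show thesis
      proof (rule that[of ?s1])
        show "exec ?body s (?B + 9) ?s1"
          by (rule exec_mono[OF exec_Seq[OF e1 exec_Cond[of _ _ _ _ 0]]])
             (use Atom Suc.prems(2) in \<open>auto simp: bool_val_def exec_Skip\<close>)
      qed (use Atom Suc.prems in auto)
    next
      case (Cell x w)
      let ?s2 = "?s1(d + 3 := x, d := w)"
      have e2: "exec (Seq (Assign (d + 3) (Fst (Var d))) (Assign d (Snd (Var d)))) ?s1 3 ?s2"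
        by (rule exec_mono[OF exec_Seq[OF exec_Assign'[of "?s1(d + 3 := x)"] exec_Assign']])
          (use Cell Suc.prems in auto)
      have "env_ok M \<rho> vs d ?s2"
        by (rule env_ok_agree[OF Suc.prems(1)]) auto
      then have "env_ok M \<rho> vs (d + 4) ?s2"
        by (rule env_ok_agree) auto
      then have "env_ok M (\<rho> @ [acc]) (vs @ [d + 2]) (d + 4) ?s2"
        by (rule env_ok_snoc) (use Suc.prems in auto)
      then have "env_ok M ((\<rho> @ [acc]) @ [x]) ((vs @ [d + 2]) @ [d + 3]) (d + 4) ?s2"
        by (rule env_ok_snoc) auto
      then obtain s3 where s3: "exec (cmp b (vs @ [d + 2, d + 3]) (d + 4)) ?s2 ?B s3"
        "s3 (d + 4) = ?f acc x" "\<forall>i<d + 4. s3 i = ?s2 i"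
        using b by (auto elim: comp_okE)
      show thesis
      proof (rule that[of "s3(d + 2 := s3 (d + 4))"])
        show "exec ?body s (?B + 9) (s3(d + 2 := s3 (d + 4)))"
        proof (rule exec_mono[OF exec_Seq[OF e1 exec_Cond]])
          have "is_true (eval_expr (Is_cell (Var d)) ?s1)"
            using Cell Suc.prems by (simp add: bool_val_def)
          moreover have "exec (Seq (Seq (Seq (Assign (d + 3) (Fst (Var d))) (Assign d (Snd (Var d))))
                (cmp b (vs @ [d + 2, d + 3]) (d + 4))) (Assign (d + 2) (Var (d + 4)))) ?s1 (3 + ?B + 1 + 1 + 1)
                (s3(d + 2 := s3 (d + 4)))"
            using exec_Seq[OF exec_Seq[OF e2 s3(1)] exec_Assign[of "d + 2" "Var (d + 4)"]] by simp
          ultimately show "exec (if is_true (eval_expr (Is_cell (Var d)) ?s1)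
              then Seq (Seq (Seq (Assign (d + 3) (Fst (Var d))) (Assign d (Snd (Var d))))
                (cmp b (vs @ [d + 2, d + 3]) (d + 4))) (Assign (d + 2) (Var (d + 4))) else Skip)
              ?s1 (3 + ?B + 1 + 1 + 1) (s3(d + 2 := s3 (d + 4)))"
            by simp
        qed simp
      qed (use s3 Cell in auto)
    qed
    have ok2: "env_ok M \<rho> vs d s2" by (rule env_ok_agree[OF Suc.prems(1) s2(2)]) simp
    obtain s' where s': "exec (While (Var (d + 1)) ?body) s2 (c * (?B + 11) + 1) s'"
      "s' (d + 2) = foldl ?f (s2 (d + 2)) (take c (elems (s2 d)))" "\<forall>i<d. s' i = s2 i"
      using Suc.IH[OF ok2 refl s2(3) refl] by blast
    have "exec (While (Var (d + 1)) ?body) s ((?B + 9) + (c * (?B + 11) + 1) + 2) s'"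
      by (rule exec_While_True[OF _ s2(1) s'(1)]) (use Suc.prems in simp)
    moreover have "s' (d + 2) = foldl ?f acc (take (Suc c) (elems v))"
      using s'(2) s2(4,5) by (cases "elems v") auto
    ultimately show ?case using s'(3) s2(2) by (intro exI[of _ s']) (auto simp: algebra_simps)
  qed
  obtain s1 where s1: "exec (cmp l vs d) s (poly (cost l) M) s1" "s1 d = den M l \<rho>" "\<forall>i<d. s1 i = s i"
    by (rule comp_okE[OF l ok])
  have ok1: "env_ok M \<rho> vs (d + 2) s1"
    using env_ok_agree[OF ok s1(3)] by simp
  obtain s2 where s2: "exec (cmp a vs (d + 2)) s1 (poly (cost a) M) s2" "s2 (d + 2) = den M a \<rho>"
      "\<forall>i<d + 2. s2 i = s1 i"
    by (rule comp_okE[OF a ok1])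
  have clock: "s2 1 = Atom M" "1 < d"
    using ok s1(3) s2(3) by (auto simp: env_ok_def)
  let ?s3 = "s2(d + 1 := Atom M)"
  have e3: "exec (Assign (d + 1) (Var 1)) s2 1 ?s3"
    using exec_Assign[of "d + 1" "Var 1" s2] clock by simp
  have "env_ok M \<rho> vs d ?s3"
    by (rule env_ok_agree[OF ok]) (use s1 s2 in auto)
  then obtain s4 where s4: "exec (While (Var (d + 1)) ?body) ?s3 (M * (?B + 11) + 1) s4"
      "s4 (d + 2) = foldl ?f (den M a \<rho>) (take M (elems (den M l \<rho>)))" "\<forall>i<d. s4 i = ?s3 i"
    using loop[of ?s3 "den M l \<rho>" M "den M a \<rho>"] s1 s2 by auto
  have "exec (cmp (Fold l a b) vs d) s (poly (cost (Fold l a b)) M) (s4(d := s4 (d + 2)))"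
    using exec_mono[OF exec_Seq[OF exec_Seq[OF exec_Seq[OF s1(1) s2(1)] e3]
        exec_Seq[OF s4(1) exec_Assign[of d "Var (d + 2)"]]]]
    by simp
  then show "\<exists>s'. exec (cmp (Fold l a b) vs d) s (poly (cost (Fold l a b)) M) s' \<and>
     s' d = den M (Fold l a b) \<rho> \<and> (\<forall>i<d. s' i = s i)"
    using s1(3) s2(3) s4(2,3)
    by (intro exI[of _ "s4(d := s4 (d + 2))"]) (simp add: fold_elems_def)
qed

lemma comp_ok_leaf:
  assumes "\<And>vs d. cmp e vs d = Assign d (f vs)" "cost e = [:1:]"
    and "\<And>\<rho> vs d s. env_ok M \<rho> vs d s \<Longrightarrow> eval_expr (f vs) s = den M e \<rho>"
  shows "comp_ok M e"
  unfolding comp_ok_def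
proof (intro allI impI)
  fix \<rho> vs d s assume ok: "env_ok M \<rho> vs d s"
  show "\<exists>s'. exec (cmp e vs d) s (poly (cost e) M) s' \<and> s' d = den M e \<rho> \<and> (\<forall>i<d. s' i = s i)"
    using exec_Assign[of d "f vs" s] assms(3)[OF ok]
    by (intro exI[of _ "s(d := den M e \<rho>)"]) (simp add: assms(1,2))
qed

lemma comp_ok_Ite:
  assumes "comp_ok M c" "comp_ok M a" "comp_ok M b"
  shows "comp_ok M (Ite c a b)"
  unfolding comp_ok_def
proof (intro allI impI)
  fix \<rho> vs d s assume ok: "env_ok M \<rho> vs d s"
  obtain s1 where s1: "exec (cmp c vs d) s (poly (cost c) M) s1" "s1 d = den M c \<rho>" "\<forall>i<d. s1 i = s i"
    by (rule comp_okE[OF assms(1) ok])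
  have ok1: "env_ok M \<rho> vs d s1"
    by (rule env_ok_agree[OF ok s1(3)]) simp
  let ?e = "if is_true (den M c \<rho>) then a else b"
  have "comp_ok M ?e" using assms by simp
  then obtain s2 where s2: "exec (cmp ?e vs d) s1 (poly (cost ?e) M) s2" "s2 d = den M ?e \<rho>"
      "\<forall>i<d. s2 i = s1 i"
    using ok1 by (rule comp_okE)
  have "exec (cmp ?e vs d) s1 (poly (cost a + cost b) M) s2"
    by (rule exec_mono[OF s2(1)]) simp
  then have "exec (Cond (Var d) (cmp a vs d) (cmp b vs d)) s1 (poly (cost a + cost b) M + 1) s2"
    by (intro exec_Cond) (simp add: s1(2) if_distrib[of "\<lambda>e. cmp e vs d"] cong: if_cong)
  from exec_Seq[OF s1(1) this]
  show "\<exists>s'. exec (cmp (Ite c a b) vs d) s (poly (cost (Ite c a b)) M) s' \<and>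
      s' d = den M (Ite c a b) \<rho> \<and> (\<forall>i<d. s' i = s i)"
    using s1(3) s2(2,3) by (intro exI[of _ s2]) (auto simp: algebra_simps)
qed

lemma comp_ok_Bind:
  assumes "comp_ok M a" "comp_ok M b"
  shows "comp_ok M (Bind a b)"
  unfolding comp_ok_def
proof (intro allI impI)
  fix \<rho> vs d s assume ok: "env_ok M \<rho> vs d s"
  obtain s1 where s1: "exec (cmp a vs d) s (poly (cost a) M) s1" "s1 d = den M a \<rho>" "\<forall>i<d. s1 i = s i"
    by (rule comp_okE[OF assms(1) ok])
  have "env_ok M \<rho> vs (d + 1) s1"
    by (rule env_ok_agree[OF ok s1(3)]) simp
  then have "env_ok M (\<rho> @ [den M a \<rho>]) (vs @ [d]) (d + 1) s1"
    by (rule env_ok_snoc) (simp_all add: s1)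
  with assms(2) obtain s2 where s2: "exec (cmp b (vs @ [d]) (d + 1)) s1 (poly (cost b) M) s2"
      "s2 (d + 1) = den M b (\<rho> @ [den M a \<rho>])" "\<forall>i<d + 1. s2 i = s1 i"
    by (rule comp_okE)
  have "exec (cmp (Bind a b) vs d) s (poly (cost (Bind a b)) M) (s2(d := s2 (d + 1)))"
    unfolding cmp.simps
    by (rule exec_mono[OF exec_Seq[OF exec_Seq[OF s1(1) s2(1)] exec_Assign']]) simp_all
  then show "\<exists>s'. exec (cmp (Bind a b) vs d) s (poly (cost (Bind a b)) M) s' \<and>
      s' d = den M (Bind a b) \<rho> \<and> (\<forall>i<d. s' i = s i)"
    by (intro exI[of _ "s2(d := s2 (d + 1))"]) (use s1(2,3) s2(2,3) in simp)
qed

lemma length_dens [simp]: "length (dens M as \<rho>) = length as"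
  by (induction as) auto

lemma comp_ok_Call:
  assumes "comp_ok M f" "comps_ok M as"
  shows "comp_ok M (Call f as)"
  unfolding comp_ok_def
proof (intro allI impI)
  fix \<rho> vs d s assume ok: "env_ok M \<rho> vs d s"
  obtain s1 where s1: "exec (cmps as vs d) s (poly (costs as) M) s1"
      "\<forall>i<length as. s1 (d + i) = dens M as \<rho> ! i" "\<forall>i<d. s1 i = s i"
    using assms(2) ok unfolding comps_ok_def by blast
  have "env_ok M (dens M as \<rho>) [d..<d + length as] (d + length as) s1"
    using ok s1 by (auto simp: env_ok_def)
  with assms(1) obtain s2 where s2:
      "exec (cmp f [d..<d + length as] (d + length as)) s1 (poly (cost f) M) s2"
      "s2 (d + length as) = den M f (dens M as \<rho>)" "\<forall>i<d + length as. s2 i = s1 i"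
    by (rule comp_okE)
  have "exec (cmp (Call f as) vs d) s (poly (cost (Call f as)) M) (s2(d := s2 (d + length as)))"
    unfolding cmp.simps
    by (rule exec_mono[OF exec_Seq[OF exec_Seq[OF s1(1) s2(1)] exec_Assign']]) simp_all
  then show "\<exists>s'. exec (cmp (Call f as) vs d) s (poly (cost (Call f as)) M) s' \<and>
      s' d = den M (Call f as) \<rho> \<and> (\<forall>i<d. s' i = s i)"
    by (intro exI[of _ "s2(d := s2 (d + length as))"]) (use s1(2,3) s2(2,3) in simp)
qed

lemma comps_ok_Cons:
  assumes "comp_ok M a" "comps_ok M as"
  shows "comps_ok M (a # as)"
  unfolding comps_ok_def
proof (intro allI impI)
  fix \<rho> vs d s assume ok: "env_ok M \<rho> vs d s"
  obtain s1 where s1: "exec (cmp a vs d) s (poly (cost a) M) s1" "s1 d = den M a \<rho>" "\<forall>i<d. s1 i = s i"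
    by (rule comp_okE[OF assms(1) ok])
  have "env_ok M \<rho> vs (d + 1) s1"
    by (rule env_ok_agree[OF ok s1(3)]) simp
  then obtain s2 where s2: "exec (cmps as vs (d + 1)) s1 (poly (costs as) M) s2"
      "\<forall>i<length as. s2 (d + 1 + i) = dens M as \<rho> ! i" "\<forall>i<d + 1. s2 i = s1 i"
    using assms(2) unfolding comps_ok_def by blast
  have "s2 (d + i) = dens M (a # as) \<rho> ! i" if "i < length (a # as)" for i
    using that s1(2) s2(2,3) by (cases i) auto
  then show "\<exists>s'. exec (cmps (a # as) vs d) s (poly (costs (a # as)) M) s' \<and>
       (\<forall>i<length (a # as). s' (d + i) = dens M (a # as) \<rho> ! i) \<and> (\<forall>i<d. s' i = s i)"
    using exec_Seq[OF s1(1) s2(1)] s1(3) s2(3) by (intro exI[of _ s2]) auto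
qed

lemma comps_okI: "(\<And>a. a \<in> set as \<Longrightarrow> comp_ok M a) \<Longrightarrow> comps_ok M as"
proof (induction as)
  case Nil
  show ?case by (auto simp: comps_ok_def intro: exec_Skip)
next
  case (Cons a as)
  then show ?case by (intro comps_ok_Cons) auto
qed

lemma comp_correct: "comp_ok M e"
proof (induction e)
  case (Arg i)
  show ?case by (rule comp_ok_leaf) (auto simp: env_ok_def)
next
  case (Lit n)
  show ?case by (rule comp_ok_leaf) auto
next
  case (Pr a b)
  then show ?case by (rule comp_ok_binary[where f = Mk and g = Cell]) auto
next
  case (Hd a)
  then show ?case by (rule comp_ok_unary[where f = Fst and g = fst_of]) auto
next
  case (Tl a)
  then show ?case by (rule comp_ok_unary[where f = Snd and g = snd_of]) auto
next
  case (Isc a)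
  then show ?case by (rule comp_ok_unary[where f = Is_cell and g = "\<lambda>v. bool_val (is_cell v)"]) auto
next
  case (Add a b)
  then show ?case
    by (rule comp_ok_binary[where f = Plus and g = "\<lambda>v w. Atom (num_of v + num_of w)"]) auto
next
  case (Lt a b)
  then show ?case
    by (rule comp_ok_binary[where f = Less and g = "\<lambda>v w. bool_val (num_of v < num_of w)"]) auto
next
  case (Ite c a b)
  then show ?case by (rule comp_ok_Ite)
next
  case (Bind a b)
  then show ?case by (rule comp_ok_Bind)
next
  case (Fold l a b)
  then show ?case by (rule comp_ok_fold)
next
  case (Call f as)
  then show ?case by (intro comp_ok_Call comps_okI)
qed

section \<open>The clock\<close>

definition count_loop :: com where
  "count_loop = While (Is_cell (Var 2)) (Seq (Assign 2 (Snd (Var 2))) (Assign 1 (Plus (Var 1) (Const 1))))"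

definition square_loop :: com where
  "square_loop = While (Var 2) (Seq (Assign 2 (Minus (Var 2) (Const 1))) (Assign 3 (Plus (Var 3) (Var 1))))"

definition square_clock :: com where
  "square_clock = Seq (Seq (Seq (Assign 2 (Var 1)) (Assign 3 (Const 0))) square_loop) (Assign 1 (Var 3))"

definition init_clock :: com where
  "init_clock = Seq (Seq (Seq (Seq (Assign 1 (Const 2)) (Assign 2 (Fst (Snd (Var 0))))) count_loop)
     (Assign 2 (Snd (Snd (Var 0))))) count_loop"

text \<open>Three squarings give the clock the exponent 8, the first power of two above the exponent
  6 that the size estimates in \<open>den_mainP\<close> produce.\<close>

definition compile :: "fe \<Rightarrow> com" where
  "compile e = Seq (Seq (Seq (Seq (Seq init_clock square_clock) square_clock) square_clock)
     (cmp e [0] 2)) (Assign 0 (Var 2))"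

lemma exec_count_loop:
  assumes "s 2 = v" "s 1 = Atom c"
  shows "\<exists>s'. exec count_loop s (5 * length (elems v) + 1) s' \<and> s' 1 = Atom (c + length (elems v)) \<and> s' 0 = s 0"
  using assms
proof (induction v arbitrary: s c)
  case (Atom n)
  then show ?case unfolding count_loop_def
    by (intro exI[of _ s]) (auto intro!: exec_While_False[unfolded One_nat_def] simp: bool_val_def)
next
  case (Cell x w)
  let ?s1 = "s(2 := w, 1 := Atom (c + 1))"
  have "exec (Seq (Assign 2 (Snd (Var 2))) (Assign 1 (Plus (Var 1) (Const 1)))) s 3 ?s1"
    by (rule exec_mono[OF exec_Seq[OF exec_Assign'[of "s(2 := w)"] exec_Assign']])
       (use Cell.prems in auto)
  moreover have "?s1 2 = w" "?s1 1 = Atom (c + 1)" by simp_all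
  from Cell.IH(2)[OF this] obtain s' where s': "exec count_loop ?s1 (5 * length (elems w) + 1) s'"
      "s' 1 = Atom (c + 1 + length (elems w))" "s' 0 = ?s1 0"
    by blast
  ultimately have "exec count_loop s (3 + (5 * length (elems w) + 1) + 2) s'"
    unfolding count_loop_def
    by (intro exec_While_True[of _ _ _ 3 ?s1]) (use Cell.prems in \<open>auto simp: bool_val_def\<close>)
  with s' show ?case by (intro exI[of _ s']) (auto simp: algebra_simps)
qed

lemma exec_square_loop:
  assumes "s 2 = Atom c" "s 1 = Atom m" "s 3 = Atom a"
  shows "\<exists>s'. exec square_loop s (5 * c + 1) s' \<and> s' 3 = Atom (a + c * m) \<and> s' 0 = s 0"
  using assms
proof (induction c arbitrary: s a)
  case 0
  then show ?case unfolding square_loop_def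
    by (intro exI[of _ s]) (auto intro!: exec_While_False[unfolded One_nat_def])
next
  case (Suc c)
  let ?s1 = "s(2 := Atom c, 3 := Atom (a + m))"
  have "exec (Seq (Assign 2 (Minus (Var 2) (Const 1))) (Assign 3 (Plus (Var 3) (Var 1)))) s 3 ?s1"
    by (rule exec_mono[OF exec_Seq[OF exec_Assign'[of "s(2 := Atom c)"] exec_Assign']])
       (use Suc.prems in auto)
  moreover have "?s1 2 = Atom c" "?s1 1 = Atom m" "?s1 3 = Atom (a + m)" using Suc.prems by simp_all
  from Suc.IH[OF this] obtain s' where s': "exec square_loop ?s1 (5 * c + 1) s'"
      "s' 3 = Atom (a + m + c * m)" "s' 0 = ?s1 0"
    by blast
  ultimately have "exec square_loop s (3 + (5 * c + 1) + 2) s'"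
    unfolding square_loop_def
    by (intro exec_While_True[of _ _ _ 3 ?s1]) (use Suc.prems in auto)
  with s' show ?case by (intro exI[of _ s']) (auto simp: algebra_simps)
qed

lemma exec_square_clock:
  assumes "s 1 = Atom m"
  shows "\<exists>s'. exec square_clock s (5 * m + 7) s' \<and> s' 1 = Atom (m ^ 2) \<and> s' 0 = s 0"
proof -
  let ?s1 = "s(2 := Atom m, 3 := Atom 0)"
  have e1: "exec (Seq (Assign 2 (Var 1)) (Assign 3 (Const 0))) s 3 ?s1"
    by (rule exec_mono[OF exec_Seq[OF exec_Assign'[of "s(2 := Atom m)"] exec_Assign']])
       (use assms in auto)
  obtain s2 where s2: "exec square_loop ?s1 (5 * m + 1) s2" "s2 3 = Atom (m * m)" "s2 0 = s 0"
    using exec_square_loop[of ?s1 m m 0] assms by auto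
  have "exec square_clock s (5 * m + 7) (s2(1 := Atom (m * m)))"
    unfolding square_clock_def
    by (rule exec_mono[OF exec_Seq[OF exec_Seq[OF e1 s2(1)] exec_Assign']]) (use s2 in auto)
  then show ?thesis
    by (intro exI[of _ "s2(1 := Atom (m * m))"]) (use s2 in \<open>auto simp: power2_eq_square\<close>)
qed

lemma exec_init_clock:
  assumes "s 0 = Cell x (Cell v w)"
  shows "\<exists>s'. exec init_clock s (5 * (length (elems v) + length (elems w)) + 9) s' \<and>
    s' 1 = Atom (length (elems v) + length (elems w) + 2) \<and> s' 0 = s 0"
proof -
  let ?s1 = "s(1 := Atom 2, 2 := v)"
  have e1: "exec (Seq (Assign 1 (Const 2)) (Assign 2 (Fst (Snd (Var 0))))) s 3 ?s1"
    by (rule exec_mono[OF exec_Seq[OF exec_Assign'[of "s(1 := Atom 2)"] exec_Assign']])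
       (use assms in auto)
  obtain s2 where s2: "exec count_loop ?s1 (5 * length (elems v) + 1) s2"
      "s2 1 = Atom (2 + length (elems v))" "s2 0 = s 0"
    using exec_count_loop[of ?s1 v 2] by auto
  let ?s3 = "s2(2 := w)"
  have e3: "exec (Assign 2 (Snd (Snd (Var 0)))) s2 1 ?s3"
    by (rule exec_Assign') (use s2(3) assms in auto)
  obtain s4 where s4: "exec count_loop ?s3 (5 * length (elems w) + 1) s4"
      "s4 1 = Atom (2 + length (elems v) + length (elems w))" "s4 0 = ?s3 0"
    using exec_count_loop[of ?s3 w "2 + length (elems v)"] s2(2) by auto
  have "exec init_clock s (5 * (length (elems v) + length (elems w)) + 9) s4"
    unfolding init_clock_def
    by (rule exec_mono[OF exec_Seq[OF exec_Seq[OF exec_Seq[OF e1 s2(1)] e3] s4(1)]]) simp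
  with s2 s4 show ?thesis by (intro exI[of _ s4]) auto
qed

lemma poly_nat_mono: "x \<le> y \<Longrightarrow> poly p x \<le> poly p y" for p :: "nat poly"
  by (induction p) (auto intro: add_mono mult_mono)

lemma compile_correct:
  fixes v w :: val
  defines "m \<equiv> length (elems v) + length (elems w) + 2"
  assumes "u = Cell x (Cell v w)"
  shows "\<exists>s'. exec (compile e) ((\<lambda>_. Atom 0)(0 := u))
    (poly ([:50:] * [:0, 1:] ^ 8 + pcompose (cost e) ([:0, 1:] ^ 8)) m) s' \<and> s' 0 = den (m ^ 8) e [u]"
proof -
  let ?s = "(\<lambda>_. Atom 0)(0 := u) :: store"
  obtain s1 where s1: "exec init_clock ?s (5 * (length (elems v) + length (elems w)) + 9) s1"
      "s1 1 = Atom m" "s1 0 = u"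
    using exec_init_clock[of ?s x v w] assms by (auto simp: m_def)
  obtain s2 where s2: "exec square_clock s1 (5 * m + 7) s2" "s2 1 = Atom (m ^ 2)" "s2 0 = u"
    using exec_square_clock[of s1 m, OF s1(2)] s1(3) by auto
  obtain s3 where s3: "exec square_clock s2 (5 * m ^ 2 + 7) s3" "s3 1 = Atom (m ^ 4)" "s3 0 = u"
    using exec_square_clock[of s2 "m ^ 2", OF s2(2)] s2(3) by (auto simp flip: power_mult)
  obtain s4 where s4: "exec square_clock s3 (5 * m ^ 4 + 7) s4" "s4 1 = Atom (m ^ 8)" "s4 0 = u"
    using exec_square_clock[of s3 "m ^ 4", OF s3(2)] s3(3) by (auto simp flip: power_mult)
  have "env_ok (m ^ 8) [u] [0] 2 s4" using s4 by (auto simp: env_ok_def)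
  then obtain s5 where s5: "exec (cmp e [0] 2) s4 (poly (cost e) (m ^ 8)) s5" "s5 2 = den (m ^ 8) e [u]"
    using comp_correct[of "m ^ 8" e] by (auto elim: comp_okE)
  have m: "2 \<le> m" "length (elems v) + length (elems w) + 2 = m" by (simp_all add: m_def)
  \<comment> \<open>The clock starts at 2, so \<open>m ^ 8\<close> is at least 256 and absorbs all
    additive constants of the sequential composition.\<close>
  have p: "m \<le> m ^ 8" "m ^ 2 \<le> m ^ 8" "m ^ 4 \<le> m ^ 8" "256 \<le> m ^ 8"
    using m power_increasing[of 1 8 m] power_increasing[of 2 8 m] power_increasing[of 4 8 m]
      power_mono[OF m(1), of 8] by auto
  have "exec (compile e) ?s (poly ([:50:] * [:0, 1:] ^ 8 + pcompose (cost e) ([:0, 1:] ^ 8)) m)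
      (s5(0 := s5 2))"
    unfolding compile_def
  proof (rule exec_mono[OF exec_Seq[OF exec_Seq[OF exec_Seq[OF exec_Seq[OF exec_Seq[OF
        s1(1) s2(1)] s3(1)] s4(1)] s5(1)] exec_Assign']])
    show "s5(0 := s5 2) = s5(0 := eval_expr (Var 2) s5)" by simp
    show "5 * (length (elems v) + length (elems w)) + 9 + (5 * m + 7) + 1 + (5 * m\<^sup>2 + 7) + 1 +
      (5 * m ^ 4 + 7) + 1 + poly (cost e) (m ^ 8) + 1 + 1 + 1
      \<le> poly ([:50:] * [:0, 1:] ^ 8 + pcompose (cost e) ([:0, 1:] ^ 8)) m"
    proof -
      have eq: "poly ([:50:] * [:0, 1:] ^ 8 + pcompose (cost e) ([:0, 1:] ^ 8)) m = 50 * m ^ 8 + poly (cost e) (m ^ 8)"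
        by (simp add: poly_pcompose)
      have bound: "5 * a + 9 + (5 * m + 7) + 1 + (5 * b + 7) + 1 + (5 * c + 7) + 1 + d + 1 + 1 + 1
          \<le> 50 * z + d"
        if "a \<le> z" "m \<le> z" "b \<le> z" "c \<le> z" "256 \<le> z" for a b c d z :: nat
        using that by linarith
      have "length (elems v) + length (elems w) \<le> m ^ 8"
        using p(1) m(2) by linarith
      then show ?thesis unfolding eq by (rule bound) (fact p)+
    qed
  qed
  then show ?thesis using s5(2) by (intro exI[of _ "s5(0 := s5 2)"]) simp
qed

lemma elems_enc_list [simp]: "elems (enc_list f xs) = map f xs"
  by (induction xs) (auto simp: enc_list_def)

lemma length_le_val_size: "length (elems v) \<le> val_size v"
  by (induction v) auto

text \<open>The list lengths that feed the clock are at most the input size. Shifting the argument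
  by 2 therefore turns a time bound in the base of the clock into one in the input size, with a
  polynomial that depends on the program alone.\<close>

lemma compile_polytime:
  "\<exists>p. \<forall>n es ts. let x = enc_input n es ts in
     \<exists>s'. run (poly p (val_size x)) (initial (compile e) x) = return_pmf (Skip, s') \<and>
       s' 0 = den ((length es + length ts + 2) ^ 8) e [x]"
proof -
  let ?q = "[:50:] * [:0, 1:] ^ 8 + pcompose (cost e) ([:0, 1:] ^ 8)"
  let ?p = "pcompose ?q [:2, 1:]"
  have "\<exists>s'. run (poly ?p (val_size x)) (initial (compile e) x) = return_pmf (Skip, s') \<and>
       s' 0 = den ((length es + length ts + 2) ^ 8) e [x]"
    if x: "x = enc_input n es ts" for x n es ts
  proof -
    obtain s' where s': "exec (compile e) ((\<lambda>_. Atom 0)(0 := x)) (poly ?q (length es + length ts + 2)) s'"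
      "s' 0 = den ((length es + length ts + 2) ^ 8) e [x]"
      using compile_correct[of x "Atom n" "enc_edges es" "enc_list enc_edges ts" e] x
      by (auto simp: enc_input_def enc_edges_def)
    have "length es + length ts \<le> val_size x"
      using length_le_val_size[of "enc_edges es"] length_le_val_size[of "enc_list enc_edges ts"] x
      by (simp add: enc_input_def enc_edges_def)
    then have "poly ?q (length es + length ts + 2) \<le> poly ?q (2 + val_size x)"
      by (intro poly_nat_mono) simp
    also have "\<dots> = poly ?p (val_size x)" by (simp add: poly_pcompose)
    finally have "exec (compile e) ((\<lambda>_. Atom 0)(0 := x)) (poly ?p (val_size x)) s'"
      by (rule exec_mono[OF s'(1)])
    with s'(2) show ?thesis unfolding initial_def by (auto dest: exec_run)
  qed
  then show ?thesis by (intro exI[of _ ?p]) (auto simp: Let_def)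
qed

section \<open>The algorithm on lists\<close>

type_synonym edge = "nat \<times> nat"
type_synonym label = "nat \<times> nat list"
type_synonym table = "(nat \<times> label) list"
type_synonym selection = "(edge \<times> nat list) list"

definition ends :: "'a \<times> 'a \<Rightarrow> 'a set" where
  "ends e = {fst e, snd e}"

text \<open>A tree edge doubles its weight after \<open>k\<close> uses, a non-tree edge after every use.\<close>

definition wt_step :: "nat \<Rightarrow> nat \<Rightarrow> bool \<Rightarrow> edge \<Rightarrow> nat \<times> nat" where
  "wt_step k i b cw = (if b then (if fst cw + i < k then (fst cw + i, snd cw) else (0, 2 * snd cw)) else cw)"

text \<open>One number plays two roles, initial weight and counter increment. With increment
  \<open>k\<close> every single use reaches the threshold of \<open>wt_step\<close>, which is why
  non-tree edges double at once.\<close>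

definition unit_of :: "nat \<Rightarrow> edge list \<Rightarrow> edge \<Rightarrow> nat" where
  "unit_of k t f = (if ends f \<in> ends ` set t then 1 else k)"

text \<open>Weights are recomputed from the log of used edges on every request, so no weight table
  has to be stored. The log is newest first, but only the number of occurrences matters.\<close>

definition wt_state :: "nat \<Rightarrow> edge list \<Rightarrow> edge list \<Rightarrow> edge \<Rightarrow> nat \<times> nat" where
  "wt_state k t lg f =
     foldl (\<lambda>cw g. wt_step k (unit_of k t f) (ends f = ends g) cw) (0, unit_of k t f) lg"

definition wt :: "nat \<Rightarrow> edge list \<Rightarrow> edge list \<Rightarrow> edge \<Rightarrow> nat" where
  "wt k t lg f = snd (wt_state k t lg f)"

text \<open>Labels are read from \<open>src\<close>, the table of the previous round, and written to
  \<open>acc\<close>; hence one round prolongs a path by at most one edge, which keeps the count of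
  non-tree edges exact. Better labels are consed in front and shadow older ones under
  \<open>map_of\<close>. Paths grow at the head and end in the source.\<close>

definition relax :: "table \<Rightarrow> table \<Rightarrow> nat \<Rightarrow> nat \<Rightarrow> nat \<Rightarrow> table" where
  "relax src acc a b w = (case map_of src a of None \<Rightarrow> acc | Some (c, p) \<Rightarrow>
     (case map_of acc b of None \<Rightarrow> (b, c + w, b # p) # acc
      | Some (c', _) \<Rightarrow> if c + w < c' then (b, c + w, b # p) # acc else acc))"

definition relax2 :: "table \<Rightarrow> table \<Rightarrow> edge \<times> nat \<Rightarrow> table" where
  "relax2 src acc x = relax src (relax src acc (fst (fst x)) (snd (fst x)) (snd x)) (snd (fst x)) (fst (fst x)) (snd x)"

definition relax_round :: "(edge \<times> nat) list \<Rightarrow> table \<Rightarrow> table" where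
  "relax_round wes src = foldl (relax2 src) src wes"

definition dp_init :: "(edge \<times> nat) list \<Rightarrow> nat \<Rightarrow> nat \<Rightarrow> table" where
  "dp_init te m u = (relax_round te ^^ m) [(u, 0, [u])]"

text \<open>Bellman-Ford in layers: each of the \<open>R\<close> rounds spends one non-tree edge and
  is followed by \<open>m\<close> tree rounds, enough for any stretch of at most \<open>m\<close>
  tree edges.\<close>

definition dp :: "(edge \<times> nat) list \<Rightarrow> (edge \<times> nat) list \<Rightarrow> nat \<Rightarrow> nat \<Rightarrow> nat \<Rightarrow> table" where
  "dp te ne m R u = ((\<lambda>tab. (relax_round te ^^ m) (relax_round ne tab)) ^^ R) (dp_init te m u)"

definition weighted :: "(edge \<Rightarrow> bool) \<Rightarrow> (edge \<Rightarrow> nat) \<Rightarrow> edge list \<Rightarrow> (edge \<times> nat) list" where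
  "weighted Q w es = rev (map (\<lambda>e. (e, w e)) (filter Q es))"

text \<open>A pair in \<open>U\<close> records that its second edge served as a non-tree edge on the
  path found for its first edge. Comparison goes through \<open>ends\<close> because paths may
  traverse an edge against its listed orientation.\<close>

definition conflict :: "edge \<Rightarrow> edge \<Rightarrow> (edge \<times> edge) list \<Rightarrow> bool" where
  "conflict e f U \<longleftrightarrow> (\<exists>x\<in>set U. ends e = ends (fst x) \<and> ends f = ends (snd x))"

definition tree_sel :: "nat \<Rightarrow> edge list \<Rightarrow> edge list \<Rightarrow> edge list \<Rightarrow> (edge \<times> nat) list" where
  "tree_sel k t lg es = weighted (\<lambda>f. ends f \<in> ends ` set t) (wt k t lg) es"

definition nontree_sel where
  "nontree_sel k t lg es e U =
     weighted (\<lambda>f. ends f \<notin> ends ` set t \<and> ends e \<noteq> ends f \<and> \<not> conflict e f U) (wt k t lg) es"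

definition cand where
  "cand k t lg es R U e =
     map_of (dp (tree_sel k t lg es) (nontree_sel k t lg es e U) (length es) R (fst e)) (snd e)"

definition better :: "(label \<times> edge) option \<Rightarrow> label option \<Rightarrow> edge \<Rightarrow> (label \<times> edge) option" where
  "better acc lab e = (case lab of None \<Rightarrow> acc | Some l \<Rightarrow>
     (case acc of None \<Rightarrow> Some (l, e) | Some (l', _) \<Rightarrow> if fst l < fst l' then Some (l, e) else acc))"

definition best where
  "best k t lg es R U cov = foldl (\<lambda>acc e.
     if ends e \<in> ends ` set t then acc else if ends e \<in> ends ` set cov then acc
     else better acc (cand k t lg es R U e) e) None es"

definition path_edges :: "'a list \<Rightarrow> ('a \<times> 'a) list" where
  "path_edges p = zip p (tl p)"

text \<open>If \<open>best\<close> finds nothing the state is returned unchanged, so a fixed number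
  of iterations can be run and surplus ones are harmless.\<close>

definition step_alg where
  "step_alg k es R t st = (case st of (cov, lg, U, out) \<Rightarrow>
     (case best k t lg es R U cov of None \<Rightarrow> st | Some ((c, p), e) \<Rightarrow>
       (e # cov, rev (path_edges p) @ lg,
        rev (map (Pair e) (filter (\<lambda>f. ends f \<notin> ends ` set t) (path_edges p))) @ U, p # out)))"

text \<open>Covered edges and the log start afresh for every tree; only the forbidden pairs and the
  output are handed on. Load bounds are therefore per tree and get summed at the end.\<close>

definition stage_alg where
  "stage_alg k es R UO t = snd (snd ((step_alg k es R t ^^ length es) ([], [], UO)))"

text \<open>Yields \<open>2 * L + 2\<close> for the least power \<open>2 ^ L\<close> that reaches
  \<open>n\<close>, provided \<open>m\<close> doublings suffice. Doubling replaces a logarithm,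
  which the language lacks as a primitive.\<close>

definition rounds_for :: "nat \<Rightarrow> nat \<Rightarrow> nat" where
  "rounds_for n m = snd (((\<lambda>(j, R). if j < n then (2 * j, R + 2) else (j, R)) ^^ m) (1, 2))"

definition main_alg where
  "main_alg n es ts =
     snd (foldl (stage_alg (length ts) es (rounds_for n (length es))) ([], []) ts)"

section \<open>The program\<close>

definition eqN :: fe where
  "eqN = Ite (Lt (Arg 0) (Arg 1)) (Lit 0) (Ite (Lt (Arg 1) (Arg 0)) (Lit 0) (Lit 1))"

definition eqE :: fe where
  "eqE = Ite (Ite (Call eqN [Hd (Arg 0), Hd (Arg 1)]) (Call eqN [Tl (Arg 0), Tl (Arg 1)]) (Lit 0)) (Lit 1)
     (Ite (Call eqN [Hd (Arg 0), Tl (Arg 1)]) (Call eqN [Tl (Arg 0), Hd (Arg 1)]) (Lit 0))"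

definition memE :: fe where
  "memE = Fold (Arg 1) (Lit 0) (Ite (Call eqE [Arg 0, Arg 3]) (Lit 1) (Arg 2))"

definition confP :: fe where
  "confP = Fold (Arg 2) (Lit 0) (Ite (Call eqE [Arg 0, Hd (Arg 4)])
     (Ite (Call eqE [Arg 1, Tl (Arg 4)]) (Lit 1) (Arg 3)) (Arg 3))"

definition wtP :: fe where
  "wtP = Bind (Ite (Call memE [Arg 3, Arg 1]) (Lit 1) (Arg 0))
     (Tl (Fold (Arg 2) (Pr (Lit 0) (Arg 4))
       (Ite (Call eqE [Arg 3, Arg 6])
         (Ite (Lt (Add (Hd (Arg 5)) (Arg 4)) (Arg 0)) (Pr (Add (Hd (Arg 5)) (Arg 4)) (Tl (Arg 5)))
            (Pr (Lit 0) (Add (Tl (Arg 5)) (Tl (Arg 5)))))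
         (Arg 5))))"

definition lookP :: fe where
  "lookP = Fold (Arg 1) (Lit 0) (Ite (Isc (Arg 2)) (Arg 2)
     (Ite (Call eqN [Arg 0, Hd (Arg 3)]) (Tl (Arg 3)) (Arg 2)))"

definition relaxP :: fe where
  "relaxP = Bind (Call lookP [Arg 2, Arg 0])
     (Ite (Isc (Arg 5))
       (Bind (Call lookP [Arg 3, Arg 1])
         (Bind (Add (Hd (Arg 5)) (Arg 4))
           (Ite (Ite (Isc (Arg 6)) (Lt (Arg 7) (Hd (Arg 6))) (Lit 1))
             (Pr (Pr (Arg 3) (Pr (Arg 7) (Pr (Arg 3) (Tl (Arg 5))))) (Arg 1)) (Arg 1))))
       (Arg 1))"

definition roundP :: fe where
  "roundP = Fold (Arg 0) (Arg 1)
     (Call relaxP [Arg 1, Call relaxP [Arg 1, Arg 2, Hd (Hd (Arg 3)), Tl (Hd (Arg 3)), Tl (Arg 3)],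
        Tl (Hd (Arg 3)), Hd (Hd (Arg 3)), Tl (Arg 3)])"

definition tree_roundsP :: fe where
  "tree_roundsP = Fold (Arg 1) (Arg 2) (Call roundP [Arg 0, Arg 3])"

definition dpP :: fe where
  "dpP = Fold (Arg 3)
     (Call tree_roundsP [Arg 0, Arg 2, Pr (Pr (Arg 4) (Pr (Lit 0) (Pr (Arg 4) (Lit 0)))) (Lit 0)])
     (Call tree_roundsP [Arg 0, Arg 2, Call roundP [Arg 1, Arg 5]])"

definition tree_selP :: fe where
  "tree_selP = Fold (Arg 3) (Lit 0) (Ite (Call memE [Arg 5, Arg 1])
     (Pr (Pr (Arg 5) (Call wtP [Arg 0, Arg 1, Arg 2, Arg 5])) (Arg 4)) (Arg 4))"

definition nontree_selP :: fe where
  "nontree_selP = Fold (Arg 3) (Lit 0) (Ite (Call memE [Arg 7, Arg 1]) (Arg 6)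
     (Ite (Call eqE [Arg 4, Arg 7]) (Arg 6) (Ite (Call confP [Arg 4, Arg 7, Arg 5]) (Arg 6)
       (Pr (Pr (Arg 7) (Call wtP [Arg 0, Arg 1, Arg 2, Arg 7])) (Arg 6)))))"

definition best_bodyP :: fe where
  "best_bodyP = Ite (Call memE [Arg 9, Arg 1]) (Arg 8)
     (Ite (Call memE [Arg 9, Arg 6]) (Arg 8)
       (Bind (Call lookP [Tl (Arg 9), Call dpP [Arg 7,
           Call nontree_selP [Arg 0, Arg 1, Arg 2, Arg 3, Arg 9, Arg 5], Arg 3, Arg 4, Hd (Arg 9)]])
         (Ite (Isc (Arg 10))
           (Ite (Ite (Isc (Arg 8)) (Lt (Hd (Arg 10)) (Hd (Hd (Arg 8)))) (Lit 1)) (Pr (Arg 10) (Arg 9)) (Arg 8))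
           (Arg 8))))"

definition bestP :: fe where
  "bestP = Bind (Call tree_selP [Arg 0, Arg 1, Arg 2, Arg 3]) (Fold (Arg 3) (Lit 0) best_bodyP)"

text \<open>The accumulator \<open>Arg 7\<close> holds the previous vertex, the log and the
  forbidden pairs; \<open>Arg 8\<close> is the next vertex of the path, so the two together form the
  current edge.\<close>

definition use_edgeP :: fe where
  "use_edgeP = Pr (Arg 8) (Pr (Pr (Pr (Hd (Arg 7)) (Arg 8)) (Hd (Tl (Arg 7))))
     (Ite (Call memE [Pr (Hd (Arg 7)) (Arg 8), Arg 1]) (Tl (Tl (Arg 7)))
       (Pr (Pr (Tl (Arg 5)) (Pr (Hd (Arg 7)) (Arg 8))) (Tl (Tl (Arg 7))))))"

definition stepP :: fe where
  "stepP = Bind (Call bestP [Arg 0, Arg 1, Hd (Tl (Arg 4)), Arg 2, Arg 3, Hd (Tl (Tl (Arg 4))), Hd (Arg 4)])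
     (Ite (Isc (Arg 5))
       (Bind (Tl (Hd (Arg 5)))
         (Bind (Fold (Tl (Arg 6)) (Pr (Hd (Arg 6)) (Pr (Hd (Tl (Arg 4))) (Hd (Tl (Tl (Arg 4)))))) use_edgeP)
           (Pr (Pr (Tl (Arg 5)) (Hd (Arg 4)))
             (Pr (Hd (Tl (Arg 7))) (Pr (Tl (Tl (Arg 7))) (Pr (Arg 6) (Tl (Tl (Tl (Arg 4))))))))))
       (Arg 4))"

definition stageP :: fe where
  "stageP = Tl (Tl (Fold (Arg 1) (Pr (Lit 0) (Pr (Lit 0) (Arg 4)))
     (Call stepP [Arg 0, Arg 3, Arg 1, Arg 2, Arg 5])))"

text \<open>The round count is kept in unary, as a list of zeros, because the only loop is a fold
  over a list. Two more rounds means consing two zeros.\<close>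

definition doubleP :: fe where
  "doubleP = Ite (Lt (Hd (Arg 2)) (Hd (Arg 0)))
     (Pr (Add (Hd (Arg 2)) (Hd (Arg 2))) (Pr (Lit 0) (Pr (Lit 0) (Tl (Arg 2))))) (Arg 2)"

definition mainP :: fe where
  "mainP = Bind (Fold (Tl (Tl (Arg 0))) (Lit 0) (Add (Arg 1) (Lit 1)))
     (Bind (Tl (Fold (Hd (Tl (Arg 0))) (Pr (Lit 1) (Pr (Lit 0) (Pr (Lit 0) (Lit 0)))) doubleP))
       (Tl (Fold (Tl (Tl (Arg 0))) (Pr (Lit 0) (Lit 0))
         (Call stageP [Arg 1, Hd (Tl (Arg 0)), Arg 2, Arg 4, Arg 3]))))"

section \<open>Correctness of the program\<close>

fun enc_edge :: "edge \<Rightarrow> val" where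
  "enc_edge (u, v) = Cell (Atom u) (Atom v)"

abbreviation enc_es :: "edge list \<Rightarrow> val" where
  "enc_es \<equiv> enc_list enc_edge"

definition enc_wedge :: "edge \<times> nat \<Rightarrow> val" where
  "enc_wedge x = Cell (enc_edge (fst x)) (Atom (snd x))"

definition enc_label :: "label \<Rightarrow> val" where
  "enc_label l = Cell (Atom (fst l)) (enc_list Atom (snd l))"

definition enc_entry :: "nat \<times> label \<Rightarrow> val" where
  "enc_entry x = Cell (Atom (fst x)) (enc_label (snd x))"

definition enc_opt :: "('a \<Rightarrow> val) \<Rightarrow> 'a option \<Rightarrow> val" where
  "enc_opt f x = (case x of None \<Rightarrow> Atom 0 | Some y \<Rightarrow> f y)"

definition enc_found :: "label \<times> edge \<Rightarrow> val" where
  "enc_found x = Cell (enc_label (fst x)) (enc_edge (snd x))"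

definition enc_used :: "edge \<times> edge \<Rightarrow> val" where
  "enc_used x = Cell (enc_edge (fst x)) (enc_edge (snd x))"

lemma enc_edges_eq: "enc_edges = enc_es"
  unfolding enc_edges_def by (rule arg_cong[where f = enc_list]) auto

lemma fst_of_enc_edge [simp]: "fst_of (enc_edge e) = Atom (fst e)"
  and snd_of_enc_edge [simp]: "snd_of (enc_edge e) = Atom (snd e)"
  by (cases e; simp)+

lemma enc_list_Nil [simp]: "enc_list f [] = Atom 0"
  and enc_list_Cons [simp]: "enc_list f (x # xs) = Cell (f x) (enc_list f xs)"
  by (simp_all add: enc_list_def)

lemma is_true_bool_val [simp]: "is_true (bool_val b) = b"
  by (simp add: bool_val_def)

text \<open>The invariant is indexed by the number of consumed elements: lists grow during a fold,
  and each iteration is correct only while they are still shorter than the clock.\<close>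

lemma fold_elems_inv:
  assumes "length xs \<le> M" "I 0 a" "v = enc a"
    and "\<And>i acc. i < length xs \<Longrightarrow> I i acc \<Longrightarrow>
       f (enc acc) (g (xs ! i)) = enc (F acc (xs ! i)) \<and> I (Suc i) (F acc (xs ! i))"
  shows "fold_elems M f v (enc_list g xs) = enc (foldl F a xs) \<and> I (length xs) (foldl F a xs)"
proof -
  have "foldl f (enc a) (map g (take j xs)) = enc (foldl F a (take j xs)) \<and> I j (foldl F a (take j xs))"
    if "j \<le> length xs" for j
    using that
  proof (induction j)
    case 0
    then show ?case using assms(2) by simp
  next
    case (Suc j)
    then show ?case using assms(4)[of j "foldl F a (take j xs)"]
      by (simp add: take_Suc_conv_app_nth)
  qed
  from this[of "length xs"] assms(1,3) show ?thesis
    by (simp add: fold_elems_def)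
qed

lemma fold_elems_enc:
  assumes "length xs \<le> M" "v = enc a"
    and "\<And>acc x. x \<in> set xs \<Longrightarrow> f (enc acc) (g x) = enc (F acc x)"
  shows "fold_elems M f v (enc_list g xs) = enc (foldl F a xs)"
  using fold_elems_inv[where I = "\<lambda>_ _. True" and xs = xs and f = f and g = g and F = F and enc = enc] assms
  by auto

lemma foldl_const: "foldl (\<lambda>x _. f x) a xs = (f ^^ length xs) a"
  by (induction xs arbitrary: a) (auto simp: funpow_swap1)

lemma den_eqN [simp]: "den M eqN [Atom a, Atom b] = bool_val (a = b)"
  by (auto simp: eqN_def bool_val_def)

lemma den_eqE [simp]: "den M eqE [enc_edge e, enc_edge f] = bool_val (ends e = ends f)"
  by (cases e; cases f) (auto simp: eqE_def ends_def bool_val_def doubleton_eq_iff)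

lemma foldl_bex: "foldl (\<lambda>acc x. if Q x then True else acc) b xs \<longleftrightarrow> b \<or> (\<exists>x\<in>set xs. Q x)"
  by (induction xs arbitrary: b) auto

lemma den_memE:
  assumes "length xs \<le> M"
  shows "den M memE [enc_edge e, enc_es xs] = bool_val (ends e \<in> ends ` set xs)"
proof -
  have "den M memE [enc_edge e, enc_es xs] =
    bool_val (foldl (\<lambda>acc x. if ends e = ends x then True else acc) False xs)"
    unfolding memE_def den.simps dens.simps
    by (simp, rule fold_elems_enc[OF assms]) (auto simp: bool_val_def)
  then show ?thesis by (simp add: foldl_bex image_iff)
qed

lemma den_confP:
  assumes "length U \<le> M"
  shows "den M confP [enc_edge e, enc_edge f, enc_list enc_used U] = bool_val (conflict e f U)"
proof -
  have "den M confP [enc_edge e, enc_edge f, enc_list enc_used U] =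
    bool_val (foldl (\<lambda>acc x. if ends e = ends (fst x) \<and> ends f = ends (snd x) then True else acc) False U)"
    unfolding confP_def den.simps dens.simps
    by (simp, rule fold_elems_enc[OF assms]) (auto simp: enc_used_def bool_val_def)
  then show ?thesis by (auto simp: foldl_bex conflict_def)
qed

definition enc_pair :: "('a \<Rightarrow> val) \<Rightarrow> ('b \<Rightarrow> val) \<Rightarrow> 'a \<times> 'b \<Rightarrow> val" where
  "enc_pair f g x = Cell (f (fst x)) (g (snd x))"

lemma den_wtP:
  assumes "length lg \<le> M" "length t \<le> M"
  shows "den M wtP [Atom k, enc_es t, enc_es lg, enc_edge f] = Atom (wt k t lg f)"
proof -
  have "den M wtP [Atom k, enc_es t, enc_es lg, enc_edge f] =
    snd_of (enc_pair Atom Atom (wt_state k t lg f))"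
    unfolding wt_state_def
    by (cases "ends f \<in> ends ` set t";
        simp add: wtP_def den_memE[OF assms(2)] unit_of_def del: image_iff;
        rule arg_cong[where f = snd_of]; rule fold_elems_enc[OF assms(1)])
       (auto simp: wt_step_def bool_val_def enc_pair_def)
  then show ?thesis by (simp add: wt_def enc_pair_def)
qed

lemma map_of_foldl:
  "foldl (\<lambda>acc x. if acc = None then if v = fst x then Some (snd x) else None else acc) a xs =
    (if a = None then map_of xs v else a)"
  by (induction xs arbitrary: a) auto

lemma is_cell_enc_label [simp]: "is_cell (enc_label l)"
  by (simp add: enc_label_def)

lemma is_cell_enc_opt_label [simp]: "is_cell (enc_opt enc_label x) \<longleftrightarrow> x \<noteq> None"
  by (auto simp: enc_opt_def split: option.splits)

lemma den_lookP:
  assumes "length tab \<le> M"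
  shows "den M lookP [Atom v, enc_list enc_entry tab] = enc_opt enc_label (map_of tab v)"
proof -
  have "den M lookP [Atom v, enc_list enc_entry tab] = enc_opt enc_label
     (foldl (\<lambda>acc x. if acc = None then if v = fst x then Some (snd x) else None else acc) None tab)"
    by (simp add: lookP_def, rule fold_elems_enc[OF assms]) (auto simp: enc_opt_def enc_entry_def)
  then show ?thesis by (simp add: map_of_foldl)
qed

lemma den_relaxP:
  assumes "length src \<le> M" "length acc \<le> M"
  shows "den M relaxP [enc_list enc_entry src, enc_list enc_entry acc, Atom a, Atom b, Atom w] =
    enc_list enc_entry (relax src acc a b w)"
  using assms
  by (auto simp: relaxP_def relax_def den_lookP enc_opt_def enc_entry_def enc_label_def bool_val_def
      split: option.splits)

text \<open>Each relaxation adds at most one entry, and each round at most one vertex per path since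
  it reads from the old table. These two counters carry the whole size analysis of the dynamic
  program.\<close>

definition tab_ok :: "nat \<Rightarrow> nat \<Rightarrow> table \<Rightarrow> bool" where
  "tab_ok N B tab \<longleftrightarrow> length tab \<le> N \<and> (\<forall>x\<in>set tab. snd (snd x) \<noteq> [] \<and> length (snd (snd x)) \<le> B)"

lemma tab_ok_relax:
  assumes "tab_ok N B src" "tab_ok N' (Suc B) acc"
  shows "tab_ok (Suc N') (Suc B) (relax src acc a b w)"
proof (cases "map_of src a")
  case None
  then show ?thesis using assms by (auto simp: relax_def tab_ok_def)
next
  case (Some l)
  then have "(a, l) \<in> set src" by (rule map_of_SomeD)
  then have "length (snd l) \<le> B" using assms(1) by (force simp: tab_ok_def)
  moreover have "relax src acc a b w \<in> {acc, (b, fst l + w, b # snd l) # acc}"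
    using Some by (auto simp: relax_def split: prod.splits option.splits)
  ultimately show ?thesis using assms(2) by (auto simp: tab_ok_def)
qed

lemma tab_ok_mono: "tab_ok N B tab \<Longrightarrow> N \<le> N' \<Longrightarrow> B \<le> B' \<Longrightarrow> tab_ok N' B' tab"
  unfolding tab_ok_def by fastforce

lemma den_roundP:
  assumes src: "tab_ok N B src" and M: "length wes \<le> M" "N + 2 * length wes \<le> M"
  shows "den M roundP [enc_list enc_wedge wes, enc_list enc_entry src] = enc_list enc_entry (relax_round wes src)"
    and "tab_ok (N + 2 * length wes) (Suc B) (relax_round wes src)"
proof -
  have N: "length src \<le> M" using src M by (simp add: tab_ok_def)
  have "den M roundP [enc_list enc_wedge wes, enc_list enc_entry src] =
      enc_list enc_entry (foldl (relax2 src) src wes) \<and>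
    tab_ok (N + 2 * length wes) (Suc B) (foldl (relax2 src) src wes)"
    unfolding roundP_def den.simps dens.simps
  proof (simp, rule fold_elems_inv[OF M(1), where I = "\<lambda>i. tab_ok (N + 2 * i) (Suc B)"])
    show "tab_ok (N + 2 * 0) (Suc B) src"
      using src by (auto intro: tab_ok_mono)
    fix i acc assume i: "i < length wes" and acc: "tab_ok (N + 2 * i) (Suc B) acc"
    obtain a b w where x: "wes ! i = ((a, b), w)" by (metis prod.collapse)
    have acc': "tab_ok (Suc (N + 2 * i)) (Suc B) (relax src acc a b w)"
      by (rule tab_ok_relax[OF src acc])
    have l: "length acc \<le> M" "length (relax src acc a b w) \<le> M"
      using acc acc' i M by (auto simp: tab_ok_def)
    show "den M relaxP
         [enc_list enc_entry src,
          den M relaxP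
           [enc_list enc_entry src, enc_list enc_entry acc, fst_of (fst_of (enc_wedge (wes ! i))),
            snd_of (fst_of (enc_wedge (wes ! i))), snd_of (enc_wedge (wes ! i))],
          snd_of (fst_of (enc_wedge (wes ! i))), fst_of (fst_of (enc_wedge (wes ! i))),
          snd_of (enc_wedge (wes ! i))] =
        enc_list enc_entry (relax2 src acc (wes ! i)) \<and>
        tab_ok (N + 2 * Suc i) (Suc B) (relax2 src acc (wes ! i))"
      using tab_ok_relax[OF src acc'] l N
      by (simp add: x enc_wedge_def den_relaxP relax2_def)
  qed simp
  then show "den M roundP [enc_list enc_wedge wes, enc_list enc_entry src] = enc_list enc_entry (relax_round wes src)"
    "tab_ok (N + 2 * length wes) (Suc B) (relax_round wes src)"
    by (simp_all add: relax_round_def)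
qed

lemma den_tree_roundsP:
  assumes src: "tab_ok N B src" and M: "length te \<le> m" "length es = m" "N + 2 * m * m \<le> M" "m \<le> M"
  shows "den M tree_roundsP [enc_list enc_wedge te, enc_es es, enc_list enc_entry src] =
      enc_list enc_entry ((relax_round te ^^ m) src)"
    and "tab_ok (N + 2 * m * m) (B + m) ((relax_round te ^^ m) src)"
proof -
  have "den M tree_roundsP [enc_list enc_wedge te, enc_es es, enc_list enc_entry src] =
      enc_list enc_entry (foldl (\<lambda>tab _. relax_round te tab) src es) \<and>
    tab_ok (N + 2 * m * length es) (B + length es) (foldl (\<lambda>tab _. relax_round te tab) src es)"
    unfolding tree_roundsP_def den.simps dens.simps
  proof (simp, rule fold_elems_inv[where I = "\<lambda>i. tab_ok (N + 2 * m * i) (B + i)"])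
    show "length es \<le> M" using M by simp
    show "tab_ok (N + 2 * m * 0) (B + 0) src" using src by simp
    fix i acc assume i: "i < length es" and acc: "tab_ok (N + 2 * m * i) (B + i) acc"
    have "2 * m * Suc i \<le> 2 * m * m" using i M by (intro mult_le_mono) auto
    then have *: "N + 2 * m * i + 2 * m \<le> M" using M by simp
    show "den M roundP [enc_list enc_wedge te, enc_list enc_entry acc] = enc_list enc_entry (relax_round te acc) \<and>
         tab_ok (N + 2 * m * Suc i) (B + Suc i) (relax_round te acc)"
      using den_roundP[OF acc, of te M] M * by (auto elim!: tab_ok_mono)
  qed simp
  then show "den M tree_roundsP [enc_list enc_wedge te, enc_es es, enc_list enc_entry src] =
      enc_list enc_entry ((relax_round te ^^ m) src)" "tab_ok (N + 2 * m * m) (B + m) ((relax_round te ^^ m) src)"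
    using M by (simp_all add: foldl_const)
qed

text \<open>There are \<open>m + R * (m + 1)\<close> rounds in total. Each adds at most
  \<open>2 * m\<close> entries, one per orientation of an edge, and at most one vertex per path,
  which gives both bounds.\<close>

lemma den_dpP:
  assumes M: "length te \<le> m" "length ne \<le> m" "length es = m"
    and Rs: "length Rs = R" and bound: "1 + 2 * m * (m + R * (m + 1)) \<le> M" "m \<le> M" "R \<le> M"
  shows "den M dpP [enc_list enc_wedge te, enc_list enc_wedge ne, enc_es es,
       enc_list Atom Rs, Atom u] = enc_list enc_entry (dp te ne m R u)"
    and "tab_ok (1 + 2 * m * (m + R * (m + 1))) (1 + m + R * (m + 1)) (dp te ne m R u)"
proof -
  define I where "I = (\<lambda>i. tab_ok (1 + 2 * m * (m + i * (m + 1))) (1 + m + i * (m + 1)))"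
  let ?F = "\<lambda>tab (_ :: nat). (relax_round te ^^ m) (relax_round ne tab)"
  have init: "tab_ok 1 1 [(u, 0, [u])]" by (simp add: tab_ok_def)
  have bound0: "1 + 2 * m * m \<le> M"
    using bound(1) by (simp add: algebra_simps)
  have e: "enc_list enc_entry [(u, 0, [u])] = Cell (Cell (Atom u) (Cell (Atom 0) (Cell (Atom u) (Atom 0)))) (Atom 0)"
    by (simp add: enc_entry_def enc_label_def)
  note init_den = den_tree_roundsP[OF init M(1,3) bound0 bound(2)]
  have "den M dpP [enc_list enc_wedge te, enc_list enc_wedge ne, enc_es es,
       enc_list Atom Rs, Atom u] = enc_list enc_entry (foldl ?F (dp_init te m u) Rs) \<and>
     I (length Rs) (foldl ?F (dp_init te m u) Rs)"
    unfolding dpP_def den.simps dens.simps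
  proof (simp, rule fold_elems_inv[where I = I])
    show "length Rs \<le> M" using bound Rs by simp
    show "I 0 (dp_init te m u)" using init_den(2) by (simp add: dp_init_def I_def)
    show "den M tree_roundsP [enc_list enc_wedge te, enc_es es,
        Cell (Cell (Atom u) (Cell (Atom 0) (Cell (Atom u) (Atom 0)))) (Atom 0)] =
      enc_list enc_entry (dp_init te m u)"
      using init_den(1) by (simp only: e dp_init_def)
    fix i acc assume i: "i < length Rs" and "I i acc"
    then have acc: "tab_ok (1 + 2 * m * (m + i * (m + 1))) (1 + m + i * (m + 1)) acc"
      by (simp add: I_def)
    have "2 * m * (m + Suc i * (m + 1)) \<le> 2 * m * (m + R * (m + 1))"
      using i Rs by (intro mult_le_mono add_le_mono) auto
    then have b1: "1 + 2 * m * (m + Suc i * (m + 1)) \<le> M" using bound by simp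
    then have b2: "1 + 2 * m * (m + i * (m + 1)) + 2 * length ne \<le> M"
      using M(2) by (simp add: algebra_simps)
    note r = den_roundP[OF acc _ b2]
    have r2: "tab_ok (1 + 2 * m * (m + i * (m + 1)) + 2 * m) (Suc (1 + m + i * (m + 1))) (relax_round ne acc)"
      by (rule tab_ok_mono[OF r(2)]) (use M bound in auto)
    note t = den_tree_roundsP[OF r2 M(1,3) _ bound(2)]
    show "den M tree_roundsP [enc_list enc_wedge te, enc_es es,
           den M roundP [enc_list enc_wedge ne, enc_list enc_entry acc]] =
         enc_list enc_entry (?F acc (Rs ! i)) \<and> I (Suc i) (?F acc (Rs ! i))"
      using r(1) t b1 M bound by (auto simp: I_def algebra_simps elim!: tab_ok_mono)
  qed
  then show "den M dpP [enc_list enc_wedge te, enc_list enc_wedge ne, enc_es es,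
       enc_list Atom Rs, Atom u] = enc_list enc_entry (dp te ne m R u)"
    "tab_ok (1 + 2 * m * (m + R * (m + 1))) (1 + m + R * (m + 1)) (dp te ne m R u)"
    by (simp_all add: foldl_const dp_def Rs I_def)
qed

lemma weighted_foldl:
  "foldl (\<lambda>acc e. if Q e then (e, w e) # acc else acc) a es = weighted Q w es @ a"
  by (induction es arbitrary: a) (auto simp: weighted_def)

lemma length_weighted: "length (weighted Q w es) \<le> length es"
  by (simp add: weighted_def)

lemma den_tree_selP:
  assumes "length es \<le> M" "length lg \<le> M" "length t \<le> M"
  shows "den M tree_selP [Atom k, enc_es t, enc_es lg, enc_es es] =
    enc_list enc_wedge (tree_sel k t lg es)"
proof -
  have "den M tree_selP [Atom k, enc_es t, enc_es lg, enc_es es] =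
    enc_list enc_wedge (foldl (\<lambda>acc e. if ends e \<in> ends ` set t then (e, wt k t lg e) # acc else acc) [] es)"
    by (simp add: tree_selP_def, rule fold_elems_enc[OF assms(1)])
       (simp_all add: den_memE den_wtP assms enc_wedge_def)
  then show ?thesis by (simp add: weighted_foldl tree_sel_def)
qed

lemma den_nontree_selP:
  assumes "length es \<le> M" "length lg \<le> M" "length t \<le> M" "length U \<le> M"
  shows "den M nontree_selP [Atom k, enc_es t, enc_es lg, enc_es es,
      enc_edge e, enc_list enc_used U] = enc_list enc_wedge (nontree_sel k t lg es e U)"
proof -
  have "den M nontree_selP [Atom k, enc_es t, enc_es lg, enc_es es,
      enc_edge e, enc_list enc_used U] =
    enc_list enc_wedge (foldl (\<lambda>acc f. if ends f \<notin> ends ` set t \<and> ends e \<noteq> ends f \<and> \<not> conflict e f U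
      then (f, wt k t lg f) # acc else acc) [] es)"
    by (simp add: nontree_selP_def, rule fold_elems_enc[OF assms(1)])
       (simp_all add: den_memE den_wtP den_confP assms enc_wedge_def)
  then show ?thesis by (simp add: weighted_foldl nontree_sel_def)
qed

text \<open>Non-emptiness lets the program peel off the first vertex before it folds over the rest
  of the path.\<close>

definition found_ok :: "nat \<Rightarrow> (label \<times> edge) option \<Rightarrow> bool" where
  "found_ok B x \<longleftrightarrow> (\<forall>y. x = Some y \<longrightarrow> snd (fst y) \<noteq> [] \<and> length (snd (fst y)) \<le> B)"

lemma den_bestP:
  assumes m: "length es = m" and Rs: "length Rs = R" and t: "length t \<le> M" and cov: "length cov \<le> M"
    and lg: "length lg \<le> M" and U: "length U \<le> M"
    and bound: "1 + 2 * m * (m + R * (m + 1)) \<le> M" "m \<le> M" "R \<le> M"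
  shows "den M bestP [Atom k, enc_es t, enc_es lg, enc_es es,
      enc_list Atom Rs, enc_list enc_used U, enc_es cov] =
      enc_opt enc_found (best k t lg es R U cov)"
    and "found_ok (1 + m + R * (m + 1)) (best k t lg es R U cov)"
proof -
  let ?F = "\<lambda>acc e. if ends e \<in> ends ` set t then acc else if ends e \<in> ends ` set cov then acc
     else better acc (cand k t lg es R U e) e"
  let ?B = "1 + m + R * (m + 1)"
  have te: "den M tree_selP [Atom k, enc_es t, enc_es lg, enc_es es] =
      enc_list enc_wedge (tree_sel k t lg es)"
    by (rule den_tree_selP) (use assms in auto)
  have len: "length (tree_sel k t lg es) \<le> m" "length (nontree_sel k t lg es e U) \<le> m" for e
    using m length_weighted by (auto simp: tree_sel_def nontree_sel_def)
  have cand: "den M lookP [Atom (snd e), den M dpP [enc_list enc_wedge (tree_sel k t lg es),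
       den M nontree_selP [Atom k, enc_es t, enc_es lg, enc_es es,
      enc_edge e, enc_list enc_used U], enc_es es, enc_list Atom Rs, Atom (fst e)]] =
     enc_opt enc_label (cand k t lg es R U e)"
    and cand_ok: "\<And>l. cand k t lg es R U e = Some l \<Longrightarrow> snd l \<noteq> [] \<and> length (snd l) \<le> ?B" for e
  proof -
    have ne: "den M nontree_selP [Atom k, enc_es t, enc_es lg, enc_es es,
      enc_edge e, enc_list enc_used U] = enc_list enc_wedge (nontree_sel k t lg es e U)"
      by (rule den_nontree_selP) (use assms in auto)
    note dp = den_dpP[OF len m Rs bound]
    have "length (dp (tree_sel k t lg es) (nontree_sel k t lg es e U) m R (fst e)) \<le> M"
      using dp(2)[of e "fst e"] bound(1) by (simp add: tab_ok_def)
    then show "den M lookP [Atom (snd e), den M dpP [enc_list enc_wedge (tree_sel k t lg es),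
       den M nontree_selP [Atom k, enc_es t, enc_es lg, enc_es es,
      enc_edge e, enc_list enc_used U], enc_es es, enc_list Atom Rs, Atom (fst e)]] =
     enc_opt enc_label (cand k t lg es R U e)"
      by (simp add: ne dp(1) den_lookP cand_def m)
    show "snd l \<noteq> [] \<and> length (snd l) \<le> ?B" if "cand k t lg es R U e = Some l" for l
      using dp(2)[of e "fst e"] map_of_SomeD[OF that[unfolded cand_def]]
      by (auto simp: tab_ok_def m)
  qed
  define I where "I = (\<lambda>_ :: nat. found_ok ?B)"
  have "den M bestP [Atom k, enc_es t, enc_es lg, enc_es es,
      enc_list Atom Rs, enc_list enc_used U, enc_es cov] = enc_opt enc_found (foldl ?F None es) \<and>
     I (length es) (foldl ?F None es)"
    unfolding bestP_def den.simps dens.simps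
  proof (simp add: te del: image_iff, rule fold_elems_inv[where I = I])
    show "length es \<le> M" using m bound by simp
    show "I 0 None" by (simp add: I_def found_ok_def)
    show "Atom 0 = enc_opt enc_found None" by (simp add: enc_opt_def)
    fix i acc assume i: "i < length es" and acc: "I i acc"
    let ?e = "es ! i"
    have "I (Suc i) (?F acc ?e)"
      using acc cand_ok[of ?e] by (auto simp: I_def found_ok_def better_def split: option.splits)
    moreover have "den M best_bodyP [Atom k, enc_es t, enc_es lg,
        enc_es es, enc_list Atom Rs, enc_list enc_used U, enc_es cov,
        enc_list enc_wedge (tree_sel k t lg es), enc_opt enc_found acc, enc_edge ?e] =
        enc_opt enc_found (?F acc ?e)"
      by (simp add: best_bodyP_def cand den_memE[OF t] den_memE[OF cov] del: image_iff)
         (auto simp: better_def enc_opt_def enc_found_def enc_label_def bool_val_def split: option.splits)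
    ultimately show "den M best_bodyP [Atom k, enc_es t, enc_es lg,
        enc_es es, enc_list Atom Rs, enc_list enc_used U, enc_es cov,
        enc_list enc_wedge (tree_sel k t lg es), enc_opt enc_found acc, enc_edge ?e] =
        enc_opt enc_found (?F acc ?e) \<and> I (Suc i) (?F acc ?e)"
      by blast
  qed
  then show "den M bestP [Atom k, enc_es t, enc_es lg, enc_es es,
      enc_list Atom Rs, enc_list enc_used U, enc_es cov] =
      enc_opt enc_found (best k t lg es R U cov)" "found_ok ?B (best k t lg es R U cov)"
    by (simp_all add: best_def I_def)
qed

lemma path_edges_simps [simp]:
  "path_edges [] = []" "path_edges [x] = []" "path_edges (x # y # p) = (x, y) # path_edges (y # p)"
  by (simp_all add: path_edges_def)

lemma length_path_edges [simp]: "length (path_edges p) = length p - 1"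
  by (simp add: path_edges_def)

definition use_edge ::
  "edge list \<Rightarrow> edge \<Rightarrow> nat \<times> edge list \<times> (edge \<times> edge) list \<Rightarrow> nat
    \<Rightarrow> nat \<times> edge list \<times> (edge \<times> edge) list" where
  "use_edge t e st y = (case st of (x, lg, U) \<Rightarrow>
     (y, (x, y) # lg, if ends (x, y) \<in> ends ` set t then U else (e, (x, y)) # U))"

lemma foldl_use_edge:
  "foldl (use_edge t e) (x, lg, U) p = (last (x # p), rev (path_edges (x # p)) @ lg,
     rev (map (Pair e) (filter (\<lambda>f. ends f \<notin> ends ` set t) (path_edges (x # p)))) @ U)"
  by (induction p arbitrary: x lg U) (auto simp: use_edge_def)

definition enc_use :: "nat \<times> edge list \<times> (edge \<times> edge) list \<Rightarrow> val" where
  "enc_use st = Cell (Atom (fst st)) (Cell (enc_es (fst (snd st))) (enc_list enc_used (snd (snd st))))"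

definition enc_result :: "(edge \<times> edge) list \<times> nat list list \<Rightarrow> val" where
  "enc_result st = Cell (enc_list enc_used (fst st)) (enc_cycles (snd st))"

definition enc_state where
  "enc_state st = Cell (enc_es (fst st)) (Cell (enc_es (fst (snd st))) (enc_result (snd (snd st))))"

definition state_ok :: "nat \<Rightarrow> nat \<Rightarrow> nat \<Rightarrow>
   edge list \<times> edge list \<times> (edge \<times> edge) list \<times> nat list list \<Rightarrow> bool" where
  "state_ok Nc Nl Nu st \<longleftrightarrow>
     length (fst st) \<le> Nc \<and> length (fst (snd st)) \<le> Nl \<and> length (fst (snd (snd st))) \<le> Nu"

lemma den_stepP:
  assumes m: "length es = m" and Rs: "length Rs = R" and t: "length t \<le> M"
    and st: "state_ok Nc Nl Nu st" "Nc \<le> M" "Nl \<le> M" "Nu \<le> M"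
    and B: "B = 1 + m + R * (m + 1)" "B \<le> M"
    and bound: "1 + 2 * m * (m + R * (m + 1)) \<le> M" "m \<le> M" "R \<le> M"
  shows "den M stepP [Atom k, enc_es t, enc_es es, enc_list Atom Rs, enc_state st] =
      enc_state (step_alg k es R t st)"
    and "state_ok (Suc Nc) (Nl + B) (Nu + B) (step_alg k es R t st)"
proof -
  obtain cov lg U out where st_eq: "st = (cov, lg, U, out)" by (cases st)
  have len: "length cov \<le> Nc" "length lg \<le> Nl" "length U \<le> Nu"
    using st by (auto simp: state_ok_def st_eq)
  note best = den_bestP[OF m Rs t _ _ _ bound, of cov lg U k]
  have best_den: "den M bestP [Atom k, enc_es t, enc_es lg, enc_es es,
      enc_list Atom Rs, enc_list enc_used U, enc_es cov] =
      enc_opt enc_found (best k t lg es R U cov)"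
    by (rule best) (use len st in auto)
  have ok: "found_ok B (best k t lg es R U cov)"
    unfolding B by (rule best) (use len st in auto)
  have "den M stepP [Atom k, enc_es t, enc_es es, enc_list Atom Rs, enc_state st] =
      enc_state (step_alg k es R t st) \<and> state_ok (Suc Nc) (Nl + B) (Nu + B) (step_alg k es R t st)"
  proof (cases "best k t lg es R U cov")
    case None
    then show ?thesis using best_den len
      by (simp add: stepP_def enc_state_def enc_result_def st_eq enc_opt_def step_alg_def state_ok_def)
  next
    case (Some x)
    then obtain c p e where x: "best k t lg es R U cov = Some ((c, p), e)"
      by (metis prod.collapse)
    with ok have p: "p \<noteq> []" "length p \<le> B" by (auto simp: found_ok_def)
    then obtain y q where pq: "p = y # q" by (cases p) auto
    have q: "length q \<le> M" using p B pq by simp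
    have fold: "fold_elems M (\<lambda>acc v. den M use_edgeP
        [Atom k, enc_es t, enc_es es, enc_list Atom Rs, enc_state st,
         enc_found ((c, p), e), enc_list Atom p, acc, v])
        (Cell (Atom y) (Cell (enc_es lg) (enc_list enc_used U))) (enc_list Atom q) =
       enc_use (foldl (use_edge t e) (y, lg, U) q)"
    proof (rule fold_elems_enc[OF q])
      show "Cell (Atom y) (Cell (enc_es lg) (enc_list enc_used U)) = enc_use (y, lg, U)"
        by (simp add: enc_use_def)
      fix acc :: "nat \<times> edge list \<times> (edge \<times> edge) list" and z
      have "Cell (Atom (fst acc)) (Atom z) = enc_edge (fst acc, z)" by simp
      then have "den M memE [Cell (Atom (fst acc)) (Atom z), enc_es t] =
         bool_val (ends (fst acc, z) \<in> ends ` set t)"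
        using den_memE[OF t, of "(fst acc, z)"] by simp
      then show "den M use_edgeP
         [Atom k, enc_es t, enc_es es, enc_list Atom Rs, enc_state st,
          enc_found ((c, p), e), enc_list Atom p, enc_use acc, Atom z] =
         enc_use (use_edge t e acc z)"
        by (cases acc) (simp add: use_edgeP_def enc_use_def use_edge_def enc_found_def enc_used_def del: image_iff)
    qed
    have "den M stepP [Atom k, enc_es t, enc_es es, enc_list Atom Rs, enc_state st] =
      enc_state (step_alg k es R t st)"
      using fold best_den x pq
      by (simp add: stepP_def enc_state_def enc_result_def st_eq enc_opt_def step_alg_def
          enc_found_def enc_label_def foldl_use_edge enc_use_def enc_cycles_def)
    moreover have "length (filter (\<lambda>f. ends f \<notin> ends ` set t) (path_edges p)) \<le> B"
      by (rule order.trans[OF length_filter_le]) (use p in auto)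
    then have "state_ok (Suc Nc) (Nl + B) (Nu + B) (step_alg k es R t st)"
      using len p by (simp add: st_eq x step_alg_def state_ok_def del: image_iff)
    ultimately show ?thesis by blast
  qed
  then show "den M stepP [Atom k, enc_es t, enc_es es, enc_list Atom Rs, enc_state st] =
      enc_state (step_alg k es R t st)"
    "state_ok (Suc Nc) (Nl + B) (Nu + B) (step_alg k es R t st)" by blast+
qed

lemma den_stageP:
  assumes m: "length es = m" and Rs: "length Rs = R" and t: "length t \<le> M"
    and UO: "length (fst UO) \<le> Nu"
    and B: "B = 1 + m + R * (m + 1)" "Nu + (m + 1) * B \<le> M"
    and bound: "1 + 2 * m * (m + R * (m + 1)) \<le> M" "m \<le> M" "R \<le> M"
  shows "den M stageP [Atom k, enc_es es, enc_list Atom Rs, enc_es t, enc_result UO] =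
      enc_result (stage_alg k es R UO t)"
    and "length (fst (stage_alg k es R UO t)) \<le> Nu + m * B"
proof -
  let ?F = "\<lambda>st (_ :: nat \<times> nat). step_alg k es R t st"
  define I where "I = (\<lambda>i. state_ok i (i * B) (Nu + i * B))"
  have "fold_elems M (\<lambda>acc v. den M stepP [Atom k, enc_es t, enc_es es, enc_list Atom Rs, acc])
      (Cell (Atom 0) (Cell (Atom 0) (enc_result UO))) (enc_es es) =
      enc_state (foldl ?F ([], [], UO) es) \<and> I (length es) (foldl ?F ([], [], UO) es)"
  proof (rule fold_elems_inv[where I = I])
    show "length es \<le> M" using m bound by simp
    show "I 0 ([], [], UO)" using UO by (simp add: I_def state_ok_def)
    show "Cell (Atom 0) (Cell (Atom 0) (enc_result UO)) = enc_state ([], [], UO)"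
      by (simp add: enc_state_def)
    fix i acc assume i: "i < length es" and acc: "I i acc"
    have "Nu + i * B \<le> M" "i * B \<le> M" "B \<le> M"
      using mult_le_mono1[of i "m + 1" B] i m B(2) by auto
    with den_stepP[OF m Rs t acc[unfolded I_def] _ _ _ B(1) _ bound, of k] i m bound
    show "den M stepP [Atom k, enc_es t, enc_es es, enc_list Atom Rs, enc_state acc] =
        enc_state (step_alg k es R t acc) \<and> I (Suc i) (step_alg k es R t acc)"
      by (simp add: I_def algebra_simps)
  qed
  then have "den M stageP [Atom k, enc_es es, enc_list Atom Rs, enc_es t, enc_result UO] =
      enc_result (stage_alg k es R UO t) \<and> length (fst (stage_alg k es R UO t)) \<le> Nu + m * B"
    by (simp add: stageP_def foldl_const stage_alg_def enc_state_def I_def state_ok_def m)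
  then show "den M stageP [Atom k, enc_es es, enc_list Atom Rs, enc_es t, enc_result UO] =
      enc_result (stage_alg k es R UO t)"
    "length (fst (stage_alg k es R UO t)) \<le> Nu + m * B" by blast+
qed

lemma rounds_for_le: "rounds_for n m \<le> 2 + 2 * m"
proof -
  have "snd (((\<lambda>(j, R). if j < n then (2 * j, R + 2) else (j, R)) ^^ m) (1, 2)) \<le> 2 + 2 * m"
    by (induction m) (auto split: prod.splits if_splits)
  then show ?thesis by (simp add: rounds_for_def)
qed

text \<open>With \<open>q\<close> the base of the clock, path lengths are at most
  \<open>q ^ 4\<close>, while table sizes and the accumulated list of forbidden pairs are at most
  \<open>q ^ 6\<close>. All lists thus stay below the clock and every fold runs to its end.\<close>

lemma den_mainP:
  assumes ts: "\<And>t. t \<in> set ts \<Longrightarrow> length t \<le> length es"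
  shows "den ((length es + length ts + 2) ^ 8) mainP [enc_input n es ts] = enc_cycles (main_alg n es ts)"
proof -
  define m k q M R B where "m = length es" and "k = length ts" and "q = m + k + 2" and "M = q ^ 8"
    and "R = rounds_for n m" and "B = 1 + m + R * (m + 1)"
  have q: "m + 2 \<le> q" "2 \<le> q" "k \<le> q" by (auto simp: q_def)
  have R: "R \<le> 2 * q" using rounds_for_le[of n m] q by (simp add: R_def)
  have "R * (m + 1) \<le> 2 * q * q" using R q by (intro mult_le_mono) auto
  moreover have "q * 2 \<le> q * q" using q by (intro mult_le_mono) auto
  ultimately have "B \<le> 4 * (q * q)" using q unfolding B_def by linarith
  also have "\<dots> \<le> (q * q) * (q * q)" using mult_le_mono[OF q(2) q(2)] by simp
  finally have B: "B \<le> q ^ 4" by (simp add: power4_eq_xxxx ac_simps)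
  have pw: "q ^ i \<le> M" if "i \<le> 8" for i
    using q that by (auto simp: M_def intro: power_increasing)
  have bounds: "m \<le> M" "R \<le> M" "k \<le> M"
  proof -
    have "2 * q \<le> q * q" using q by simp
    then show "m \<le> M" "R \<le> M" "k \<le> M" using pw[of 2] R q unfolding power2_eq_square by linarith+
  qed
  have "1 + 2 * m * (m + R * (m + 1)) \<le> 2 * q * B"
  proof -
    have "2 * m * (m + R * (m + 1)) \<le> 2 * m * B" by (simp add: B_def)
    moreover have "2 * m * B + 1 \<le> 2 * q * B"
    proof -
      have "(2 * m + 1) * B \<le> 2 * q * B" using q by (intro mult_le_mono) auto
      moreover have "1 \<le> B" by (simp add: B_def)
      ultimately show ?thesis by (simp add: algebra_simps)
    qed
    ultimately show ?thesis by linarith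
  qed
  also have "\<dots> \<le> q * q * q ^ 4" using B q by (intro mult_le_mono) auto
  also have "\<dots> = q ^ 6" by (simp add: power_numeral_reduce)
  finally have bound: "1 + 2 * m * (m + R * (m + 1)) \<le> M" using pw[of 6] by simp
  have U: "i * (m * B) + (m + 1) * B \<le> M" if "i \<le> k" for i
  proof -
    have "i * (m * B) + (m + 1) * B \<le> k * (m * B) + (m + 1) * B" using that by simp
    also have "\<dots> \<le> k * ((m + 1) * B) + (m + 1) * B" by simp
    also have "\<dots> = (k + 1) * (m + 1) * B" by (simp add: algebra_simps)
    also have "\<dots> \<le> q * q * q ^ 4" using B by (intro mult_le_mono) (auto simp: q_def)
    also have "\<dots> = q ^ 6" by (simp add: power_numeral_reduce)
    finally show ?thesis using pw[of 6] by simp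
  qed
  define \<rho> where "\<rho> = enc_input n es ts"
  have kf: "fold_elems M (\<lambda>acc v. Atom (num_of acc + 1)) (Atom 0) (enc_list enc_edges ts) = Atom k"
  proof -
    have "fold_elems M (\<lambda>acc v. Atom (num_of acc + 1)) (Atom 0) (enc_list enc_edges ts) =
       Atom (foldl (\<lambda>a _. a + 1) 0 ts)"
      by (rule fold_elems_enc) (use bounds in \<open>auto simp: k_def\<close>)
    also have "foldl (\<lambda>a _. a + 1) c ts = c + length ts" for c :: nat
      by (induction ts arbitrary: c) auto
    finally show ?thesis by (simp add: k_def)
  qed
  define D where "D = (\<lambda>(j, rs :: nat list). if j < n then (2 * j, 0 # 0 # rs) else (j, rs))"
  have Rf: "fold_elems M (\<lambda>acc v. den M doubleP [\<rho>, Atom k, acc, v])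
     (Cell (Atom 1) (Cell (Atom 0) (Cell (Atom 0) (Atom 0)))) (enc_es es) =
     enc_pair Atom (enc_list Atom) (foldl (\<lambda>x _. D x) (1, [0, 0]) es)"
    by (rule fold_elems_enc)
      (use bounds in \<open>auto simp: m_def enc_pair_def doubleP_def bool_val_def \<rho>_def enc_input_def D_def\<close>)
  define Rs where "Rs = snd ((D ^^ m) (1, [0, 0]))"
  have Rs: "length Rs = R"
  proof -
    define G where "G = (\<lambda>(j, R :: nat). if j < n then (2 * j, R + 2) else (j, R))"
    have G: "map_prod id length (D x) = G (map_prod id length x)" for x
      by (cases x) (simp add: D_def G_def)
    have "map_prod id length ((D ^^ i) (1, [0, 0])) = (G ^^ i) (1, 2)" for i
      by (induction i) (simp_all add: G[unfolded id_def] id_def)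
    from this[of m] have "length (snd ((D ^^ m) (1, [0, 0]))) = snd ((G ^^ m) (1, 2))"
      by (metis snd_map_prod)
    then show ?thesis by (simp add: Rs_def R_def rounds_for_def G_def)
  qed
  define I where "I = (\<lambda>i (x :: (edge \<times> edge) list \<times> nat list list). length (fst x) \<le> i * (m * B))"
  have "fold_elems M (\<lambda>acc v. den M stageP [Atom k, enc_es es, enc_list Atom Rs, v, acc])
     (Cell (Atom 0) (Atom 0)) (enc_list enc_edges ts) =
     enc_result (foldl (stage_alg k es R) ([], []) ts) \<and> I (length ts) (foldl (stage_alg k es R) ([], []) ts)"
  proof (rule fold_elems_inv[where I = I])
    show "length ts \<le> M" using bounds by (simp add: k_def)
    show "I 0 ([], [])" by (simp add: I_def)
    show "Cell (Atom 0) (Atom 0) = enc_result ([], [])" by (simp add: enc_result_def enc_cycles_def)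
    fix i acc assume i: "i < length ts" and acc: "I i acc"
    have t: "length (ts ! i) \<le> M" using ts[of "ts ! i"] i bounds by (simp add: m_def)
    note den_stageP[OF m_def[symmetric] Rs t acc[unfolded I_def] B_def U bound bounds(1,2), of k]
    with i show "den M stageP [Atom k, enc_es es, enc_list Atom Rs, enc_edges (ts ! i), enc_result acc] =
        enc_result (stage_alg k es R acc (ts ! i)) \<and> I (Suc i) (stage_alg k es R acc (ts ! i))"
      by (simp add: I_def enc_edges_eq k_def algebra_simps)
  qed
  moreover have "(length es + length ts + 2) ^ 8 = M" by (simp add: M_def q_def m_def k_def)
  moreover have "snd ((D ^^ m) (Suc 0, [0, 0])) = Rs" by (simp add: Rs_def)
  ultimately show ?thesis
    using kf Rf unfolding \<rho>_def
    by (simp add: mainP_def enc_input_def enc_edges_eq foldl_const main_alg_def enc_result_def enc_pair_def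
        flip: m_def k_def R_def)
qed

section \<open>Analysis of the shortest path computation\<close>

lemma ends_pair [simp]: "ends (a, b) = {a, b}"
  by (simp add: ends_def)

definition walk :: "'a set set \<Rightarrow> 'a list \<Rightarrow> bool" where
  "walk A p \<longleftrightarrow> p \<noteq> [] \<and> (\<forall>f\<in>set (path_edges p). ends f \<in> A)"

definition path_cost :: "('a set \<Rightarrow> nat) \<Rightarrow> 'a list \<Rightarrow> nat" where
  "path_cost w p = (\<Sum>f\<leftarrow>path_edges p. w (ends f))"

definition nontree_count :: "'a set set \<Rightarrow> 'a list \<Rightarrow> nat" where
  "nontree_count T p = length (filter (\<lambda>f. ends f \<notin> T) (path_edges p))"

lemma walk_simps [simp]:
  "\<not> walk A []" "walk A [x]" "walk A (x # y # p) \<longleftrightarrow> {x, y} \<in> A \<and> walk A (y # p)"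
  by (auto simp: walk_def)

lemma path_cost_simps [simp]:
  "path_cost w [] = 0" "path_cost w [x] = 0" "path_cost w (x # y # p) = w {x, y} + path_cost w (y # p)"
  by (auto simp: path_cost_def)

lemma nontree_count_simps [simp]:
  "nontree_count T [] = 0" "nontree_count T [x] = 0"
  "nontree_count T (x # y # p) = (if {x, y} \<in> T then 0 else 1) + nontree_count T (y # p)"
  by (auto simp: nontree_count_def)

text \<open>Completeness speaks of costs only; that the stored paths are real walks of exactly the
  stored cost is the business of \<open>sound\<close>.\<close>

definition at_most :: "table \<Rightarrow> nat \<Rightarrow> nat \<Rightarrow> bool" where
  "at_most tab v x \<longleftrightarrow> (\<exists>c p. map_of tab v = Some (c, p) \<and> c \<le> x)"

lemma at_most_relax: "at_most acc v x \<Longrightarrow> at_most (relax src acc a b w) v x"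
  unfolding at_most_def relax_def by (auto split: option.splits)

lemma at_most_relax_new: "at_most src a x \<Longrightarrow> at_most (relax src acc a b w) b (x + w)"
  unfolding at_most_def relax_def by (force split: option.splits)

lemma at_most_foldl_relax2: "at_most acc v x \<Longrightarrow> at_most (foldl (relax2 src) acc wes) v x"
  by (induction wes arbitrary: acc) (auto simp: relax2_def intro: at_most_relax)

lemma at_most_round: "at_most src v x \<Longrightarrow> at_most (relax_round wes src) v x"
  by (simp add: relax_round_def at_most_foldl_relax2)

lemma at_most_round_new:
  assumes "((a, b), w) \<in> set wes"
  shows "at_most src a x \<Longrightarrow> at_most (relax_round wes src) b (x + w)"
    and "at_most src b x \<Longrightarrow> at_most (relax_round wes src) a (x + w)"
proof -
  obtain xs ys where wes: "wes = xs @ ((a, b), w) # ys" using assms by (meson split_list)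
  have "at_most (relax2 src acc ((a, b), w)) b (x + w)" if "at_most src a x" for acc
    using that by (simp add: relax2_def at_most_relax at_most_relax_new)
  moreover have "at_most (relax2 src acc ((a, b), w)) a (x + w)" if "at_most src b x" for acc
    using that by (simp add: relax2_def at_most_relax_new)
  ultimately show "at_most src a x \<Longrightarrow> at_most (relax_round wes src) b (x + w)"
    "at_most src b x \<Longrightarrow> at_most (relax_round wes src) a (x + w)"
    by (simp_all add: relax_round_def wes at_most_foldl_relax2)
qed

locale dp_setup =
  fixes T N :: "nat set set" and w :: "nat set \<Rightarrow> nat" and te ne :: "(edge \<times> nat) list"
  assumes te: "\<And>x. x \<in> set te \<Longrightarrow> ends (fst x) \<in> T \<and> snd x = w (ends (fst x))"
    and ne: "\<And>x. x \<in> set ne \<Longrightarrow> ends (fst x) \<in> N \<and> snd x = w (ends (fst x))"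
    and T: "\<And>s. s \<in> T \<Longrightarrow> \<exists>x\<in>set te. ends (fst x) = s"
    and N: "\<And>s. s \<in> N \<Longrightarrow> \<exists>x\<in>set ne. ends (fst x) = s"
begin

definition sound :: "nat \<Rightarrow> nat \<Rightarrow> table \<Rightarrow> bool" where
  "sound u j tab \<longleftrightarrow> (\<forall>(v, c, p)\<in>set tab.
     walk (T \<union> N) p \<and> hd p = v \<and> last p = u \<and> c = path_cost w p \<and> nontree_count T p \<le> j)"

lemma sound_mono: "sound u i tab \<Longrightarrow> i \<le> j \<Longrightarrow> sound u j tab"
  unfolding sound_def by fastforce

lemma sound_relax:
  assumes "sound u i src" "sound u j acc" "{a, b} \<in> T \<union> N" "x = w {a, b}"
    and "i + (if {a, b} \<in> T then 0 else 1) \<le> j"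
  shows "sound u j (relax src acc a b x)"
proof (cases "map_of src a")
  case None
  then show ?thesis using assms by (simp add: relax_def)
next
  case (Some l)
  obtain c p where l: "l = (c, p)" by (cases l)
  then have "(a, c, p) \<in> set src" using Some map_of_SomeD by fast
  then have p: "walk (T \<union> N) p" "hd p = a" "last p = u" "c = path_cost w p" "nontree_count T p \<le> i"
    using assms(1) by (auto simp: sound_def)
  then obtain q where q: "p = a # q" by (cases p) auto
  have "walk (T \<union> N) (b # p)" "hd (b # p) = b" "last (b # p) = u" "c + x = path_cost w (b # p)"
    "nontree_count T (b # p) \<le> j"
    using p assms(3-5) by (auto simp: q insert_commute split: if_splits)
  then have "sound u j ((b, c + x, b # p) # acc)"
    using assms(2) by (simp add: sound_def)
  then show ?thesis using Some l assms(2) by (auto simp: relax_def split: option.splits)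
qed

lemma sound_round:
  assumes "sound u i src" "i \<le> j"
    and "\<And>y. y \<in> set wes \<Longrightarrow> ends (fst y) \<in> T \<union> N \<and> snd y = w (ends (fst y)) \<and>
      i + (if ends (fst y) \<in> T then 0 else 1) \<le> j"
  shows "sound u j (relax_round wes src)"
proof -
  have "sound u j (foldl (relax2 src) acc wes)" if "sound u j acc" for acc
    using that assms(3)
  proof (induction wes arbitrary: acc)
    case (Cons y wes)
    obtain a b x where y: "y = ((a, b), x)" by (metis prod.collapse)
    have "sound u j (relax2 src acc y)"
      using Cons.prems(1) Cons.prems(2)[of y] assms(1)
      by (auto simp: relax2_def y insert_commute intro!: sound_relax)
    with Cons show ?case by simp
  qed simp
  then show ?thesis using sound_mono[OF assms(1,2)] by (simp add: relax_round_def)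
qed

lemma sound_tree_rounds: "sound u j tab \<Longrightarrow> sound u j ((relax_round te ^^ m) tab)"
  by (induction m) (auto intro!: sound_round[where i = j] dest: te)

lemma sound_dp: "sound u R (dp te ne m R u)"
proof -
  have "sound u 0 [(u, 0, [u])]" by (simp add: sound_def)
  then have "sound u 0 (dp_init te m u)" by (simp add: dp_init_def sound_tree_rounds)
  then have "sound u R (((\<lambda>tab. (relax_round te ^^ m) (relax_round ne tab)) ^^ R) (dp_init te m u))"
  proof (induction R)
    case (Suc R)
    then show ?case
      by (auto intro!: sound_tree_rounds sound_round[where i = R] dest: ne)
  qed simp
  then show ?thesis by (simp add: dp_def)
qed

lemma at_most_funpow: "at_most tab v x \<Longrightarrow> at_most ((relax_round wes ^^ m) tab) v x"
  by (induction m) (auto intro: at_most_round)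

text \<open>Paths are built towards the head, so the leading tree edges are those added since the
  last non-tree edge. Their number tells how many tree rounds of the current layer are
  required.\<close>

fun tree_front :: "nat list \<Rightarrow> nat" where
  "tree_front (x # y # p) = (if {x, y} \<in> T then Suc (tree_front (y # p)) else 0)"
| "tree_front _ = 0"

lemma tree_front_le: "tree_front p \<le> length p - 1"
  by (induction p rule: tree_front.induct) auto

text \<open>The table at the start of layer \<open>j\<close>, before its tree rounds. Splitting
  \<open>dp\<close> here lets the induction over a walk stop between any two rounds.\<close>

definition stage_tab :: "nat \<Rightarrow> nat \<Rightarrow> nat \<Rightarrow> table" where
  "stage_tab m u j = (if j = 0 then [(u, 0, [u])] else relax_round ne (dp te ne m (j - 1) u))"

lemma dp_stage_tab: "dp te ne m j u = (relax_round te ^^ m) (stage_tab m u j)"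
  by (cases j) (simp_all add: dp_def dp_init_def stage_tab_def)

lemma at_most_stage_tab: "at_most (stage_tab m u j) v x \<Longrightarrow> at_most (stage_tab m u (Suc j)) v x"
  by (simp add: stage_tab_def[of _ _ "Suc j"] dp_stage_tab at_most_round at_most_funpow)

text \<open>Removing the first edge of the walk lowers \<open>i\<close> if it is a tree edge.
  Otherwise it lowers \<open>j\<close>, and \<open>i\<close> is reset to \<open>m\<close>, which is
  large enough because the walk has at most \<open>m\<close> edges.\<close>

lemma at_most_walk:
  assumes "walk (T \<union> N) p" "last p = u" "length p \<le> m + 1" "nontree_count T p \<le> j" "tree_front p \<le> i"
  shows "at_most ((relax_round te ^^ i) (stage_tab m u j)) (hd p) (path_cost w p)"
  using assms
proof (induction p arbitrary: i j)
  case (Cons b p)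
  show ?case
  proof (cases p)
    case Nil
    then have b: "b = u" using Cons.prems by simp
    have "at_most (stage_tab m u j) u 0" for j
      by (induction j) (simp_all add: at_most_stage_tab, simp add: stage_tab_def at_most_def)
    then show ?thesis using Nil b by (simp add: at_most_funpow)
  next
    case (Cons a q)
    have walk: "walk (T \<union> N) p" "last p = u" "length p \<le> m + 1" "{b, a} \<in> T \<union> N"
      using Cons.prems by (auto simp: Cons)
    show ?thesis
    proof (cases "{b, a} \<in> T")
      case True
      then obtain i' where i: "i = Suc i'" "tree_front p \<le> i'"
        using Cons.prems(5) by (cases i) (auto simp: Cons)
      have "at_most ((relax_round te ^^ i') (stage_tab m u j)) a (path_cost w p)"
        using Cons.IH[OF walk(1-3), of j i'] Cons.prems(4) True i by (simp add: Cons)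
      moreover obtain x y z where f: "((x, y), z) \<in> set te" "{x, y} = {b, a}"
        using T[OF True] by (auto simp: ends_def)
      then have "((a, b), w {b, a}) \<in> set te \<or> ((b, a), w {b, a}) \<in> set te"
        using te[OF f(1)] by (auto simp: doubleton_eq_iff insert_commute)
      ultimately show ?thesis
        using at_most_round_new[of a b "w {b, a}" te] at_most_round_new[of b a "w {b, a}" te]
        by (auto simp: i Cons add.commute)
    next
      case False
      then obtain j' where j: "j = Suc j'" "nontree_count T p \<le> j'"
        using Cons.prems(4) by (cases j) (auto simp: Cons)
      have "tree_front p \<le> m" using tree_front_le[of p] walk(3) by linarith
      then have "at_most (dp te ne m j' u) a (path_cost w p)"
        using Cons.IH[OF walk(1-3) j(2)] by (simp add: Cons dp_stage_tab)
      moreover obtain x y z where f: "((x, y), z) \<in> set ne" "{x, y} = {b, a}"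
        using N[of "{b, a}"] walk(4) False by (auto simp: ends_def)
      then have "((a, b), w {b, a}) \<in> set ne \<or> ((b, a), w {b, a}) \<in> set ne"
        using ne[OF f(1)] by (auto simp: doubleton_eq_iff insert_commute)
      ultimately have "at_most (stage_tab m u j) b (path_cost w p + w {b, a})"
        using at_most_round_new[of a b "w {b, a}" ne] at_most_round_new[of b a "w {b, a}" ne]
        by (auto simp: j stage_tab_def)
      then show ?thesis by (simp add: Cons at_most_funpow add.commute)
    qed
  qed
qed simp

lemma at_most_dp:
  assumes "walk (T \<union> N) p" "last p = u" "length p \<le> m + 1" "nontree_count T p \<le> R"
  shows "at_most (dp te ne m R u) (hd p) (path_cost w p)"
proof -
  have "tree_front p \<le> m" using tree_front_le[of p] assms(3) by linarith
  then show ?thesis using at_most_walk[OF assms] by (simp add: dp_stage_tab)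
qed

end

section \<open>Paths and trees\<close>

lemma path_edges_append: "path_edges (p @ x # q) = path_edges (p @ [x]) @ path_edges (x # q)"
proof (induction p)
  case (Cons y p)
  then show ?case by (cases p) auto
qed simp

lemma path_edges_join:
  assumes "p \<noteq> []" "q \<noteq> []" "last p = hd q"
  shows "path_edges (p @ tl q) = path_edges p @ path_edges q"
proof -
  obtain p' where p: "p = p' @ [hd q]" using assms by (metis append_butlast_last_id)
  obtain q' where q: "q = hd q # q'" using assms by (metis list.collapse)
  have "p @ tl q = p' @ hd q # q'" using p q by (metis append.assoc append_Cons append_Nil list.sel(3))
  then show ?thesis using path_edges_append[of p' "hd q" q'] p q by metis
qed

lemma path_edges_rev: "path_edges (rev p) = rev (map prod.swap (path_edges p))"
proof (induction p rule: induct_list012)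
  case (3 x y p)
  have "path_edges (rev (x # y # p)) = path_edges (rev (y # p)) @ [(y, x)]"
    using path_edges_append[of "rev p" y "[x]"] by simp
  with 3 show ?case by simp
qed auto

lemma ends_swap [simp]: "ends (prod.swap f) = ends f"
  by (auto simp: ends_def)

lemma walk_rev [simp]: "walk A (rev p) \<longleftrightarrow> walk A p"
  by (auto simp: walk_def path_edges_rev)

lemma path_cost_rev [simp]: "path_cost w (rev p) = path_cost w p"
proof -
  have "path_cost w (rev p) = sum_list (rev (map (\<lambda>f. w (ends f)) (path_edges p)))"
    by (simp add: path_cost_def path_edges_rev rev_map o_def)
  then show ?thesis by (simp add: path_cost_def sum_list_rev)
qed

lemma nontree_count_rev [simp]: "nontree_count T (rev p) = nontree_count T p"
  by (simp add: nontree_count_def path_edges_rev filter_map o_def flip: rev_filter)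

lemma set_path_edges: "set (path_edges p) = {(p ! i, p ! Suc i) | i. Suc i < length p}"
proof -
  have "i < length p - 1 \<longleftrightarrow> Suc i < length p" for i by auto
  then show ?thesis by (auto simp: path_edges_def set_zip nth_tl)
qed

lemma cycle_edges_path_edges:
  assumes "c \<noteq> []"
  shows "cycle_edges c = ends ` set (path_edges (c @ [hd c]))"
proof -
  have nth: "(c @ [hd c]) ! Suc i = c ! (Suc i mod length c)" if "i < length c" for i
  proof (cases "Suc i < length c")
    case True
    then show ?thesis by (simp add: nth_append)
  next
    case False
    with that have "Suc i = length c" by simp
    then show ?thesis by (simp add: nth_append hd_conv_nth assms)
  qed
  have "cycle_edges c = {ends ((c @ [hd c]) ! i, (c @ [hd c]) ! Suc i) | i. i < length c}"
    unfolding cycle_edges_def using nth by (force simp: nth_append)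
  also have "\<dots> = ends ` set (path_edges (c @ [hd c]))"
    unfolding set_path_edges by (auto simp del: ends_pair)
  finally show ?thesis .
qed

section \<open>Loop erasure, tracked through the multiset of edges\<close>

lemma shortcut:
  assumes "\<not> distinct p"
  shows "\<exists>q. q \<noteq> [] \<and> hd q = hd p \<and> last q = last p \<and> mset (path_edges q) \<subseteq># mset (path_edges p) \<and>
    length q < length p"
proof -
  obtain xs ys zs y where p: "p = xs @ [y] @ ys @ [y] @ zs"
    using not_distinct_decomp[OF assms] by blast
  have "path_edges p = path_edges (xs @ [y]) @ path_edges (y # ys @ [y]) @ path_edges (y # zs)"
    using path_edges_append[of xs y "ys @ y # zs"] path_edges_append[of "y # ys" y zs] p by simp
  moreover have "path_edges (xs @ y # zs) = path_edges (xs @ [y]) @ path_edges (y # zs)"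
    by (rule path_edges_append)
  ultimately have "mset (path_edges (xs @ y # zs)) \<subseteq># mset (path_edges p)"
    by simp
  then show ?thesis
    by (intro exI[of _ "xs @ y # zs"]) (auto simp: p hd_append)
qed

text \<open>The submultiset relation on edges controls cost, non-tree count and the walk property
  all at once. The strict length clause serves to show that cheapest walks have no repeated
  vertex.\<close>

lemma loop_erasure:
  assumes "p \<noteq> []"
  obtains q where "q \<noteq> []" "hd q = hd p" "last q = last p" "mset (path_edges q) \<subseteq># mset (path_edges p)"
    "distinct q" "\<not> distinct p \<Longrightarrow> length q < length p"
proof -
  have "\<exists>q. q \<noteq> [] \<and> hd q = hd p \<and> last q = last p \<and> mset (path_edges q) \<subseteq># mset (path_edges p) \<and>
    distinct q \<and> length q \<le> length p \<and> (\<not> distinct p \<longrightarrow> length q < length p)"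
    using assms
  proof (induction p rule: length_induct)
    case (1 p)
    show ?case
    proof (cases "distinct p")
      case True
      then show ?thesis using 1(2) by (intro exI[of _ p]) simp
    next
      case False
      then obtain q where q: "q \<noteq> []" "hd q = hd p" "last q = last p"
        "mset (path_edges q) \<subseteq># mset (path_edges p)" "length q < length p"
        using shortcut[OF False] by (elim exE conjE)
      from 1(1)[rule_format, OF q(5,1)] obtain r where r: "r \<noteq> []" "hd r = hd q" "last r = last q"
        "mset (path_edges r) \<subseteq># mset (path_edges q)" "distinct r" "length r \<le> length q"
        by (elim exE conjE)
      have "mset (path_edges r) \<subseteq># mset (path_edges p)"
        using r(4) q(4) by (rule subset_mset.order_trans)
      moreover have "length r < length p" using r(6) q(5) by simp
      ultimately show ?thesis using q(2,3) r by (intro exI[of _ r]) simp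
    qed
  qed
  with that show thesis by (elim exE conjE) simp
qed

lemma path_cost_mset: "path_cost w p = (\<Sum>f\<in>#mset (path_edges p). w (ends f))"
  by (simp add: path_cost_def flip: sum_mset_sum_list)

lemma nontree_count_mset: "nontree_count T p = size {#f \<in># mset (path_edges p). ends f \<notin> T#}"
  by (simp add: nontree_count_def flip: mset_filter)

lemma path_cost_mono:
  "mset (path_edges q) \<subseteq># mset (path_edges p) \<Longrightarrow> path_cost w q \<le> path_cost w p"
  unfolding path_cost_mset by (auto simp: subset_mset.le_iff_add)

lemma nontree_count_mono:
  "mset (path_edges q) \<subseteq># mset (path_edges p) \<Longrightarrow> nontree_count T q \<le> nontree_count T p"
  unfolding nontree_count_mset by (simp add: multiset_filter_mono size_mset_mono)

lemma walk_mono: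
  "mset (path_edges q) \<subseteq># mset (path_edges p) \<Longrightarrow> q \<noteq> [] \<Longrightarrow> walk A p \<Longrightarrow> walk A q"
  unfolding walk_def by (auto dest: mset_subset_eqD simp del: ends_pair)

lemma path_cost_strict:
  assumes sub: "mset (path_edges q) \<subseteq># mset (path_edges p)" and len: "length q < length p"
    and "q \<noteq> []" and pos: "\<And>f. f \<in> set (path_edges p) \<Longrightarrow> 0 < w (ends f)"
  shows "path_cost w q < path_cost w p"
proof -
  obtain D where D: "mset (path_edges p) = mset (path_edges q) + D"
    using sub by (auto simp: subset_mset.le_iff_add)
  then have "length (path_edges p) = length (path_edges q) + size D"
    by (metis size_mset size_union)
  then have "D \<noteq> {#}" using len \<open>q \<noteq> []\<close> by (cases q) auto
  then obtain f D' where f: "D = add_mset f D'" by (meson multiset_nonemptyE multi_member_split)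
  then have "0 < w (ends f)" using pos[of f] D by (metis set_mset_mset union_iff union_single_eq_member)
  then show ?thesis by (simp add: path_cost_mset D f)
qed

lemma walk_Un_join:
  assumes "walk A p" "walk A q" "last p = hd q"
  shows "walk A (p @ tl q)" "hd (p @ tl q) = hd p" "last (p @ tl q) = last q"
    "path_cost w (p @ tl q) = path_cost w p + path_cost w q"
    "nontree_count T (p @ tl q) = nontree_count T p + nontree_count T q"
proof -
  have ne: "p \<noteq> []" "q \<noteq> []" using assms by (auto simp: walk_def)
  note j = path_edges_join[OF ne assms(3)]
  show "walk A (p @ tl q)" using assms ne by (auto simp: walk_def j)
  show "hd (p @ tl q) = hd p" using ne by simp
  show "last (p @ tl q) = last q" using ne assms(3) by (cases q) (auto simp: last_append)
  show "path_cost w (p @ tl q) = path_cost w p + path_cost w q" by (simp add: path_cost_def j)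
  show "nontree_count T (p @ tl q) = nontree_count T p + nontree_count T q"
    by (simp add: nontree_count_def j)
qed

text \<open>Induction on the total length. A shared interior vertex splits both paths, and the
  halves agree by induction; without one, the first path followed by the second reversed is a simple
  cycle.\<close>

lemma tree_path_unique:
  assumes acyclic: "\<not> (\<exists>c. simple_cycle T c)"
    and "walk T p" "walk T q" "distinct p" "distinct q" "hd p = hd q" "last p = last q"
  shows "p = q"
  using assms(2-)
proof (induction "length p + length q" arbitrary: p q rule: less_induct)
  case less
  show ?case
  proof (rule ccontr)
    assume neq: "p \<noteq> q"
    have ne: "p \<noteq> []" "q \<noteq> []" using less.prems by (auto simp: walk_def)
    define a b where "a = hd p" and "b = last p"
    obtain p' q' where p': "p = a # p'" and q': "q = a # q'"
      using ne less.prems by (metis a_def list.collapse)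
    have sing: "r = [hd r]" if "r \<noteq> []" "distinct r" "hd r = last r" for r :: "'a list"
      using that by (cases r) (auto split: if_splits)
    have "a \<noteq> b" using sing[of p] sing[of q] less.prems ne neq by (metis a_def b_def)
    then have ne': "p' \<noteq> []" "q' \<noteq> []" using less.prems by (auto simp: p' q' b_def)
    have interior: "x \<in> {a, b}" if x: "x \<in> set p" "x \<in> set q" for x
    proof (rule ccontr)
      assume "x \<notin> {a, b}"
      obtain p1 p2 where p: "p = p1 @ x # p2" using x by (meson split_list)
      obtain q1 q2 where q: "q = q1 @ x # q2" using x by (meson split_list)
      have nn: "p1 \<noteq> []" "p2 \<noteq> []" "q1 \<noteq> []" "q2 \<noteq> []"
        using \<open>x \<notin> {a, b}\<close> less.prems p q by (auto simp: a_def b_def)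
      have w: "walk T (p1 @ [x])" "walk T (x # p2)" "walk T (q1 @ [x])" "walk T (x # q2)"
        using less.prems path_edges_append[of p1 x p2] path_edges_append[of q1 x q2]
        by (auto simp: walk_def p q)
      have "p1 @ [x] = q1 @ [x]"
        by (rule less.hyps) (use nn w less.prems p q in \<open>auto simp: hd_append\<close>)
      moreover have "x # p2 = x # q2"
        by (rule less.hyps) (use nn w less.prems p q in auto)
      ultimately show False using neq p q by simp
    qed
    \<comment> \<open>Both common endpoints must occur once: \<open>q'\<close> lacks the start
      \<open>a\<close>, and \<open>butlast\<close> removes the end \<open>b\<close>.\<close>
    define c where c: "c = p @ rev (butlast q')"
    have b: "last p = b" "last q = b" "last q' = b" using less.prems ne' by (auto simp: b_def q')
    have closed: "c @ [hd c] = p @ tl (rev q)"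
    proof -
      have "q' = butlast q' @ [b]" using ne' b(3) by (metis append_butlast_last_id)
      then have "rev q' = b # rev (butlast q')" by (metis rev_eq_Cons_iff rev_rev_ident)
      then have "rev q = b # rev (butlast q') @ [a]" by (simp add: q')
      then show ?thesis using ne by (simp add: c a_def)
    qed
    have "cycle_edges c = ends ` set (path_edges p @ path_edges (rev q))"
    proof -
      have "c \<noteq> []" using ne c by simp
      moreover have "last p = hd (rev q)" using b ne by (simp add: hd_rev)
      ultimately show ?thesis
        using cycle_edges_path_edges[of c] closed path_edges_join[of p "rev q"] ne by simp
    qed
    moreover have "walk T (rev q)" using less.prems by simp
    ultimately have "cycle_edges c \<subseteq> T"
      using less.prems by (auto simp: walk_def simp del: walk_rev ends_pair)
    moreover have "distinct c"
    proof -
      have "x \<notin> set p" if x: "x \<in> set (butlast q')" for x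
      proof
        assume "x \<in> set p"
        moreover have "x \<in> set q" using x by (auto simp: q' dest: in_set_butlastD)
        ultimately have "x = a \<or> x = b" using interior by blast
        moreover have "a \<notin> set q'" using less.prems q' by simp
        then have "x \<noteq> a" using x by (auto dest: in_set_butlastD)
        moreover have "x \<noteq> b"
        proof -
          have "q' = butlast q' @ [b]" using ne' b(3) by (metis append_butlast_last_id)
          then have "b \<notin> set (butlast q')"
            using less.prems q' by (metis distinct.simps(2) distinct_append disjoint_insert(1) list.set(2))
          then show ?thesis using x by blast
        qed
        ultimately show False by blast
      qed
      moreover have "distinct (butlast q')" using less.prems q' by (simp add: distinct_butlast)
      ultimately show ?thesis using less.prems by (auto simp: c)
    qed
    \<comment> \<open>A shorter list would force both paths to be the single edge from
      \<open>a\<close> to \<open>b\<close>, contradicting that they differ.\<close>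
    moreover have "3 \<le> length c"
    proof (rule ccontr)
      assume "\<not> 3 \<le> length c"
      then have "length p + (length q' - 1) < 3" by (simp add: c)
      then have "length p' = 1" "length q' = 1" using ne' by (cases p'; cases q'; auto simp: p')+
      then have "p' = [b]" "q' = [b]" using b ne' by (auto simp: length_Suc_conv p')
      then show False using neq p' q' by simp
    qed
    ultimately show False using acyclic by (auto simp: simple_cycle_def)
  qed
qed

lemma walk_between_walk:
  "walk_between V E u p v \<longleftrightarrow> walk E p \<and> hd p = u \<and> last p = v \<and> set p \<subseteq> V"
proof -
  have "successively (\<lambda>x y. {x, y} \<in> E) p \<longleftrightarrow> (\<forall>f\<in>set (path_edges p). ends f \<in> E)"
    by (induction p rule: induct_list012) auto
  then show ?thesis by (auto simp: walk_between_def walk_def simp del: ends_pair)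
qed

lemma walk_vertices:
  assumes "walk E p" "\<And>e. e \<in> E \<Longrightarrow> e \<subseteq> V" "hd p \<in> V"
  shows "set p \<subseteq> V"
  using assms(1,3) by (induction p rule: induct_list012) (auto dest: assms(2))

lemma graph_dist_walk:
  assumes "walk_between V E u p v"
  obtains q where "walk_between V E u q v" "length q = Suc (graph_dist V E u v)"
proof -
  have "\<exists>l q. walk_between V E u q v \<and> length q = Suc l"
    using assms by (intro exI[of _ "length p - 1"] exI[of _ p]) (auto simp: walk_between_def)
  from LeastI_ex[OF this] show thesis using that unfolding graph_dist_def by blast
qed

text \<open>Erasing loops from a shortest walk gives a path with the same ends. By uniqueness it is
  \<open>p\<close>, so \<open>p\<close> is no longer than the distance of its ends.\<close>

lemma tree_path_length_le_diameter:
  assumes tree: "spanning_tree V E T" and graph: "simple_graph V E"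
    and p: "walk T p" "distinct p" "hd p \<in> V"
  shows "length p \<le> Suc (diameter V T)"
proof -
  have T: "e \<subseteq> V" if "e \<in> T" for e
    using that tree graph by (auto simp: spanning_tree_def simple_graph_def)
  have V: "set p \<subseteq> V" by (rule walk_vertices[OF p(1) T p(3)])
  define u v where "u = hd p" and "v = last p"
  have "p \<noteq> []" using p by (auto simp: walk_def)
  then have uv: "u \<in> V" "v \<in> V" using V p by (auto simp: u_def v_def)
  have "walk_between V T u p v" using p V by (simp add: walk_between_walk u_def v_def)
  then obtain q where q: "walk_between V T u q v" "length q = Suc (graph_dist V T u v)"
    by (rule graph_dist_walk)
  then have wq: "walk T q" "hd q = u" "last q = v" by (auto simp: walk_between_walk)
  obtain r where r: "r \<noteq> []" "hd r = hd q" "last r = last q" "mset (path_edges r) \<subseteq># mset (path_edges q)"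
    "distinct r" "\<not> distinct q \<Longrightarrow> length r < length q"
    using loop_erasure[of q] wq by (metis walk_simps(1))
  have "walk T r" by (rule walk_mono[OF r(4,1) wq(1)])
  then have "p = r"
    using tree p r wq by (intro tree_path_unique[of T]) (auto simp: spanning_tree_def u_def v_def)
  moreover have "length r \<le> length q"
  proof -
    have "length (path_edges r) \<le> length (path_edges q)"
      using size_mset_mono[OF r(4)] by simp
    moreover have "q \<noteq> []" using wq by auto
    ultimately show ?thesis using r(1) by (cases r; cases q) auto
  qed
  moreover have "graph_dist V T u v \<le> diameter V T"
  proof -
    have "finite V" using graph by (simp add: simple_graph_def)
    then have "finite ((\<lambda>(u, v). graph_dist V T u v) ` (V \<times> V))" by simp
    moreover have "(\<lambda>(u, v). graph_dist V T u v) ` (V \<times> V) = {graph_dist V T u v | u v. u \<in> V \<and> v \<in> V}"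
      by auto
    ultimately show ?thesis unfolding diameter_def by (intro Max_ge) (use uv in auto)
  qed
  ultimately show ?thesis using q(2) by simp
qed

text \<open>Non-tree edges cut the path into one more tree segment than their number. The induction
  keeps the leading segment open and charges \<open>d\<close> only for those already closed
  off.\<close>

lemma path_length_nontree:
  assumes seg: "\<And>s. walk T s \<Longrightarrow> distinct s \<Longrightarrow> set s \<subseteq> V \<Longrightarrow> length s \<le> d"
    and "p \<noteq> []" "distinct p" "set p \<subseteq> V"
  shows "length p \<le> (nontree_count T p + 1) * d"
proof -
  have "\<exists>s r. p = s @ r \<and> walk T s \<and> length p \<le> nontree_count T p * d + length s"
    using assms(2-)
  proof (induction p rule: induct_list012)
    case (2 x)
    then show ?case by (intro exI[of _ "[x]"] exI[of _ "[]"]) simp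
  next
    case (3 x y p)
    from 3(2) obtain s r where s: "y # p = s @ r" "walk T s"
      "length (y # p) \<le> nontree_count T (y # p) * d + length s" using 3(3-) by fastforce
    then obtain s' where s': "s = y # s'" by (cases s) auto
    show ?case
    proof (cases "{x, y} \<in> T")
      case True
      with s s' show ?thesis by (intro exI[of _ "x # s"] exI[of _ r]) auto
    next
      case False
      have "distinct s" "set s \<subseteq> V"
        using 3(4,5) s(1) by (metis distinct.simps(2) distinct_append, metis set_subset_Cons set_append sup.bounded_iff subset_trans)
      then have "length s \<le> d" using seg s(2) by blast
      with s(3) False show ?thesis by (intro exI[of _ "[x]"] exI[of _ "y # p"]) simp
    qed
  qed simp
  then obtain s r where s: "p = s @ r" "walk T s" "length p \<le> nontree_count T p * d + length s" by blast
  moreover have "length s \<le> d" using s assms(3,4) by (intro seg) auto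
  ultimately show ?thesis by (simp add: add_mult_distrib)
qed

text \<open>Depth-first positions on a line of twice the total weight, dominating tree distances. They are
  built by adding one leaf at a time.\<close>

lemma line_embedding:
  assumes conn: "connected_graph V T" and V: "finite V" and T: "finite T"
  shows "card V \<le> Suc (card T)" and "\<exists>pos :: 'a \<Rightarrow> int. \<forall>a\<in>V. \<forall>b\<in>V. 0 \<le> pos a \<and> pos a \<le> 2 * int (\<Sum>e\<in>T. w e) \<and>
    (\<exists>p. walk T p \<and> hd p = a \<and> last p = b \<and> int (path_cost w p) \<le> \<bar>pos a - pos b\<bar>)"
proof -
  \<comment> \<open>The equation between \<open>card S\<close> and \<open>card F\<close> is carried
    along to obtain the bound on \<open>card V\<close> from the same construction.\<close>
  define ok where "ok S F pos \<longleftrightarrow> S \<subseteq> V \<and> F \<subseteq> T \<and> (\<forall>e\<in>F. e \<subseteq> S) \<and> card S = Suc (card F) \<and>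
    (\<forall>a\<in>S. \<forall>b\<in>S. 0 \<le> pos a \<and> pos a \<le> 2 * int (\<Sum>e\<in>F. w e) \<and>
      (\<exists>p. walk T p \<and> hd p = a \<and> last p = b \<and> int (path_cost w p) \<le> \<bar>pos a - pos b\<bar>))"
    for S F and pos :: "'a \<Rightarrow> int"
  have "\<exists>S F pos. ok S F pos \<and> card S = Suc n" if "Suc n \<le> card V" for n
    using that
  proof (induction n)
    case 0
    obtain r where "r \<in> V" using conn by (auto simp: connected_graph_def)
    then have "ok {r} {} (\<lambda>_. 0)" by (auto simp: ok_def intro!: exI[of _ "[r]"])
    then show ?case by (intro exI[of _ "{r}"]) auto
  next
    case (Suc n)
    then obtain S F pos where S: "ok S F pos" "card S = Suc n" by auto
    then have "S \<noteq> V" "S \<subseteq> V" "S \<noteq> {}" using Suc.prems by (auto simp: ok_def)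
    then obtain s v where sv: "s \<in> S" "v \<in> V" "v \<notin> S" by blast
    then obtain q where q: "walk T q" "hd q = s" "last q = v" "set q \<subseteq> V"
      using conn \<open>S \<subseteq> V\<close> unfolding connected_graph_def walk_between_walk by blast
    have "\<exists>y x. {y, x} \<in> T \<and> y \<in> S \<and> x \<in> V - S"
      using q sv
    proof (induction q arbitrary: s rule: induct_list012)
      case (3 a b q)
      then show ?case by (cases "b \<in> S") auto
    qed auto
    then obtain y x where yx: "{y, x} \<in> T" "y \<in> S" "x \<in> V" "x \<notin> S" by blast
    define c where "c = w {y, x}"
    \<comment> \<open>The leaf \<open>x\<close> is put at distance \<open>c\<close> to the right of
      \<open>y\<close>, and everything right of \<open>y\<close> moves by \<open>2 * c\<close>. So
      \<open>x\<close> is at least \<open>c\<close> further than \<open>y\<close> from every old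
      point, on either side, and old distances never shrink.\<close>
    define pos' where "pos' = (\<lambda>z. if z = x then pos y + int c else if pos z > pos y then pos z + 2 * int c else pos z)"
    have new: "{y, x} \<notin> F" using S yx by (auto simp: ok_def)
    have finF: "finite F" using S T by (auto simp: ok_def intro: finite_subset)
    have sum: "(\<Sum>e\<in>insert {y, x} F. w e) = c + (\<Sum>e\<in>F. w e)"
      using new finF by (simp add: c_def)
    have posS: "0 \<le> pos a" "pos a \<le> 2 * int (\<Sum>e\<in>F. w e)"
      "\<exists>p. walk T p \<and> hd p = a \<and> last p = b \<and> int (path_cost w p) \<le> \<bar>pos a - pos b\<bar>"
      if "a \<in> S" "b \<in> S" for a b
      using S(1) that by (auto simp: ok_def)
    have walk: "\<exists>p. walk T p \<and> hd p = a \<and> last p = b \<and> int (path_cost w p) \<le> \<bar>pos' a - pos' b\<bar>"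
      if ab: "a \<in> insert x S" "b \<in> insert x S" for a b
    proof -
      have leaf: "\<exists>p. walk T p \<and> hd p = x \<and> last p = b \<and> int (path_cost w p) \<le> \<bar>pos' x - pos' b\<bar>"
        if b: "b \<in> S" for b
      proof -
        obtain p where p: "walk T p" "hd p = y" "last p = b" "int (path_cost w p) \<le> \<bar>pos y - pos b\<bar>"
          using posS(3)[OF yx(2) b] by blast
        then obtain p' where p': "p = y # p'" by (cases p) auto
        have "b \<noteq> x" using b yx by blast
        then have "int c + \<bar>pos y - pos b\<bar> \<le> \<bar>pos' x - pos' b\<bar>" by (auto simp: pos'_def)
        then show ?thesis using p yx(1)
          by (intro exI[of _ "x # p"]) (auto simp: p' c_def insert_commute)
      qed
      show ?thesis
      proof (cases "a = x"; cases "b = x")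
        assume "a = x" "b = x"
        then show ?thesis by (intro exI[of _ "[x]"]) auto
      next
        assume "a = x" "b \<noteq> x"
        then show ?thesis using leaf[of b] ab by auto
      next
        assume "a \<noteq> x" "b = x"
        then obtain p where "walk T p" "hd p = x" "last p = a" "int (path_cost w p) \<le> \<bar>pos' x - pos' a\<bar>"
          using leaf[of a] ab by auto
        with \<open>b = x\<close> show ?thesis
          by (intro exI[of _ "rev p"]) (auto simp: hd_rev last_rev abs_minus_commute walk_def[of T p])
      next
        assume "a \<noteq> x" "b \<noteq> x"
        then obtain p where p: "walk T p" "hd p = a" "last p = b" "int (path_cost w p) \<le> \<bar>pos a - pos b\<bar>"
          using posS(3)[of a b] ab by auto
        have "\<bar>pos a - pos b\<bar> \<le> \<bar>pos' a - pos' b\<bar>"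
          using \<open>a \<noteq> x\<close> \<open>b \<noteq> x\<close> by (auto simp: pos'_def)
        then show ?thesis using p by (intro exI[of _ p]) auto
      qed
    qed
    have range: "0 \<le> pos' a \<and> pos' a \<le> 2 * int (c + (\<Sum>e\<in>F. w e))" if "a \<in> insert x S" for a
      using posS(1,2)[of a a] posS(1,2)[of y y] yx(2) that by (auto simp: pos'_def)
    have card_new: "card (insert x S) = Suc (Suc n)"
      using S(2) yx(4) by (metis card.infinite card_insert_disjoint nat.distinct(1))
    moreover have "card F = n" using S by (simp add: ok_def)
    ultimately have "card (insert x S) = Suc (card (insert {y, x} F))"
      using new finF by simp
    then have "ok (insert x S) (insert {y, x} F) pos'"
      using S(1) yx walk range unfolding ok_def sum by auto
    moreover note card_new
    ultimately show ?case by blast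
  qed
  note grow = this
  have "card V \<noteq> 0" using conn V by (auto simp: connected_graph_def)
  then obtain n where n: "card V = Suc n" by (cases "card V") auto
  obtain S F pos where S: "ok S F pos" "card S = card V" using grow[of n] n by fastforce
  then have SV: "S = V" using V by (metis card_subset_eq ok_def)
  have "(\<Sum>e\<in>F. w e) \<le> (\<Sum>e\<in>T. w e)"
    using S(1) T by (intro sum_mono2) (auto simp: ok_def)
  then have "2 * int (\<Sum>e\<in>F. w e) \<le> 2 * int (\<Sum>e\<in>T. w e)" by linarith
  then show "\<exists>pos :: 'a \<Rightarrow> int. \<forall>a\<in>V. \<forall>b\<in>V. 0 \<le> pos a \<and> pos a \<le> 2 * int (\<Sum>e\<in>T. w e) \<and>
    (\<exists>p. walk T p \<and> hd p = a \<and> last p = b \<and> int (path_cost w p) \<le> \<bar>pos a - pos b\<bar>)"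
    using S(1) unfolding ok_def SV by (intro exI[of _ pos]) (blast intro: order.trans)
  have "card F \<le> card T" using S(1) T by (auto simp: ok_def intro: card_mono)
  then show "card V \<le> Suc (card T)" using S(1) by (simp add: ok_def SV)
qed

section \<open>Independent sets and short cycles\<close>

text \<open>In the digraph with an arc from \<open>x\<close> to each element of \<open>A x\<close>
  the average in-degree is at most \<Delta>, so some \<open>y\<close> has in-degree at most
  \<Delta>. Keeping \<open>y\<close> and deleting its in- and out-neighbours removes at most
  \<open>2 * \<Delta> + 1\<close> vertices. Both directions must go because the relation need not be
  symmetric.\<close>

lemma independent_subset:
  fixes A :: "'b \<Rightarrow> 'b set"
  assumes "finite S" "\<And>x. x \<in> S \<Longrightarrow> finite (A x) \<and> card (A x) \<le> \<Delta>"
  shows "\<exists>I\<subseteq>S. card S \<le> (2 * \<Delta> + 1) * card I \<and> (\<forall>x\<in>I. \<forall>y\<in>I. x \<noteq> y \<longrightarrow> y \<notin> A x)"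
  using assms
proof (induction "card S" arbitrary: S rule: less_induct)
  case less
  show ?case
  proof (cases "S = {}")
    case True
    then show ?thesis by (intro exI[of _ "{}"]) auto
  next
    case False
    define P where "P = {(x, y). x \<in> S \<and> y \<in> S \<and> y \<in> A x}"
    have P: "P = Sigma S (\<lambda>x. A x \<inter> S)" by (auto simp: P_def)
    have "card P = (\<Sum>x\<in>S. card (A x \<inter> S))" using less.prems by (simp add: P)
    also have "\<dots> \<le> (\<Sum>x\<in>S. \<Delta>)"
      using less.prems by (intro sum_mono order.trans[OF card_mono less.prems(2)[THEN conjunct2]]) auto
    finally have P1: "card P \<le> card S * \<Delta>" by simp
    have "P = prod.swap ` Sigma S (\<lambda>y. {x\<in>S. y \<in> A x})" by (auto simp: P_def)
    then have P2: "card P = (\<Sum>y\<in>S. card {x\<in>S. y \<in> A x})"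
      using less.prems by (simp add: card_image)
    obtain y where y: "y \<in> S" "card {x\<in>S. y \<in> A x} \<le> \<Delta>"
    proof (rule ccontr)
      assume "\<not> thesis"
      then have "\<And>y. y \<in> S \<Longrightarrow> \<Delta> < card {x\<in>S. y \<in> A x}" using that by force
      then have "(\<Sum>y\<in>S. \<Delta>) < (\<Sum>y\<in>S. card {x\<in>S. y \<in> A x})"
        using less.prems False by (intro sum_strict_mono) auto
      then show False using P1 P2 by simp
    qed
    define D where "D = insert y ({x\<in>S. y \<in> A x} \<union> (A y \<inter> S))"
    have D: "D \<subseteq> S" "y \<in> D" using y by (auto simp: D_def)
    have "card D \<le> Suc (card ({x\<in>S. y \<in> A x} \<union> (A y \<inter> S)))"
      unfolding D_def by (rule card_insert_le_m1) auto
    also have "card ({x\<in>S. y \<in> A x} \<union> (A y \<inter> S)) \<le> card {x\<in>S. y \<in> A x} + card (A y \<inter> S)"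
      by (rule card_Un_le)
    also have "card (A y \<inter> S) \<le> \<Delta>"
      using less.prems(2)[OF y(1)] by (meson card_mono inf_le1 order.trans)
    finally have cD: "card D \<le> 2 * \<Delta> + 1" using y(2) by simp
    have "card (S - D) < card S" using D less.prems(1) by (intro psubset_card_mono) auto
    then obtain I where I: "I \<subseteq> S - D" "card (S - D) \<le> (2 * \<Delta> + 1) * card I"
      "\<forall>x\<in>I. \<forall>z\<in>I. x \<noteq> z \<longrightarrow> z \<notin> A x"
      using less.hyps[of "S - D"] less.prems by auto
    have fin: "finite I" "finite D" using I D less.prems(1) by (auto intro: finite_subset)
    have "card S = card (S - D) + card D"
      using D less.prems(1) by (metis card_Diff_subset card_mono fin(2) le_add_diff_inverse2)
    also have "\<dots> \<le> (2 * \<Delta> + 1) * card (insert y I)"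
      using I(1,2) cD D fin by (subst card_insert_disjoint) auto
    finally show ?thesis
      using I y by (intro exI[of _ "insert y I"]) (auto simp: D_def)
  qed
qed

text \<open>Ball of radius \<open>j\<close> in an undirected multigraph whose edges are labels with
  endpoints \<open>f\<close> and \<open>g\<close>. Loops and parallel edges have to be allowed since
  they arise when vertices are merged into blocks.\<close>

primrec reach :: "('e \<Rightarrow> 'v) \<Rightarrow> ('e \<Rightarrow> 'v) \<Rightarrow> 'e set \<Rightarrow> nat \<Rightarrow> 'v \<Rightarrow> 'v set" where
  "reach f g S 0 x = {x}"
| "reach f g S (Suc j) x = reach f g S j x \<union> {y. \<exists>e\<in>S. (f e \<in> reach f g S j x \<and> y = g e) \<or> (g e \<in> reach f g S j x \<and> y = f e)}"

lemma reach_mono: "i \<le> j \<Longrightarrow> reach f g S i x \<subseteq> reach f g S j x"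
  by (rule lift_Suc_mono_le) auto

lemma reach_mono_set: "S \<subseteq> S' \<Longrightarrow> reach f g S j x \<subseteq> reach f g S' j x"
  by (induction j) auto

lemma reach_self: "x \<in> reach f g S j x"
  by (induction j) auto

lemma reach_trans: "y \<in> reach f g S i x \<Longrightarrow> z \<in> reach f g S j y \<Longrightarrow> z \<in> reach f g S (i + j) x"
proof (induction j arbitrary: z)
  case (Suc j)
  then show ?case by auto
qed auto

lemma reach_sym: "y \<in> reach f g S j x \<Longrightarrow> x \<in> reach f g S j y"
proof (induction j arbitrary: y)
  case (Suc j)
  show ?case
  proof (cases "y \<in> reach f g S j x")
    case True
    then show ?thesis using Suc.IH by auto
  next
    case False
    then obtain e z where e: "e \<in> S" "z \<in> reach f g S j x" "(z = f e \<and> y = g e) \<or> (z = g e \<and> y = f e)"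
      using Suc.prems by auto
    then have "z \<in> reach f g S 1 y" by auto
    from reach_trans[OF this Suc.IH[OF e(2)]] show ?thesis by simp
  qed
qed auto

lemma reach_subset: "x \<in> Q \<Longrightarrow> (\<And>e. e \<in> S \<Longrightarrow> f e \<in> Q \<and> g e \<in> Q) \<Longrightarrow> reach f g S j x \<subseteq> Q"
  by (induction j) auto

text \<open>A shortest path to a vertex at distance \<open>j\<close> only uses edges between consecutive levels.\<close>

lemma reach_delete:
  assumes "y \<in> reach f g S j x"
    and "\<And>i. i < j \<Longrightarrow> \<not> (f e \<in> reach f g S i x \<and> g e \<in> reach f g S (Suc i) x - reach f g S i x)"
    and "\<And>i. i < j \<Longrightarrow> \<not> (g e \<in> reach f g S i x \<and> f e \<in> reach f g S (Suc i) x - reach f g S i x)"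
  shows "y \<in> reach f g (S - {e}) j x"
  using assms
proof (induction j arbitrary: y)
  case (Suc j)
  show ?case
  proof (cases "y \<in> reach f g S j x")
    case True
    then show ?thesis using Suc by auto
  next
    case False
    then obtain e' z where e': "e' \<in> S" "z \<in> reach f g S j x" "(z = f e' \<and> y = g e') \<or> (z = g e' \<and> y = f e')"
      using Suc.prems by auto
    then have "e' \<noteq> e" using Suc.prems(1) Suc.prems(2)[of j] Suc.prems(3)[of j] False by auto
    moreover have "z \<in> reach f g (S - {e}) j x" using Suc.IH[OF e'(2)] Suc.prems by auto
    ultimately show ?thesis using e' by auto
  qed
qed auto

text \<open>The Moore bound. A ball that does not double when its radius grows by one meets as many edges
  as it has vertices in the larger ball, or else some edge closes a short cycle; such balls are removed
  one after another.\<close>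

lemma short_cycle:
  fixes f g :: "'e \<Rightarrow> 'v"
  assumes "finite Q" "finite I" "\<And>e. e \<in> I \<Longrightarrow> f e \<in> Q \<and> g e \<in> Q" "card Q \<le> 2 ^ L"
    and "2 * card Q < card I"
  shows "\<exists>e\<in>I. g e \<in> reach f g (I - {e}) (2 * L + 1) (f e)"
proof (rule ccontr)
  assume "\<not> ?thesis"
  then have "\<forall>e\<in>I. g e \<notin> reach f g (I - {e}) (2 * L + 1) (f e)" by blast
  with assms(1-4) have "card I \<le> 2 * card Q"
  proof (induction "card Q" arbitrary: Q I rule: less_induct)
    case less
    show ?case
    proof (cases "Q = {}")
      case True
      then have "I = {}" using less.prems by auto
      then show ?thesis by simp
    next
      case False
      then obtain x where x: "x \<in> Q" by blast
      let ?B = "\<lambda>j. reach f g I j x"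
      have BQ: "?B j \<subseteq> Q" for j using x less.prems(3) by (rule reach_subset)
      then have finB: "finite (?B j)" for j using less.prems(1) by (rule finite_subset)
      \<comment> \<open>Otherwise the balls double for \<open>L + 1\<close> radii in a row, and
        \<open>2 ^ (L + 1)\<close> vertices do not fit into \<open>Q\<close>.\<close>
      have "\<exists>l\<le>L. card (?B (Suc l)) \<le> 2 * card (?B l)"
      proof (rule ccontr)
        assume "\<not> ?thesis"
        then have grow: "2 * card (?B l) < card (?B (Suc l))" if "l \<le> L" for l
          using that by (meson not_le)
        have "2 ^ j \<le> card (?B j)" if "j \<le> Suc L" for j
          using that
        proof (induction j)
          case (Suc j)
          then show ?case using grow[of j] by simp
        qed simp
        from this[of "Suc L"] have "2 ^ Suc L \<le> card Q"
          using card_mono[OF less.prems(1) BQ] by (meson le_refl order.trans)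
        moreover have "(2 :: nat) ^ L < 2 ^ Suc L" by simp
        ultimately show False using less.prems(4) by linarith
      qed
      then obtain l where l: "l \<le> L" "card (?B (Suc l)) \<le> 2 * card (?B l)" by blast
      define J where "J = {e\<in>I. f e \<in> ?B l \<or> g e \<in> ?B l}"
      have noshort: "g e \<notin> reach f g (I - {e}) j (f e)" if "e \<in> I" "j \<le> 2 * L + 1" for e j
        using less.prems(5) that reach_mono[of j "2 * L + 1" f g "I - {e}" "f e"] by blast
      define lev where "lev y = (LEAST j. y \<in> ?B j)" for y
      have lev: "y \<in> ?B (lev y)" "lev y \<le> j" if "y \<in> ?B j" for y j
        using that unfolding lev_def by (auto intro: LeastI Least_le)
      have lev_iff: "y \<in> ?B j \<longleftrightarrow> lev y \<le> j" if "y \<in> ?B i" for y i j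
        using lev[OF that] lev(2)[of y j] reach_mono[of "lev y" j f g I x] by blast
      have JB: "f e \<in> ?B (Suc l)" "g e \<in> ?B (Suc l)" if "e \<in> J" for e
        using that by (auto simp: J_def)
      \<comment> \<open>Shortest paths from \<open>x\<close> avoid \<open>e\<close> if its ends are
        on equal levels, or if the goal is strictly closer to \<open>x\<close> than the farther end
        of \<open>e\<close>.\<close>
      have delete: "y \<in> reach f g (I - {e}) (lev y) x"
        if e: "e \<in> J" and y: "y \<in> ?B (Suc l)" and far: "lev (f e) = lev (g e) \<or> lev y < max (lev (f e)) (lev (g e))" for e y
        by (rule reach_delete[OF lev(1)[OF y]])
           (use far lev_iff[OF JB(1)[OF e]] lev_iff[OF JB(2)[OF e]] in \<open>auto simp del: reach.simps\<close>)
      define top where "top e = (if lev (f e) < lev (g e) then g e else f e)" for e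
      define bot where "bot e = (if lev (f e) < lev (g e) then f e else g e)" for e
      \<comment> \<open>An edge within one level closes a walk through \<open>x\<close> of length at
        most \<open>2 * l\<close> that avoids it.\<close>
      have neq: "lev (f e) \<noteq> lev (g e)" if e: "e \<in> J" for e
      proof
        assume eq: "lev (f e) = lev (g e)"
        have "lev (f e) \<le> l" using e eq lev(2)[of "f e" l] lev(2)[of "g e" l] by (auto simp: J_def)
        moreover have "g e \<in> reach f g (I - {e}) (lev (f e) + lev (g e)) (f e)"
          by (rule reach_trans[OF reach_sym[OF delete[OF e JB(1)[OF e] disjI1[OF eq]]]
                delete[OF e JB(2)[OF e] disjI1[OF eq]]])
        ultimately show False using noshort[of e "lev (f e) + lev (g e)"] e l eq by (auto simp: J_def)
      qed
      have bot: "bot e \<in> ?B (Suc l)" "lev (bot e) \<le> l" "lev (bot e) < lev (top e)" if e: "e \<in> J" for e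
        using JB[OF e] neq[OF e] e lev(2)[of "f e" l] lev(2)[of "g e" l]
        by (auto simp: bot_def top_def J_def simp del: reach.simps)
      \<comment> \<open>If two edges share their upper end, one can go from the lower end of
        \<open>e\<close> through \<open>x\<close> to the lower end of \<open>e'\<close> and then
        along \<open>e'\<close>. This replaces \<open>e\<close> by a walk of length at most
        \<open>2 * l + 1\<close>. Hence \<open>J\<close> has no more edges than the larger ball has
        vertices.\<close>
      have "inj_on top J"
      proof (rule inj_onI, rule ccontr)
        fix e e' assume e: "e \<in> J" "e' \<in> J" and top: "top e = top e'" and ne: "e \<noteq> e'"
        have max: "lev (top e) = max (lev (f e)) (lev (g e))" by (auto simp: top_def)
        have "lev (top e) \<le> Suc (lev (bot e'))"
        proof -
          have "bot e' \<in> ?B (lev (bot e'))" by (rule lev(1)[OF bot(1)[OF e(2)]])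
          then have "top e' \<in> ?B (Suc (lev (bot e')))"
            using e(2) by (auto simp: top_def bot_def J_def)
          then show ?thesis using lev(2) top by metis
        qed
        have d1: "bot e \<in> reach f g (I - {e}) (lev (bot e)) x"
          using delete[OF e(1) bot(1)[OF e(1)]] bot(3)[OF e(1)] max by simp
        have d2: "bot e' \<in> reach f g (I - {e}) (lev (bot e')) x"
          using delete[OF e(1) bot(1)[OF e(2)]] bot(3)[OF e(2)] top max by simp
        have "top e' \<in> reach f g (I - {e}) 1 (bot e')"
          using e ne by (auto simp: top_def bot_def J_def)
        from reach_trans[OF reach_trans[OF reach_sym[OF d1] d2] this]
        have "top e \<in> reach f g (I - {e}) (lev (bot e) + lev (bot e') + 1) (bot e)" using top by simp
        then have "g e \<in> reach f g (I - {e}) (lev (bot e) + lev (bot e') + 1) (f e)"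
          by (auto simp: top_def bot_def simp del: reach.simps split: if_splits intro: reach_sym)
        moreover have "lev (bot e) + lev (bot e') + 1 \<le> 2 * L + 1"
          using bot(2)[OF e(1)] bot(2)[OF e(2)] l(1) by linarith
        moreover have "e \<in> I" using e(1) by (simp add: J_def)
        ultimately show False using noshort by blast
      qed
      moreover have "top ` J \<subseteq> ?B (Suc l)" using JB by (auto simp: top_def)
      ultimately have "card J \<le> card (?B (Suc l))" using finB by (intro card_inj_on_le)
      then have J: "card J \<le> 2 * card (?B l)" using l(2) by linarith
      have sub: "?B l \<subseteq> Q" "x \<in> ?B l" using BQ by (auto simp: reach_self)
      \<comment> \<open>Every edge that meets the inner ball is in \<open>J\<close>, so the rest
        lives on the remaining vertices and the induction hypothesis applies.\<close>
      have "card (I - J) \<le> 2 * card (Q - ?B l)"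
      proof (rule less.hyps)
        show "card (Q - ?B l) < card Q" using sub less.prems(1) by (intro psubset_card_mono) auto
        show "card (Q - ?B l) \<le> 2 ^ L"
          using card_mono[OF less.prems(1), of "Q - ?B l"] less.prems(4) by auto
        show "\<forall>e\<in>I - J. g e \<notin> reach f g (I - J - {e}) (2 * L + 1) (f e)"
        proof
          fix e assume e: "e \<in> I - J"
          have "reach f g (I - J - {e}) (2 * L + 1) (f e) \<subseteq> reach f g (I - {e}) (2 * L + 1) (f e)"
            by (rule reach_mono_set) blast
          then show "g e \<notin> reach f g (I - J - {e}) (2 * L + 1) (f e)"
            using noshort[of e "2 * L + 1"] e by blast
        qed
        show "f e \<in> Q - ?B l \<and> g e \<in> Q - ?B l" if "e \<in> I - J" for e
          using that less.prems(3) by (auto simp: J_def)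
      qed (use less.prems(1,2) in auto)
      moreover have "card I = card (I - J) + card J"
        using less.prems(2) card_Diff_subset[of J I] card_mono[of I J] by (auto simp: J_def finite_subset)
      moreover have "card Q = card (Q - ?B l) + card (?B l)"
        using less.prems(1) sub card_Diff_subset[OF finB sub(1)] card_mono[OF less.prems(1) sub(1)] by simp
      ultimately show ?thesis using J by linarith
    qed
  qed
  with assms(5) show False by simp
qed

section \<open>Existence of a cheap cycle\<close>

text \<open>The map \<open>cl\<close> sends a vertex to its block. A walk through blocks lifts to
  \<open>j\<close> non-tree edges joined by at most \<open>j + 1\<close> tree paths inside blocks.
  Costs are multiplied by \<open>r\<close> throughout, which avoids division in the
  naturals.\<close>

lemma reach_walk:
  assumes cls: "\<And>a b. a \<in> V \<Longrightarrow> b \<in> V \<Longrightarrow> cl a = cl b \<Longrightarrow>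
      \<exists>p. walk T p \<and> hd p = a \<and> last p = b \<and> r * path_cost w p \<le> X"
    and S: "\<And>e. e \<in> S \<Longrightarrow> e = {ua e, ub e} \<and> ua e \<in> V \<and> ub e \<in> V \<and> r * w e \<le> Y"
    and y: "y \<in> reach (\<lambda>e. cl (ua e)) (\<lambda>e. cl (ub e)) S j x"
    and a: "a \<in> V" "cl a = x" and b: "b \<in> V" "cl b = y"
  shows "\<exists>p. walk (T \<union> S) p \<and> hd p = a \<and> last p = b \<and> nontree_count T p \<le> j \<and>
    r * path_cost w p \<le> (j + 1) * X + j * Y"
  using y b
proof (induction j arbitrary: y b)
  case 0
  then obtain p where p: "walk T p" "hd p = a" "last p = b" "r * path_cost w p \<le> X"
    using cls[of a b] a by auto
  have "nontree_count T p = 0" using p(1) by (auto simp: nontree_count_def walk_def filter_empty_conv simp del: ends_pair)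
  moreover have "walk (T \<union> S) p" using p(1) by (auto simp: walk_def)
  ultimately show ?case using p by auto
next
  case (Suc j)
  show ?case
  proof (cases "y \<in> reach (\<lambda>e. cl (ua e)) (\<lambda>e. cl (ub e)) S j x")
    case True
    have "(j + 1) * X + j * Y \<le> (Suc j + 1) * X + Suc j * Y" by (intro add_mono mult_le_mono) auto
    obtain p where "walk (T \<union> S) p" "hd p = a" "last p = b" "nontree_count T p \<le> j"
      "r * path_cost w p \<le> (j + 1) * X + j * Y"
      using Suc.IH[OF True Suc.prems(2,3)] by blast
    then show ?thesis using \<open>(j + 1) * X + j * Y \<le> _\<close> by (intro exI[of _ p]) linarith
  next
    case False
    then obtain e where e: "e \<in> S" and alt: "(cl (ua e) \<in> reach (\<lambda>e. cl (ua e)) (\<lambda>e. cl (ub e)) S j x \<and> y = cl (ub e)) \<or>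
      (cl (ub e) \<in> reach (\<lambda>e. cl (ua e)) (\<lambda>e. cl (ub e)) S j x \<and> y = cl (ua e))"
      using Suc.prems(1) by auto
    obtain c d where cd: "e = {c, d}" "c \<in> V" "d \<in> V" "cl c \<in> reach (\<lambda>e. cl (ua e)) (\<lambda>e. cl (ub e)) S j x" "cl d = y"
    proof -
      from alt show thesis
      proof
        assume "cl (ua e) \<in> reach (\<lambda>e. cl (ua e)) (\<lambda>e. cl (ub e)) S j x \<and> y = cl (ub e)"
        then show thesis using that[of "ua e" "ub e"] S[OF e] by auto
      next
        assume "cl (ub e) \<in> reach (\<lambda>e. cl (ua e)) (\<lambda>e. cl (ub e)) S j x \<and> y = cl (ua e)"
        then show thesis using that[of "ub e" "ua e"] S[OF e] by (auto simp: insert_commute)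
      qed
    qed
    obtain p where p: "walk (T \<union> S) p" "hd p = a" "last p = c" "nontree_count T p \<le> j"
      "r * path_cost w p \<le> (j + 1) * X + j * Y"
      using Suc.IH[OF cd(4) cd(2) refl] by blast
    obtain q where q: "walk T q" "hd q = d" "last q = b" "r * path_cost w q \<le> X"
      using cls[of d b] cd Suc.prems by auto
    then obtain q' where q': "q = d # q'" by (cases q) auto
    have nq: "nontree_count T q = 0"
      using q(1) by (auto simp: nontree_count_def walk_def filter_empty_conv simp del: ends_pair)
    have wq: "walk (T \<union> S) (c # q)"
      using q(1) e cd(1) by (auto simp: q' walk_def)
    note join = walk_Un_join[OF p(1) wq, unfolded list.sel, OF p(3)]
    have "r * path_cost w (p @ q) = r * path_cost w p + r * w e + r * path_cost w q"
      using join(4)[of w] by (simp add: q' cd(1) algebra_simps)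
    also have "\<dots> \<le> (Suc j + 1) * X + Suc j * Y"
      using p(5) q(4) S[OF e] by simp
    finally show ?thesis
      using join p(2,4) q(3) nq
      by (intro exI[of _ "p @ q"]) (auto simp: q')
  qed
qed

text \<open>Markov's inequality: fewer than half of the elements can exceed twice the
  average.\<close>

lemma half_cheap:
  fixes w :: "'b \<Rightarrow> nat"
  assumes "finite S"
  shows "card S \<le> 2 * card {e\<in>S. card S * w e \<le> 2 * (\<Sum>e\<in>S. w e)}"
proof (rule ccontr)
  define W B where "W = (\<Sum>e\<in>S. w e)" and "B = {e\<in>S. 2 * W < card S * w e}"
  assume "\<not> ?thesis"
  moreover have "card S = card {e\<in>S. card S * w e \<le> 2 * W} + card B"
    using assms unfolding B_def
    by (subst card_Un_disjoint[symmetric]) (auto intro!: arg_cong[where f = card])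
  ultimately have big: "card S < 2 * card B" by (simp add: W_def)
  have "card B * (2 * W + 1) = (\<Sum>e\<in>B. 2 * W + 1)" by simp
  also have "\<dots> \<le> (\<Sum>e\<in>B. card S * w e)" by (intro sum_mono) (auto simp: B_def)
  also have "\<dots> = card S * (\<Sum>e\<in>B. w e)" by (simp add: sum_distrib_left)
  also have "\<dots> \<le> card S * W"
    unfolding W_def using assms by (intro mult_le_mono2 sum_mono2) (auto simp: B_def)
  also have "\<dots> \<le> 2 * card B * W" using big by (intro mult_le_mono1) simp
  finally show False using big by (simp add: algebra_simps)
qed

text \<open>Keeping the cheaper half of \<open>S\<close> and then a compatible part leaves
  \<open>I\<close> with \<open>r \<le> 2 * c * card I\<close>, where \<open>c\<close> is
  \<open>2 * \<Delta> + 1\<close>. The conclusion covers both orientations because the program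
  searches from the first to the second component of a listed pair.\<close>

lemma cheap_edge:
  fixes w :: "'a set \<Rightarrow> nat"
  assumes graph: "simple_graph V E" and tree: "spanning_tree V E T"
    and S: "S \<subseteq> E - T" "S \<noteq> {}"
    and A: "\<And>e. e \<in> S \<Longrightarrow> finite (A e) \<and> card (A e) \<le> \<Delta>"
    and L: "card V \<le> 2 ^ L"
  shows "\<exists>e\<in>S. \<forall>u v. e = {u, v} \<longrightarrow> (\<exists>p. walk (T \<union> (E - T - {e} - A e)) p \<and> hd p = v \<and> last p = u \<and>
    nontree_count T p \<le> 2 * L + 1 \<and>
    card S * path_cost w p \<le> (2 * L + 2) * (16 * (2 * \<Delta> + 1) * (\<Sum>e\<in>T. w e)) + (2 * L + 1) * (2 * (\<Sum>e\<in>E - T. w e)))"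
proof -
  define r W c X where "r = card S" and "W = (\<Sum>e\<in>T. w e)" and "c = 2 * \<Delta> + 1" and "X = 16 * c * W"
  have V: "finite V" using graph by (simp add: simple_graph_def)
  have "E \<subseteq> Pow V" using graph by (auto simp: simple_graph_def)
  then have finE: "finite E" using V by (meson finite_Pow_iff finite_subset)
  have T: "T \<subseteq> E" "connected_graph V T" using tree by (auto simp: spanning_tree_def)
  have finT: "finite T" using T finE by (meson finite_subset)
  have finS: "finite S" using S finE by (meson Diff_subset finite_subset)
  have r: "0 < r" using S finS by (simp add: r_def card_gt_0_iff)
  obtain pos :: "'a \<Rightarrow> int" where pos: "\<And>a. a \<in> V \<Longrightarrow> 0 \<le> pos a \<and> pos a \<le> 2 * int W"
    "\<And>a b. a \<in> V \<Longrightarrow> b \<in> V \<Longrightarrow> \<exists>p. walk T p \<and> hd p = a \<and> last p = b \<and> int (path_cost w p) \<le> \<bar>pos a - pos b\<bar>"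
    using line_embedding(2)[OF T(2) V finT, of w] unfolding W_def by metis
  have endpoints: "\<exists>u v. e = {u, v} \<and> u \<in> V \<and> v \<in> V" if "e \<in> E" for e
    using that graph unfolding simple_graph_def by (metis card_2_iff insert_subset)
  define G where "G = {e\<in>S. r * w e \<le> 2 * (\<Sum>e\<in>S. w e)}"
  have "r \<le> 2 * card G" using half_cheap[OF finS, of w] by (simp add: G_def r_def)
  moreover obtain I where I: "I \<subseteq> G" "card G \<le> c * card I" "\<forall>x\<in>I. \<forall>y\<in>I. x \<noteq> y \<longrightarrow> y \<notin> A x"
    using independent_subset[of G A \<Delta>] A finS by (auto simp: G_def c_def)
  ultimately have rI: "r \<le> 2 * c * card I" by (metis (no_types) mult.assoc mult_le_mono2 order.trans)
  have IS: "I \<subseteq> S" using I by (auto simp: G_def)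
  have finI: "finite I" using IS finS by (rule finite_subset)
  have WS: "(\<Sum>e\<in>S. w e) \<le> (\<Sum>e\<in>E - T. w e)" using S finE by (intro sum_mono2) auto
  define Y where "Y = 2 * (\<Sum>e\<in>E - T. w e)"
  have cheapI: "r * w e \<le> Y" if "e \<in> I" for e
    using that I(1) WS by (force simp: G_def Y_def)
  have tree_step: "\<exists>p. walk T p \<and> hd p = a \<and> last p = b \<and> r * path_cost w p \<le> X"
    if ab: "a \<in> V" "b \<in> V" and d: "r * nat \<bar>pos a - pos b\<bar> \<le> X" for a b
  proof -
    obtain p where p: "walk T p" "hd p = a" "last p = b" "int (path_cost w p) \<le> \<bar>pos a - pos b\<bar>"
      using pos(2)[OF ab] by blast
    then have "path_cost w p \<le> nat \<bar>pos a - pos b\<bar>" by linarith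
    then have "r * path_cost w p \<le> X" using d by (meson mult_le_mono2 order.trans)
    with p show ?thesis by blast
  qed
  have "\<exists>e\<in>I. \<exists>u v p. e = {u, v} \<and> walk (T \<union> (I - {e})) p \<and> hd p = u \<and> last p = v \<and>
    nontree_count T p \<le> 2 * L + 1 \<and> r * path_cost w p \<le> (2 * L + 2) * X + (2 * L + 1) * Y"
  \<comment> \<open>For small \<open>r\<close> blocks are dispensable: any tree path costs at most
    \<open>2 * W\<close>, and \<open>r\<close> times this is already at most
    \<open>X\<close>.\<close>
  proof (cases "r < 8 * c")
    case True
    have "I \<noteq> {}" using rI r by auto
    then obtain e where e: "e \<in> I" by blast
    then obtain u v where uv: "e = {u, v}" "u \<in> V" "v \<in> V" using endpoints[of e] IS S by blast
    have "nat \<bar>pos u - pos v\<bar> \<le> 2 * W" using pos(1)[OF uv(2)] pos(1)[OF uv(3)] by linarith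
    then have "r * nat \<bar>pos u - pos v\<bar> \<le> (8 * c) * (2 * W)" using True by (intro mult_le_mono) auto
    then obtain p where p: "walk T p" "hd p = u" "last p = v" "r * path_cost w p \<le> X"
      using tree_step[OF uv(2,3)] by (auto simp: X_def)
    have "walk (T \<union> (I - {e})) p" using p(1) by (auto simp: walk_def)
    moreover have "nontree_count T p = 0"
      using p(1) by (auto simp: nontree_count_def walk_def filter_empty_conv simp del: ends_pair)
    ultimately show ?thesis using e uv p by (intro bexI[of _ e] exI[of _ u] exI[of _ v] exI[of _ p]) auto
  next
    case False
    \<comment> \<open>The block width is the largest for which two positions in one block, at most
      \<open>s - 1\<close> apart, still satisfy \<open>r * (s - 1) \<le> X\<close>.\<close>
    define s where "s = X div r + 1"
    define cl where "cl a = pos a div int s" for a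
    have s: "X < s * r" "r * (s - 1) \<le> X"
      using r dividend_less_div_times[of r X] times_div_less_eq_dividend[of r X]
      by (auto simp: s_def algebra_simps)
    obtain ua ub where uab: "\<And>e. e \<in> E \<Longrightarrow> e = {ua e, ub e} \<and> ua e \<in> V \<and> ub e \<in> V"
      using endpoints by metis
    have IE: "e \<in> E" if "e \<in> I" for e using that IS S by blast
    have Q: "cl ` V \<subseteq> {0..int (2 * W div s)}"
    proof -
      have "0 \<le> cl a \<and> cl a \<le> int (2 * W div s)" if "a \<in> V" for a
      proof -
        have "0 < int s" by (simp add: s_def)
        with pos(1)[OF that] have "0 \<le> pos a div int s" "pos a div int s \<le> 2 * int W div int s"
          by (auto intro: zdiv_mono1 simp: pos_imp_zdiv_nonneg_iff)
        then show ?thesis by (simp add: cl_def zdiv_int)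
      qed
      then show ?thesis by auto
    qed
    have cQ: "card (cl ` V) \<le> 2 * W div s + 1"
      using card_mono[OF _ Q] by simp
    \<comment> \<open>The 16 in \<open>X\<close> is fixed here: the line has length
      \<open>2 * W\<close> and \<open>s * r > 16 * c * W\<close>, so there are fewer than r/(8c) + 1
      blocks. Twice that is at most r/(2c) once \<open>r\<close> is at least \<open>8 * c\<close>,
      hence below \<open>card I\<close>.\<close>
    have "(2 * W div s) * (8 * c) * s \<le> (2 * W) * (8 * c)"
      using div_times_less_eq_dividend[of "2 * W" s] by (metis mult.assoc mult.commute mult_le_mono1)
    also have "\<dots> < r * s" using s(1) by (simp add: X_def mult.commute)
    finally have "(2 * W div s) * (8 * c) < r" by simp
    then have "8 * c * (2 * card (cl ` V)) < 2 * r + 16 * c"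
      using mult_le_mono2[OF cQ, of "16 * c"] by (simp add: algebra_simps)
    also have "\<dots> \<le> 4 * r" using False by simp
    also have "\<dots> \<le> 8 * c * card I" using rI by simp
    finally have "2 * card (cl ` V) < card I" by simp
    moreover have "card (cl ` V) \<le> 2 ^ L" using card_image_le[OF V, of cl] L by linarith
    ultimately obtain e where e: "e \<in> I" "cl (ub e) \<in> reach (\<lambda>e. cl (ua e)) (\<lambda>e. cl (ub e)) (I - {e}) (2 * L + 1) (cl (ua e))"
      using short_cycle[of "cl ` V" I "\<lambda>e. cl (ua e)" "\<lambda>e. cl (ub e)" L, OF finite_imageI[OF V] finI]
        uab[OF IE] by (metis image_eqI)
    have same: "\<exists>p. walk T p \<and> hd p = a \<and> last p = b \<and> r * path_cost w p \<le> X"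
      if ab: "a \<in> V" "b \<in> V" "cl a = cl b" for a b
    proof (rule tree_step[OF ab(1,2)])
      have sp: "0 < int s" by (simp add: s_def)
      have "pos a = int s * cl a + pos a mod int s" "pos b = int s * cl a + pos b mod int s"
        using ab(3) mult_div_mod_eq[of "int s" "pos a"] mult_div_mod_eq[of "int s" "pos b"]
        by (simp_all add: cl_def)
      moreover have "0 \<le> pos a mod int s" "pos a mod int s < int s" "0 \<le> pos b mod int s" "pos b mod int s < int s"
        using sp by simp_all
      ultimately have "nat \<bar>pos a - pos b\<bar> \<le> s - 1" by linarith
      then show "r * nat \<bar>pos a - pos b\<bar> \<le> X" using s(2) by (meson mult_le_mono2 order.trans)
    qed
    have "\<exists>p. walk (T \<union> (I - {e})) p \<and> hd p = ua e \<and> last p = ub e \<and> nontree_count T p \<le> 2 * L + 1 \<and>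
      r * path_cost w p \<le> (2 * L + 1 + 1) * X + (2 * L + 1) * Y"
    proof (rule reach_walk[OF same _ e(2)])
      show "x = {ua x, ub x} \<and> ua x \<in> V \<and> ub x \<in> V \<and> r * w x \<le> Y" if "x \<in> I - {e}" for x
        using uab[OF IE] cheapI that by blast
    qed (use uab[OF IE[OF e(1)]] in blast)+
    then obtain p where "walk (T \<union> (I - {e})) p" "hd p = ua e" "last p = ub e" "nontree_count T p \<le> 2 * L + 1"
      "r * path_cost w p \<le> (2 * L + 2) * X + (2 * L + 1) * Y"
      by (elim exE conjE) (simp add: numeral_Bit0)
    moreover have "e = {ua e, ub e}" using uab[OF IE[OF e(1)]] by blast
    ultimately show ?thesis using e(1)
      by (intro bexI[of _ e] exI[of _ "ua e"] exI[of _ "ub e"] exI[of _ p] conjI)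
  qed
  then obtain e u v p where e: "e \<in> I" "e = {u, v}" and p: "walk (T \<union> (I - {e})) p" "hd p = u" "last p = v"
    "nontree_count T p \<le> 2 * L + 1" "r * path_cost w p \<le> (2 * L + 2) * X + (2 * L + 1) * Y" by (elim bexE exE conjE)
  \<comment> \<open>Independence is what makes the other edges of \<open>I\<close> admissible on the
    path for \<open>e\<close>.\<close>
  have "I - {e} \<subseteq> E - T - {e} - A e" using I(3)[rule_format, OF e(1)] IS S(1) by blast
  then have p1: "walk (T \<union> (E - T - {e} - A e)) p" using p(1) unfolding walk_def by blast
  have bound: "r * path_cost w p \<le> (2 * L + 2) * (16 * (2 * \<Delta> + 1) * (\<Sum>e\<in>T. w e)) + (2 * L + 1) * (2 * (\<Sum>e\<in>E - T. w e))"
    using p(5) by (simp add: X_def Y_def c_def W_def)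
  have ne: "p \<noteq> []" using p(1) by (simp add: walk_def)
  show ?thesis
  proof (intro bexI[of _ e] allI impI)
    fix u' v' assume "e = {u', v'}"
    then have "u' = v \<and> v' = u \<or> u' = u \<and> v' = v" using e(2) by (auto simp: doubleton_eq_iff)
    then show "\<exists>p. walk (T \<union> (E - T - {e} - A e)) p \<and> hd p = v' \<and> last p = u' \<and>
      nontree_count T p \<le> 2 * L + 1 \<and>
      card S * path_cost w p \<le> (2 * L + 2) * (16 * (2 * \<Delta> + 1) * (\<Sum>e\<in>T. w e)) + (2 * L + 1) * (2 * (\<Sum>e\<in>E - T. w e))"
    proof
      assume "u' = v \<and> v' = u"
      then show ?thesis using p1 p bound by (intro exI[of _ p]) (simp add: r_def)
    next
      assume "u' = u \<and> v' = v"
      then show ?thesis using p1 p bound ne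
        by (intro exI[of _ "rev p"]) (simp add: r_def hd_rev last_rev)
    qed
  next
    show "e \<in> S" using e(1) IS by blast
  qed
qed

section \<open>One stage\<close>

definition uses :: "edge list \<Rightarrow> nat set \<Rightarrow> nat" where
  "uses lg s = length (filter (\<lambda>g. ends g = s) lg)"

definition weight :: "nat \<Rightarrow> bool \<Rightarrow> nat \<Rightarrow> nat" where
  "weight k b j = (if b then 2 ^ (j div k) else k * 2 ^ j)"

text \<open>The potential of a tree edge interpolates \<open>k * 2 ^ (j / k)\<close> linearly between multiples of \<open>k\<close>,
  so that each use of an edge raises the potential by exactly the weight of the edge.\<close>

definition potential :: "nat \<Rightarrow> bool \<Rightarrow> nat \<Rightarrow> nat" where
  "potential k b j = (if b then (k + j mod k) * 2 ^ (j div k) else k * 2 ^ j)"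

lemma potential_Suc:
  assumes "1 \<le> k"
  shows "potential k b (Suc j) = potential k b j + weight k b j"
\<comment> \<open>At a multiple of \<open>k\<close> the pieces fit: (2k - 1) 2^q plus one weight 2^q
  is k 2^(q + 1), the value at the start of the next piece.\<close>
proof (cases "Suc (j mod k) = k")
  case True
  then have "Suc j mod k = 0" "Suc j div k = Suc (j div k)"
    by (simp_all add: mod_Suc div_Suc)
  moreover have "k + k = Suc (k + j mod k)" using True by simp
  then have "2 * k * 2 ^ (j div k) = (k + j mod k) * 2 ^ (j div k) + 2 ^ (j div k)"
    by (metis add_mult_distrib mult_2 plus_1_eq_Suc mult_1 add.commute)
  ultimately show ?thesis by (simp add: potential_def weight_def)
next
  case False
  then have "Suc j mod k = Suc (j mod k)" "Suc j div k = j div k"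
    using assms by (auto simp: mod_Suc div_Suc mod_eq_0_iff_dvd)
  then show ?thesis by (simp add: potential_def weight_def)
qed

lemma wt_state_uses:
  assumes "1 \<le> k"
  shows "wt_state k t lg f = (if ends f \<in> ends ` set t
    then (uses lg (ends f) mod k, 2 ^ (uses lg (ends f) div k)) else (0, k * 2 ^ uses lg (ends f)))"
proof (induction lg rule: rev_induct)
  case Nil
  then show ?case by (simp add: wt_state_def uses_def unit_of_def)
next
  case (snoc g lg)
  have step: "wt_state k t (lg @ [g]) f = wt_step k (unit_of k t f) (ends f = ends g) (wt_state k t lg f)"
    by (simp add: wt_state_def)
  show ?case
  proof (cases "ends f = ends g")
    case True
    then have "uses (lg @ [g]) (ends f) = Suc (uses lg (ends f))" by (simp add: uses_def)
    moreover have "uses lg (ends f) mod k < k" using assms by simp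
    then have "Suc (uses lg (ends f) mod k) = k \<or> Suc (uses lg (ends f) mod k) < k" by linarith
    ultimately show ?thesis
      using True assms by (auto simp: step snoc wt_step_def unit_of_def mod_Suc div_Suc)
  next
    case False
    then have "uses (lg @ [g]) (ends f) = uses lg (ends f)" by (simp add: uses_def)
    then show ?thesis using False by (simp add: step snoc wt_step_def)
  qed
qed

lemma wt_weight: "1 \<le> k \<Longrightarrow> wt k t lg f = weight k (ends f \<in> ends ` set t) (uses lg (ends f))"
  by (simp add: wt_def wt_state_uses weight_def)

lemma edge_list_ends:
  fixes es :: "('a \<times> 'a) list"
  shows "edge_list es E \<longleftrightarrow> distinct (map ends es) \<and> ends ` set es = E"
proof -
  have "(\<lambda>(u, v). {u, v :: 'a}) = ends" by (auto simp: ends_def)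
  then show ?thesis by (simp only: edge_list_def set_map)
qed

definition conf_set :: "(edge \<times> edge) list \<Rightarrow> nat set \<Rightarrow> nat set set" where
  "conf_set U s = (\<lambda>x. ends (snd x)) ` {x \<in> set U. ends (fst x) = s}"

lemma conflict_conf_set: "conflict e f U \<longleftrightarrow> ends f \<in> conf_set U (ends e)"
  by (auto simp: conflict_def conf_set_def)

lemma finite_conf_set [simp]: "finite (conf_set U s)"
  by (simp add: conf_set_def)

lemma better_best:
  fixes cnd :: "edge \<Rightarrow> label option" and A B :: "nat set set"
  defines "F \<equiv> \<lambda>acc e. if ends e \<in> A then acc else if ends e \<in> B then acc else better acc (cnd e) e"
  shows "case foldl F None xs of
      None \<Rightarrow> \<forall>e\<in>set xs. ends e \<notin> A \<and> ends e \<notin> B \<longrightarrow> cnd e = None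
    | Some (l, e) \<Rightarrow> e \<in> set xs \<and> ends e \<notin> A \<and> ends e \<notin> B \<and> cnd e = Some l \<and>
        (\<forall>e'\<in>set xs. \<forall>l'. ends e' \<notin> A \<and> ends e' \<notin> B \<and> cnd e' = Some l' \<longrightarrow> fst l \<le> fst l')"
proof (induction xs rule: rev_induct)
  case (snoc x xs)
  then show ?case
    by (cases "foldl F None xs"; cases "cnd x") (force simp: F_def better_def)+
qed simp

lemma path_edges_vertices: "f \<in> set (path_edges p) \<Longrightarrow> ends f \<subseteq> set p"
  by (cases f) (auto simp: path_edges_def dest: set_zip_leftD set_zip_rightD intro: list.set_sel(2)[of p])

lemma path_edges_ends_distinct: "distinct p \<Longrightarrow> distinct (map ends (path_edges p))"
proof (induction p rule: induct_list012)
  case (3 x y p)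
  have "x \<in> ends f \<Longrightarrow> f \<notin> set (path_edges (y # p))" for f
    using 3(3) path_edges_vertices[of f "y # p"] by auto
  then have "{x, y} \<notin> ends ` set (path_edges (y # p))" by blast
  with 3 show ?case by simp
qed auto

lemma uses_path_edges: "distinct p \<Longrightarrow> uses (path_edges p) s = of_bool (s \<in> ends ` set (path_edges p))"
proof -
  assume "distinct p"
  then have d: "distinct (map ends (path_edges p))" by (rule path_edges_ends_distinct)
  have "uses xs s = of_bool (s \<in> ends ` set xs)" if "distinct (map ends xs)" for xs
    using that
  proof (induction xs)
    case (Cons x xs)
    then show ?case by (cases "ends x = s") (auto simp: uses_def simp del: ends_pair)
  qed (simp add: uses_def)
  with d show ?thesis by blast
qed

lemma uses_append [simp]: "uses (xs @ ys) s = uses xs s + uses ys s"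
  and uses_rev [simp]: "uses (rev xs) s = uses xs s"
  and uses_Nil [simp]: "uses [] s = 0"
  by (simp_all add: uses_def flip: rev_filter)

section \<open>Candidate paths and their cost relative to the potential\<close>

definition chosen_edges :: "selection \<Rightarrow> edge list" where
  "chosen_edges ch = concat (map (\<lambda>x. rev (path_edges (snd x))) ch)"

lemma chosen_edges_simps [simp]:
  "chosen_edges [] = []" "chosen_edges (x # ch) = rev (path_edges (snd x)) @ chosen_edges ch"
  by (simp_all add: chosen_edges_def)

definition used :: "nat set set \<Rightarrow> selection \<Rightarrow> nat set \<Rightarrow> nat set set" where
  "used T ch s = {ends f | f x. x \<in> set ch \<and> ends (fst x) = s \<and> f \<in> set (path_edges (snd x)) \<and> ends f \<notin> T}"

lemma in_weighted: "x \<in> set (weighted Q v es) \<longleftrightarrow> fst x \<in> set es \<and> Q (fst x) \<and> snd x = v (fst x)"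
  by (cases x) (auto simp: weighted_def)

text \<open>\<open>U0\<close> and \<open>out0\<close> are inherited from earlier trees. The bound
  \<open>k * R\<close> on forbidden partners reflects that each earlier tree contributes at most
  \<open>R\<close> of them for a given edge.\<close>

locale tree_stage =
  fixes n :: nat and E T :: "nat set set" and es t :: "edge list" and k R L :: nat
    and U0 :: "(edge \<times> edge) list" and out0 :: "nat list list"
  assumes graph: "simple_graph {..<n} E" and tree: "spanning_tree {..<n} E T"
    and es: "edge_list es E" and t: "edge_list t T" and k: "1 \<le> k" and L: "n \<le> 2 ^ L"
    and R: "R = 2 * L + 2" and conf: "\<And>s. s \<in> E \<Longrightarrow> card (conf_set U0 s) \<le> k * R"
begin

lemma ends_es: "distinct (map ends es)" "ends ` set es = E"
  and ends_t: "ends ` set t = T"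
  using es t by (auto simp: edge_list_ends)

lemma T_sub: "T \<subseteq> E" and T_conn: "connected_graph {..<n} T"
  using tree by (auto simp: spanning_tree_def)

lemma finE: "finite E" and finT: "finite T"
  using ends_es T_sub finite_subset by (metis List.finite_set finite_imageI)+

lemma E_sub: "s \<in> E \<Longrightarrow> s \<subseteq> {..<n} \<and> card s = 2"
  using graph by (auto simp: simple_graph_def)

lemma card_E: "card E = length es"
  using ends_es by (metis distinct_card length_map list.set_map)

text \<open>Guarantees that a simple path has at most \<open>length es + 1\<close> vertices, the
  range within which the dynamic program is complete.\<close>

lemma n_le: "n \<le> length es + 1"
proof -
  have "card {..<n} \<le> Suc (card T)" by (rule line_embedding(1)[OF T_conn _ finT]) simp
  also have "card T \<le> card E" using T_sub finE by (rule card_mono[rotated])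
  finally show ?thesis by (simp add: card_E)
qed

definition w :: "edge list \<Rightarrow> nat set \<Rightarrow> nat" where
  "w lg s = weight k (s \<in> T) (uses lg s)"

definition total :: "edge list \<Rightarrow> nat" where
  "total lg = (\<Sum>s\<in>E. potential k (s \<in> T) (uses lg s))"

lemma w_pos: "0 < w lg s"
  using k by (simp add: w_def weight_def)

lemma wt_w: "wt k t lg f = w lg (ends f)"
  by (simp add: wt_weight[OF k] w_def ends_t)

text \<open>A simple path uses each edge at most once, so no weight changes in the middle of the
  path and the increments add up to exactly its cost.\<close>

lemma total_path:
  assumes "distinct p" "walk E p"
  shows "total (rev (path_edges p) @ lg) = total lg + path_cost (w lg) p"
proof -
  let ?P = "ends ` set (path_edges p)"
  have P: "?P \<subseteq> E" using assms(2) by (auto simp: walk_def simp del: ends_pair)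
  have "potential k (s \<in> T) (uses (rev (path_edges p) @ lg) s) =
      potential k (s \<in> T) (uses lg s) + (if s \<in> ?P then w lg s else 0)" for s
    using uses_path_edges[OF assms(1), of s] potential_Suc[OF k, of "s \<in> T" "uses lg s"]
    by (cases "s \<in> ?P") (simp_all add: w_def del: image_iff ends_pair)
  then have "total (rev (path_edges p) @ lg) = total lg + (\<Sum>s\<in>E. if s \<in> ?P then w lg s else 0)"
    by (simp add: total_def sum.distrib)
  also have "(\<Sum>s\<in>E. if s \<in> ?P then w lg s else 0) = (\<Sum>s\<in>?P. w lg s)"
    using sum.inter_restrict[OF finE, of "w lg" ?P] P by (simp only: Int_absorb1)
  also have "\<dots> = path_cost (w lg) p"
  proof -
    have "path_cost (w lg) p = sum_list (map (w lg) (map ends (path_edges p)))"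
      by (simp add: path_cost_def o_def)
    also have "\<dots> = (\<Sum>s\<in>set (map ends (path_edges p)). w lg s)"
      by (rule sum_list_distinct_conv_sum_set[OF path_edges_ends_distinct[OF assms(1)]])
    finally show ?thesis by simp
  qed
  finally show ?thesis .
qed

text \<open>The extra factor \<open>k\<close> on the tree side later cancels the \<open>k\<close> in
  the bound on forbidden partners.\<close>

lemma total_weights:
  "k * (\<Sum>s\<in>T. w lg s) + (\<Sum>s\<in>E - T. w lg s) \<le> total lg"
proof -
  have "total lg = (\<Sum>s\<in>T. potential k (s \<in> T) (uses lg s)) + (\<Sum>s\<in>E - T. potential k (s \<in> T) (uses lg s))"
    unfolding total_def by (subst sum.subset_diff[OF T_sub finE]) (rule add.commute)
  moreover have "k * (\<Sum>s\<in>T. w lg s) \<le> (\<Sum>s\<in>T. potential k (s \<in> T) (uses lg s))"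
    unfolding sum_distrib_left by (intro sum_mono) (auto simp: w_def weight_def potential_def)
  moreover have "(\<Sum>s\<in>E - T. w lg s) \<le> (\<Sum>s\<in>E - T. potential k (s \<in> T) (uses lg s))"
    by (intro sum_mono) (auto simp: w_def weight_def potential_def)
  ultimately show ?thesis by linarith
qed

definition allowed :: "(edge \<times> edge) list \<Rightarrow> nat set \<Rightarrow> nat set set" where
  "allowed U s = E - T - {s} - conf_set U s"

lemma dp_setup: "dp_setup T (allowed U (ends e)) (w lg) (tree_sel k t lg es) (nontree_sel k t lg es e U)"
proof -
  have a: "x \<in> set (tree_sel k t lg es) \<longleftrightarrow> fst x \<in> set es \<and> ends (fst x) \<in> T \<and> snd x = w lg (ends (fst x))" for x
    unfolding tree_sel_def in_weighted ends_t wt_w by blast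
  have E: "ends f \<in> E" if "f \<in> set es" for f using that ends_es(2) by blast
  have b: "x \<in> set (nontree_sel k t lg es e U) \<longleftrightarrow>
    fst x \<in> set es \<and> ends (fst x) \<in> allowed U (ends e) \<and> snd x = w lg (ends (fst x))" for x
    unfolding nontree_sel_def in_weighted ends_t wt_w allowed_def conflict_conf_set
    using E[of "fst x"] by blast
  have sel: "\<exists>x. fst x \<in> set es \<and> ends (fst x) = s \<and> snd x = w lg s" if s: "s \<in> E" for s
  proof -
    obtain f where "f \<in> set es" "ends f = s" using s ends_es(2) by blast
    then show ?thesis by (intro exI[of _ "(f, w lg s)"]) simp
  qed
  show ?thesis
  proof
    show "\<exists>x\<in>set (tree_sel k t lg es). ends (fst x) = s" if s: "s \<in> T" for s
    proof -
      obtain x where "fst x \<in> set es" "ends (fst x) = s" "snd x = w lg s" using sel[of s] s T_sub by blast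
      with s show ?thesis by (intro bexI[of _ x]) (simp_all add: a)
    qed
    show "\<exists>x\<in>set (nontree_sel k t lg es e U). ends (fst x) = s" if s: "s \<in> allowed U (ends e)" for s
    proof -
      obtain x where "fst x \<in> set es" "ends (fst x) = s" "snd x = w lg s"
        using sel[of s] s unfolding allowed_def by blast
      with s show ?thesis by (intro bexI[of _ x]) (simp_all add: b)
    qed
    show "ends (fst x) \<in> T \<and> snd x = w lg (ends (fst x))" if "x \<in> set (tree_sel k t lg es)" for x
      using that unfolding a by blast
    show "ends (fst x) \<in> allowed U (ends e) \<and> snd x = w lg (ends (fst x))"
      if "x \<in> set (nontree_sel k t lg es e U)" for x
      using that unfolding b by blast
  qed
qed

text \<open>The loop-erased walk is short enough for the dynamic program. Since weights are
  positive, a walk with a repeated vertex is strictly beaten.\<close>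

lemma cand_complete:
  assumes e: "e \<in> set es" and p: "walk (T \<union> allowed U (ends e)) p" "hd p = snd e" "last p = fst e"
    and nc: "nontree_count T p \<le> R"
  shows "\<exists>c q. cand k t lg es R U e = Some (c, q) \<and> c \<le> path_cost (w lg) p \<and>
    (distinct p \<or> c < path_cost (w lg) p)"
proof -
  interpret dp_setup T "allowed U (ends e)" "w lg" "tree_sel k t lg es" "nontree_sel k t lg es e U"
    by (rule dp_setup)
  have ne: "p \<noteq> []" using p by (auto simp: walk_def)
  obtain q where q: "q \<noteq> []" "hd q = hd p" "last q = last p" "mset (path_edges q) \<subseteq># mset (path_edges p)"
    "distinct q" "\<not> distinct p \<Longrightarrow> length q < length p"
    using loop_erasure[OF ne] by metis
  have wq: "walk (T \<union> allowed U (ends e)) q" using q p walk_mono by blast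
  have TA: "s \<subseteq> {..<n}" if "s \<in> T \<union> allowed U (ends e)" for s
    using that T_sub E_sub by (auto simp: allowed_def)
  have "ends e \<in> E" using e ends_es by blast
  then have "hd q \<in> {..<n}" using E_sub[of "ends e"] q p by (auto simp: ends_def)
  then have "set q \<subseteq> {..<n}" using walk_vertices[OF wq TA] by blast
  then have "card (set q) \<le> n" using card_mono[of "{..<n}" "set q"] by simp
  then have "length q \<le> length es + 1" using n_le distinct_card[OF q(5)] by linarith
  moreover have "nontree_count T q \<le> R" using nontree_count_mono[OF q(4)] nc by (rule order.trans)
  ultimately have "at_most (dp (tree_sel k t lg es) (nontree_sel k t lg es e U) (length es) R (fst e)) (hd q) (path_cost (w lg) q)"
    using wq q(3) p(3) by (intro at_most_dp) auto
  then obtain c r where "cand k t lg es R U e = Some (c, r)" "c \<le> path_cost (w lg) q"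
    using q(2) p(2) by (auto simp: at_most_def cand_def)
  moreover have "path_cost (w lg) q \<le> path_cost (w lg) p" by (rule path_cost_mono[OF q(4)])
  moreover have "path_cost (w lg) q < path_cost (w lg) p" if "\<not> distinct p"
    by (rule path_cost_strict[OF q(4) q(6)[OF that] q(1)]) (simp add: w_pos)
  ultimately show ?thesis by (intro exI[of _ c] exI[of _ r]) linarith
qed

lemma cand_sound:
  assumes e: "e \<in> set es" and c: "cand k t lg es R U e = Some (c, p)"
  shows "walk (T \<union> allowed U (ends e)) p" "hd p = snd e" "last p = fst e" "distinct p"
    "nontree_count T p \<le> R" "c = path_cost (w lg) p"
proof -
  interpret dp_setup T "allowed U (ends e)" "w lg" "tree_sel k t lg es" "nontree_sel k t lg es e U"
    by (rule dp_setup)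
  have "(snd e, c, p) \<in> set (dp (tree_sel k t lg es) (nontree_sel k t lg es e U) (length es) R (fst e))"
    using c map_of_SomeD by (fastforce simp: cand_def)
  then show p: "walk (T \<union> allowed U (ends e)) p" "hd p = snd e" "last p = fst e"
    "nontree_count T p \<le> R" "c = path_cost (w lg) p"
    using sound_dp[of "fst e" R "length es"] by (auto simp: sound_def)
  \<comment> \<open>If the returned path repeated a vertex, completeness applied to this very path
    would make its cost smaller than itself.\<close>
  show "distinct p" using cand_complete[OF e p(1-4), of lg] c p(5) by auto
qed

text \<open>The 48 is 16 times 3, from \<open>2 * (k * R) + 1 \<le> 3 * (k * R)\<close>. One factor
  \<open>R\<close> bounds the number of blocks visited, the other belongs to the forbidden
  partners.\<close>

lemma cand_cheap:
  assumes S: "S \<subseteq> E - T" "S \<noteq> {}" and U: "\<And>s. s \<in> S \<Longrightarrow> conf_set U s = conf_set U0 s"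
  shows "\<exists>e\<in>set es. ends e \<in> S \<and> (\<exists>c q. cand k t lg es R U e = Some (c, q) \<and>
    card S * c \<le> 48 * R\<^sup>2 * total lg)"
proof -
  have A: "finite (conf_set U s) \<and> card (conf_set U s) \<le> k * R" if "s \<in> S" for s
    using that S U[OF that] conf by auto
  have "card {..<n} \<le> 2 ^ L" using L by simp
  note cheap_edge[where A = "conf_set U" and \<Delta> = "k * R" and L = L and w = "w lg", OF graph tree S A this]
  then obtain s where s: "s \<in> S" and walk: "\<forall>u v. s = {u, v} \<longrightarrow> (\<exists>p. walk (T \<union> (E - T - {s} - conf_set U s)) p \<and>
      hd p = v \<and> last p = u \<and> nontree_count T p \<le> 2 * L + 1 \<and>
    card S * path_cost (w lg) p \<le> (2 * L + 2) * (16 * (2 * (k * R) + 1) * (\<Sum>e\<in>T. w lg e)) + (2 * L + 1) * (2 * (\<Sum>e\<in>E - T. w lg e)))"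
    by blast
  obtain e where e: "e \<in> set es" "ends e = s" using s S ends_es(2) by blast
  obtain p where p: "walk (T \<union> allowed U s) p" "hd p = snd e" "last p = fst e" "nontree_count T p \<le> 2 * L + 1"
    "card S * path_cost (w lg) p \<le> R * (16 * (2 * (k * R) + 1) * (\<Sum>e\<in>T. w lg e)) + (2 * L + 1) * (2 * (\<Sum>e\<in>E - T. w lg e))"
    using walk[rule_format, of "fst e" "snd e"] e(2) unfolding ends_def allowed_def R by blast
  obtain c q where c: "cand k t lg es R U e = Some (c, q)" "c \<le> path_cost (w lg) p"
    using cand_complete[of e U p lg] e p R by auto
  have R1: "1 \<le> R" and h2: "2 * L + 1 \<le> R" by (simp_all add: R)
  have "1 \<le> k * R" using k R1 mult_le_mono[of 1 k 1 R] by simp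
  then have h1: "2 * (k * R) + 1 \<le> 3 * (k * R)" by linarith
  have "R \<le> R\<^sup>2" using R1 by (simp add: power2_eq_square)
  then have h3: "2 * R \<le> 48 * R\<^sup>2" by linarith
  define WT WF where "WT = (\<Sum>e\<in>T. w lg e)" and "WF = (\<Sum>e\<in>E - T. w lg e)"
  have "card S * c \<le> R * (16 * (2 * (k * R) + 1) * WT) + (2 * L + 1) * (2 * WF)"
    unfolding WT_def WF_def by (rule order.trans[OF mult_le_mono2[OF c(2)] p(5)])
  also have "\<dots> \<le> R * (16 * (3 * (k * R)) * WT) + R * (2 * WF)"
    by (rule add_mono[OF mult_le_mono2[OF mult_le_mono1[OF mult_le_mono2[OF h1]]] mult_le_mono1[OF h2]])
  also have "\<dots> = 48 * R\<^sup>2 * (k * WT) + 2 * R * WF" by (simp add: power2_eq_square algebra_simps)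
  also have "\<dots> \<le> 48 * R\<^sup>2 * (k * WT) + 48 * R\<^sup>2 * WF"
    by (rule add_mono[OF order.refl mult_le_mono1[OF h3]])
  also have "\<dots> = 48 * R\<^sup>2 * (k * WT + WF)" by (simp add: algebra_simps)
  also have "\<dots> \<le> 48 * R\<^sup>2 * total lg"
    using total_weights[of lg] by (intro mult_le_mono2) (simp add: WT_def WF_def)
  finally show ?thesis using e s c(1) by blast
qed

end

text \<open>The binary logarithm of the final potential bound divided by \<open>k\<close>; the added
  1 makes up for rounding down in \<open>j div k\<close>.\<close>

definition load_bound :: "nat \<Rightarrow> nat \<Rightarrow> real" where
  "load_bound m R = (ln m + 48 * (real R)\<^sup>2 * (1 + ln m)) / ln 2 + 1"

definition stage_ok :: "nat set set \<Rightarrow> nat set set \<Rightarrow> nat \<Rightarrow> nat \<Rightarrow> (nat set \<Rightarrow> nat set set) \<Rightarrow>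
   selection \<Rightarrow> bool" where
  "stage_ok E T k R cf ch \<longleftrightarrow>
     distinct (map (\<lambda>x. ends (fst x)) ch) \<and> (\<lambda>x. ends (fst x)) ` set ch = E - T \<and>
     (\<forall>x\<in>set ch. walk (T \<union> (E - T - {ends (fst x)} - cf (ends (fst x)))) (snd x) \<and>
        {last (snd x), hd (snd x)} = ends (fst x) \<and> distinct (snd x) \<and> nontree_count T (snd x) \<le> R) \<and>
     (\<forall>s\<in>E. real (uses (chosen_edges ch) s) \<le> (if s \<in> T then real k else 1) * load_bound (card E) R)"

text \<open>The difference of the harmonic number and the logarithm is decreasing and equals 1 for n
  = 1, which is index 0 of the library sequence.\<close>

lemma harm_le_ln: "1 \<le> n \<Longrightarrow> harm n \<le> 1 + ln (real n)"
  using decseqD[OF decseq_harm_diff_ln, of 0 "n - 1"] by (simp add: harm_def)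

section \<open>Growth of the potential while one tree is processed\<close>

context tree_stage
begin

definition extend_used :: "selection \<Rightarrow> (edge \<times> edge) list" where
  "extend_used ch = concat (map (\<lambda>x. rev (map (Pair (fst x)) (filter (\<lambda>f. ends f \<notin> T) (path_edges (snd x))))) ch) @ U0"

definition state_of where
  "state_of ch = (map fst ch, chosen_edges ch, extend_used ch, map snd ch @ out0)"

definition good :: "selection \<Rightarrow> bool" where
  "good ch \<longleftrightarrow> distinct (map (\<lambda>x. ends (fst x)) ch) \<and> (\<forall>x\<in>set ch. ends (fst x) \<in> E - T \<and>
     walk (T \<union> allowed U0 (ends (fst x))) (snd x) \<and> {last (snd x), hd (snd x)} = ends (fst x) \<and>
     distinct (snd x) \<and> nontree_count T (snd x) \<le> R)"

text \<open>The difference of harmonic numbers is the sum of 1/r over the steps done so far,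
  \<open>r\<close> being the number of uncovered edges before each step. The start value is
  \<open>k * card E\<close>.\<close>

definition pot_ok :: "selection \<Rightarrow> bool" where
  "pot_ok ch \<longleftrightarrow> real (total (chosen_edges ch)) \<le>
     real (k * card E) * exp (48 * (real R)\<^sup>2 * (harm (card (E - T)) - harm (card (E - T) - length ch)))"

lemma conf_set_extend: "conf_set (extend_used ch) s = used T ch s \<union> conf_set U0 s"
proof -
  have "set (extend_used ch) =
      {(fst y, f) | y f. y \<in> set ch \<and> f \<in> set (path_edges (snd y)) \<and> ends f \<notin> T} \<union> set U0"
    by (auto simp: extend_used_def simp del: ends_pair)
  then have "{x \<in> set (extend_used ch). ends (fst x) = s} =
      {(fst y, f) | y f. y \<in> set ch \<and> ends (fst y) = s \<and> f \<in> set (path_edges (snd y)) \<and> ends f \<notin> T} \<union>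
      {x \<in> set U0. ends (fst x) = s}" by (auto simp del: ends_pair)
  moreover have "(\<lambda>x. ends (snd x)) ` {(fst y, f) | y f. y \<in> set ch \<and> ends (fst y) = s \<and>
      f \<in> set (path_edges (snd y)) \<and> ends f \<notin> T} = used T ch s"
    unfolding used_def by (simp add: setcompr_eq_image image_def del: ends_pair) blast
  ultimately show ?thesis unfolding conf_set_def by (simp only: image_Un)
qed

lemma step_state:
  assumes "good ch" "pot_ok ch" "length ch < card (E - T)"
  shows "\<exists>x. step_alg k es R t (state_of ch) = state_of (x # ch) \<and> good (x # ch) \<and> pot_ok (x # ch)"
proof -
  define S where "S = E - T - (\<lambda>x. ends (fst x)) ` set ch"
  let ?U = "extend_used ch" and ?lg = "chosen_edges ch"
  have cov: "ends ` set (map fst ch) = (\<lambda>x. ends (fst x)) ` set ch" by force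
  have "card ((\<lambda>x. ends (fst x)) ` set ch) = length ch"
    using assms(1) by (metis good_def distinct_card length_map list.set_map)
  moreover have "(\<lambda>x. ends (fst x)) ` set ch \<subseteq> E - T" using assms(1) by (auto simp: good_def)
  ultimately have cS: "card S = card (E - T) - length ch"
    unfolding S_def by (metis List.finite_set card_Diff_subset finite_imageI)
  then have "card S \<noteq> 0" using assms(3) by simp
  then have S: "S \<subseteq> E - T" "S \<noteq> {}" unfolding S_def by (blast, metis card.empty)
  \<comment> \<open>Pairs recorded during this stage have an already covered first component, so
    uncovered edges still see only what earlier trees forbade.\<close>
  have U: "conf_set ?U s = conf_set U0 s" if "s \<in> S" for s
  proof -
    have "used T ch s = {}" using that unfolding used_def S_def by blast
    then show ?thesis by (simp add: conf_set_extend)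
  qed
  obtain e0 c0 q0 where e0: "e0 \<in> set es" "ends e0 \<in> S" "cand k t ?lg es R ?U e0 = Some (c0, q0)"
    "card S * c0 \<le> 48 * R\<^sup>2 * total ?lg"
    using cand_cheap[OF S U, of ?lg] by blast
  note b = better_best[where A = "ends ` set t" and B = "ends ` set (map fst ch)" and
      cnd = "cand k t ?lg es R ?U" and xs = es, folded best_def]
  have free: "ends e \<notin> ends ` set t \<and> ends e \<notin> ends ` set (map fst ch) \<longleftrightarrow> ends e \<in> S" if "e \<in> set es" for e
  proof -
    have "ends e \<in> E" using that ends_es(2) by blast
    then show ?thesis unfolding ends_t cov S_def by blast
  qed
  obtain c p e where best: "best k t ?lg es R ?U (map fst ch) = Some ((c, p), e)"
  proof (cases "best k t ?lg es R ?U (map fst ch)")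
    case None
    then have "cand k t ?lg es R ?U e0 = None"
      using b free[OF e0(1)] e0(1,2) by (simp only: option.case)
    then show thesis using e0 by simp
  next
    case (Some y)
    then show thesis using that by (metis prod.collapse)
  qed
  have e: "e \<in> set es" "ends e \<in> S" "cand k t ?lg es R ?U e = Some (c, p)" "c \<le> c0"
    using b[unfolded best option.case prod.case] free[of e] free[OF e0(1)] e0 by auto
  note snd = cand_sound[OF e(1,3)]
  have allowed: "allowed ?U (ends e) = allowed U0 (ends e)"
    using U[OF e(2)] by (simp add: allowed_def)
  have step: "step_alg k es R t (state_of ch) = state_of ((e, p) # ch)"
  proof -
    have "extend_used ((e, p) # ch) = rev (map (Pair e) (filter (\<lambda>f. ends f \<notin> T) (path_edges p))) @ ?U"
      by (simp add: extend_used_def)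
    then show ?thesis by (simp add: step_alg_def state_of_def best ends_t)
  qed
  have "walk E p" using snd(1) T_sub by (auto simp: walk_def allowed_def simp del: ends_pair)
  then have tot: "total (chosen_edges ((e, p) # ch)) = total ?lg + c"
    using total_path[OF snd(4), of ?lg] snd(6) by simp
  have new: "ends e \<notin> (\<lambda>x. ends (fst x)) ` set ch" "ends e \<in> E - T" using e(2) by (simp_all add: S_def)
  have ends_p: "{last p, hd p} = ends e" by (simp add: snd(2,3) ends_def)
  have good: "good ((e, p) # ch)"
    unfolding good_def
  proof (intro conjI ballI)
    show "distinct (map (\<lambda>x. ends (fst x)) ((e, p) # ch))"
      using assms(1) new(1) unfolding good_def by (simp del: ends_pair)
    fix x assume "x \<in> set ((e, p) # ch)"
    then consider "x = (e, p)" | "x \<in> set ch" by auto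
    then have "ends (fst x) \<in> E - T \<and> walk (T \<union> allowed U0 (ends (fst x))) (snd x) \<and>
      {last (snd x), hd (snd x)} = ends (fst x) \<and> distinct (snd x) \<and> nontree_count T (snd x) \<le> R"
    proof cases
      case 1
      then show ?thesis using new(2) ends_p snd(1,4,5) allowed by (simp del: ends_pair)
    next
      case 2
      then show ?thesis using assms(1) by (simp add: good_def)
    qed
    then show "ends (fst x) \<in> E - T" "walk (T \<union> allowed U0 (ends (fst x))) (snd x)"
      "{last (snd x), hd (snd x)} = ends (fst x)" "distinct (snd x)" "nontree_count T (snd x) \<le> R"
      by blast+
  qed
  define r where "r = card S"
  define \<kappa> where "\<kappa> = 48 * (real R)\<^sup>2"
  have r: "1 \<le> r" "r = card (E - T) - length ch" "card (E - T) - length ((e, p) # ch) = r - 1"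
    using cS assms(3) by (auto simp: r_def)
  have "real r * real c \<le> \<kappa> * total ?lg"
  proof -
    have "r * c \<le> 48 * R\<^sup>2 * total ?lg" unfolding r_def by (rule order.trans[OF mult_le_mono2[OF e(4)] e0(4)])
    then have "real (r * c) \<le> real (48 * R\<^sup>2 * total ?lg)" by (rule of_nat_mono)
    then show ?thesis by (simp add: \<kappa>_def)
  qed
  then have "real c \<le> \<kappa> / r * total ?lg" using r by (simp add: field_simps)
  then have "real (total (chosen_edges ((e, p) # ch))) \<le> (1 + \<kappa> / r) * total ?lg"
    unfolding tot by (simp add: algebra_simps)
  \<comment> \<open>Passing from 1 + x to exp x turns the product of growth factors into a sum in
    the exponent.\<close>
  also have "\<dots> \<le> exp (\<kappa> / r) * total ?lg"
    by (intro mult_right_mono exp_ge_add_one_self) simp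
  also have "\<dots> \<le> exp (\<kappa> / r) * (real (k * card E) * exp (\<kappa> * (harm (card (E - T)) - harm r)))"
    using assms(2) unfolding pot_ok_def r(2) \<kappa>_def by (intro mult_left_mono) auto
  also have "\<dots> = real (k * card E) * exp (\<kappa> * (harm (card (E - T)) - harm (r - 1)))"
  proof -
    have "harm r = harm (r - 1) + 1 / real r"
      using r(1) harm_Suc[of "r - 1", where 'a = real] by (simp add: inverse_eq_divide)
    then have "\<kappa> / r + \<kappa> * (harm (card (E - T)) - harm r) = \<kappa> * (harm (card (E - T)) - harm (r - 1))"
      by (simp add: algebra_simps)
    then show ?thesis by (metis (no_types, lifting) exp_add mult.assoc mult.commute)
  qed
  finally have "pot_ok ((e, p) # ch)" unfolding pot_ok_def r(3) \<kappa>_def .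
  with step good show ?thesis by blast
qed

lemma step_state_final:
  assumes "good ch" "length ch = card (E - T)"
  shows "step_alg k es R t (state_of ch) = state_of ch"
proof -
  let ?U = "extend_used ch" and ?lg = "chosen_edges ch"
  have "card ((\<lambda>x. ends (fst x)) ` set ch) = length ch"
    using assms(1) by (metis good_def distinct_card length_map list.set_map)
  moreover have "(\<lambda>x. ends (fst x)) ` set ch \<subseteq> E - T" using assms(1) by (auto simp: good_def)
  ultimately have all: "ends ` set (map fst ch) = E - T"
    using assms(2) finE by (simp add: image_image card_subset_eq)
  note b = better_best[where A = "ends ` set t" and B = "ends ` set (map fst ch)" and
      cnd = "cand k t ?lg es R ?U" and xs = es, folded best_def]
  have "best k t ?lg es R ?U (map fst ch) = None"
  proof (cases "best k t ?lg es R ?U (map fst ch)")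
    case (Some y)
    then obtain l e where y: "y = (l, e)" by (cases y)
    have "e \<in> set es \<and> ends e \<notin> T \<and> ends e \<notin> E - T"
      using b[unfolded Some y option.case prod.case] unfolding ends_t all by blast
    then have False using ends_es(2) by blast
    then show ?thesis ..
  qed
  then show ?thesis by (simp add: step_alg_def state_of_def)
qed

lemma stage_states:
  "i \<le> card (E - T) \<Longrightarrow> \<exists>ch. length ch = i \<and> (step_alg k es R t ^^ i) ([], [], U0, out0) = state_of ch \<and>
     good ch \<and> pot_ok ch"
proof (induction i)
  case 0
  have "total [] = k * card E"
  proof -
    have "potential k b 0 = k" for b by (cases b) (simp_all add: potential_def)
    then show ?thesis by (simp add: total_def)
  qed
  then show ?case by (simp add: state_of_def extend_used_def good_def pot_ok_def)
next
  case (Suc i)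
  then obtain ch where ch: "length ch = i" "(step_alg k es R t ^^ i) ([], [], U0, out0) = state_of ch"
    "good ch" "pot_ok ch" by auto
  then obtain x where "step_alg k es R t (state_of ch) = state_of (x # ch)" "good (x # ch)" "pot_ok (x # ch)"
    using step_state[OF ch(3,4)] Suc.prems by auto
  with ch show ?case by (intro exI[of _ "x # ch"]) simp
qed

text \<open>A single summand of the potential is at most the total. After cancelling
  \<open>k\<close>, the exponent of 2 in that summand is bounded by a logarithm.\<close>

lemma uses_le:
  assumes pot: "pot_ok ch" and s: "s \<in> E"
  shows "real (uses (chosen_edges ch) s) \<le> (if s \<in> T then real k else 1) * load_bound (card E) R"
proof -
  define j m f \<kappa> where "j = uses (chosen_edges ch) s" and "m = card E" and "f = card (E - T)"
    and "\<kappa> = 48 * (real R)\<^sup>2"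
  have m: "1 \<le> m" using s finE by (auto simp: m_def Suc_le_eq card_gt_0_iff)
  have \<kappa>: "0 \<le> \<kappa>" by (simp add: \<kappa>_def)
  have "harm f - harm (f - length ch) \<le> 1 + ln (real m)"
  proof -
    have "harm f \<le> 1 + ln (real m)"
    proof (cases "f = 0")
      case True
      then show ?thesis using m by (simp add: harm_def)
    next
      case False
      then have "harm f \<le> 1 + ln (real f)" by (intro harm_le_ln) simp
      also have "\<dots> \<le> 1 + ln (real m)"
      proof -
        have "f \<le> m" using finE by (auto simp: f_def m_def intro: card_mono)
        then show ?thesis using False m by simp
      qed
      finally show ?thesis .
    qed
    moreover have "0 \<le> (harm (f - length ch) :: real)" by (simp add: harm_nonneg)
    ultimately show ?thesis by linarith
  qed
  then have "exp (\<kappa> * (harm f - harm (f - length ch))) \<le> exp (\<kappa> * (1 + ln m))"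
    using \<kappa> by (simp add: mult_left_mono)
  then have tot: "real (total (chosen_edges ch)) \<le> real k * (real m * exp (\<kappa> * (1 + ln m)))"
    using pot mult_left_mono[of "exp (\<kappa> * (harm f - harm (f - length ch)))" "exp (\<kappa> * (1 + ln m))" "real (k * m)"]
    unfolding pot_ok_def f_def m_def \<kappa>_def by (simp add: mult.assoc)
  have "potential k (s \<in> T) j \<le> total (chosen_edges ch)"
    unfolding total_def j_def using finE s by (intro member_le_sum) auto
  moreover have "k * 2 ^ (if s \<in> T then j div k else j) \<le> potential k (s \<in> T) j"
    by (simp add: potential_def)
  ultimately have "real (k * 2 ^ (if s \<in> T then j div k else j)) \<le> real k * (real m * exp (\<kappa> * (1 + ln m)))"
    using tot by linarith
  then have "(2 :: real) ^ (if s \<in> T then j div k else j) \<le> real m * exp (\<kappa> * (1 + ln m))"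
    using k by simp
  then have "ln ((2 :: real) ^ (if s \<in> T then j div k else j)) \<le> ln (real m * exp (\<kappa> * (1 + ln m)))"
    using m by (subst ln_le_cancel_iff) auto
  then have "real (if s \<in> T then j div k else j) * ln 2 \<le> ln m + \<kappa> * (1 + ln m)"
    using m by (simp add: ln_realpow ln_mult)
  then have a: "real (if s \<in> T then j div k else j) \<le> load_bound m R - 1"
    by (simp add: load_bound_def \<kappa>_def field_simps)
  show ?thesis
  proof (cases "s \<in> T")
    case True
    have "j \<le> k * (j div k + 1)"
      using k by (simp add: less_imp_le dividend_less_times_div)
    then have "real j \<le> real (k * (j div k + 1))" by (rule of_nat_mono)
    also have "\<dots> = real k * (real (j div k) + 1)" by (simp add: algebra_simps)
    also have "\<dots> \<le> real k * load_bound m R" using a True by (intro mult_left_mono) auto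
    finally show ?thesis using True by (simp add: j_def m_def)
  next
    case False
    then show ?thesis using a by (simp add: j_def m_def)
  qed
qed

text \<open>All of \<open>E - T\<close> is covered after \<open>card (E - T)\<close> iterations; the
  remaining iterations of the fixed loop act on a fixpoint.\<close>

lemma stage_result:
  "\<exists>ch U'. stage_alg k es R (U0, out0) t = (U', map snd ch @ out0) \<and>
     (\<forall>s. conf_set U' s = used T ch s \<union> conf_set U0 s) \<and> stage_ok E T k R (conf_set U0) ch"
proof -
  obtain ch where ch: "length ch = card (E - T)" "(step_alg k es R t ^^ card (E - T)) ([], [], U0, out0) = state_of ch"
    "good ch" "pot_ok ch" using stage_states[of "card (E - T)"] by auto
  have fixpoint: "(step_alg k es R t ^^ i) (state_of ch) = state_of ch" for i
    by (induction i) (simp_all add: step_state_final[OF ch(3,1)])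
  have "card (E - T) \<le> length es" using finE by (metis card_E card_mono Diff_subset)
  then have "length es = (length es - card (E - T)) + card (E - T)" by simp
  then have "(step_alg k es R t ^^ length es) ([], [], U0, out0) = state_of ch"
    by (metis ch(2) comp_apply fixpoint funpow_add)
  then have "stage_alg k es R (U0, out0) t = (extend_used ch, map snd ch @ out0)"
    by (simp add: stage_alg_def state_of_def)
  moreover have "(\<lambda>x. ends (fst x)) ` set ch = E - T"
  proof (rule card_subset_eq)
    show "card ((\<lambda>x. ends (fst x)) ` set ch) = card (E - T)"
      using ch(1,3) by (metis good_def distinct_card length_map list.set_map)
  qed (use ch(3) finE in \<open>auto simp: good_def\<close>)
  then have "stage_ok E T k R (conf_set U0) ch"
    using ch(3) uses_le[OF ch(4)] unfolding stage_ok_def good_def allowed_def by auto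
  ultimately show ?thesis using conf_set_extend by blast
qed

end

section \<open>The complete run\<close>

lemma rounds_for_spec:
  assumes "1 \<le> n" "n \<le> 2 ^ m"
  shows "\<exists>L. rounds_for n m = 2 * L + 2 \<and> n \<le> 2 ^ L \<and> 2 ^ L < 2 * n"
proof -
  define F where "F = (\<lambda>(j :: nat, R :: nat). if j < n then (2 * j, R + 2) else (j, R))"
  have F: "F (2 ^ L, 2 * L + 2) = (if 2 ^ L < n then (2 ^ Suc L, 2 * Suc L + 2) else (2 ^ L, 2 * L + 2))" for L
    by (simp add: F_def)
  \<comment> \<open>The alternative \<open>L = i\<close> says that every iteration so far doubled.
    At \<open>i = m\<close> it also yields \<open>n \<le> 2 ^ L\<close>, by the assumption on
    \<open>m\<close>.\<close>
  have "\<exists>L. (F ^^ i) (1, 2) = (2 ^ L, 2 * L + 2) \<and> 2 ^ L < 2 * n \<and> (n \<le> 2 ^ L \<or> L = i)" for i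
  proof (induction i)
    case 0
    show ?case using assms(1) by (intro exI[of _ 0]) simp
  next
    case (Suc i)
    then obtain L where L: "(F ^^ i) (1, 2) = (2 ^ L, 2 * L + 2)" "2 ^ L < 2 * n" "n \<le> 2 ^ L \<or> L = i"
      by (elim exE conjE)
    have step: "(F ^^ Suc i) (1, 2) = F (2 ^ L, 2 * L + 2)" by (simp only: funpow.simps o_apply L(1))
    show ?case
    proof (cases "2 ^ L < n")
      case True
      then show ?thesis unfolding step F using L(3) by (intro exI[of _ "Suc L"]) auto
    next
      case False
      then show ?thesis unfolding step F using L(2) by (intro exI[of _ L]) auto
    qed
  qed
  then obtain L where L: "(F ^^ m) (1, 2) = (2 ^ L, 2 * L + 2)" "2 ^ L < 2 * n" "n \<le> 2 ^ L \<or> L = m"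
    by blast
  have "rounds_for n m = 2 * L + 2" unfolding rounds_for_def F_def[symmetric] L(1) by simp
  then show ?thesis using L(2,3) assms(2) by blast
qed

text \<open>Each edge receives only one path per stage, and that path has at most \<open>R\<close>
  non-tree edges.\<close>

lemma card_used_le:
  assumes "stage_ok E T k R cf ch"
  shows "card (used T ch s) \<le> R"
proof (cases "\<exists>x\<in>set ch. ends (fst x) = s")
  case False
  then have "used T ch s = {}" unfolding used_def by blast
  then show ?thesis by simp
next
  case True
  then obtain x where x: "x \<in> set ch" "ends (fst x) = s" by blast
  have uniq: "y = x" if "y \<in> set ch" "ends (fst y) = s" for y
  proof -
    have "inj_on (\<lambda>x. ends (fst x)) (set ch)" using assms by (simp add: stage_ok_def distinct_map)
    then show ?thesis by (rule inj_onD) (simp_all add: that x)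
  qed
  have "used T ch s \<subseteq> ends ` set (filter (\<lambda>f. ends f \<notin> T) (path_edges (snd x)))"
  proof
    fix z assume "z \<in> used T ch s"
    then obtain f y where fy: "z = ends f" "y \<in> set ch" "ends (fst y) = s" "f \<in> set (path_edges (snd y))" "ends f \<notin> T"
      unfolding used_def by blast
    then have "f \<in> set (filter (\<lambda>f. ends f \<notin> T) (path_edges (snd x)))" using uniq[OF fy(2,3)] by simp
    then show "z \<in> ends ` set (filter (\<lambda>f. ends f \<notin> T) (path_edges (snd x)))" using fy(1) by blast
  qed
  then have "card (used T ch s) \<le> card (ends ` set (filter (\<lambda>f. ends f \<notin> T) (path_edges (snd x))))"
    by (rule card_mono[rotated]) simp
  also have "\<dots> \<le> card (set (filter (\<lambda>f. ends f \<notin> T) (path_edges (snd x))))"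
    by (rule card_image_le) simp
  also have "\<dots> \<le> nontree_count T (snd x)"
    unfolding nontree_count_def by (rule card_length)
  also have "\<dots> \<le> R" using assms x(1) by (auto simp: stage_ok_def)
  finally show ?thesis .
qed

text \<open>Forbidden sets are expressed through the selections of earlier trees, which frees the
  covering argument from the state of the algorithm.\<close>

definition run_ok :: "nat set set \<Rightarrow> nat \<Rightarrow> nat \<Rightarrow> nat set set list \<Rightarrow> selection list \<Rightarrow> bool" where
  "run_ok E k R Ts chs \<longleftrightarrow>
     (\<forall>j<length chs. stage_ok E (Ts ! j) k R (\<lambda>s. \<Union>l<j. used (Ts ! l) (chs ! l) s) (chs ! j))"

text \<open>The stages put newer paths in front, so the output is compared with the selections only
  as a multiset.\<close>

lemma run_stages:
  assumes graph: "simple_graph {..<n} E" and es: "edge_list es E" and ts: "list_all2 edge_list ts Ts"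
    and trees: "\<And>T. T \<in> set Ts \<Longrightarrow> spanning_tree {..<n} E T"
    and L: "n \<le> 2 ^ L" and R: "R = 2 * L + 2" and i: "i \<le> length ts"
  shows "\<exists>chs U out. length chs = i \<and> foldl (stage_alg (length ts) es R) ([], []) (take i ts) = (U, out) \<and>
    mset out = mset (concat (map (map snd) chs)) \<and> (\<forall>s. conf_set U s = (\<Union>j<i. used (Ts ! j) (chs ! j) s)) \<and>
    run_ok E (length ts) R Ts chs"
  using i
proof (induction i)
  case 0
  show ?case by (simp add: run_ok_def conf_set_def)
next
  case (Suc i)
  let ?k = "length ts"
  from Suc obtain chs U out where IH: "length chs = i" "foldl (stage_alg ?k es R) ([], []) (take i ts) = (U, out)"
    "mset out = mset (concat (map (map snd) chs))" "\<And>s. conf_set U s = (\<Union>j<i. used (Ts ! j) (chs ! j) s)"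
    "run_ok E ?k R Ts chs" by auto
  have i: "i < length ts" "i < length Ts" "length ts = length Ts"
    using Suc.prems list_all2_lengthD[OF ts] by auto
  have conf: "card (conf_set U s) \<le> ?k * R" for s
  proof -
    have "card (conf_set U s) \<le> (\<Sum>j<i. card (used (Ts ! j) (chs ! j) s))"
      unfolding IH(4) by (rule card_UN_le) simp
    also have "\<dots> \<le> (\<Sum>j<i. R)"
      using IH(1,5) by (intro sum_mono card_used_le) (auto simp: run_ok_def)
    also have "\<dots> \<le> ?k * R" using i by simp
    finally show ?thesis .
  qed
  interpret tree_stage n E "Ts ! i" es "ts ! i" ?k R L U out
  proof
    show "spanning_tree {..<n} E (Ts ! i)" using trees i by simp
    show "edge_list (ts ! i) (Ts ! i)" using ts i by (simp add: list_all2_nthD)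
    show "1 \<le> ?k" using i by simp
  qed (use graph es L R conf in auto)
  obtain ch U' where ch: "stage_alg ?k es R (U, out) (ts ! i) = (U', map snd ch @ out)"
    "\<And>s. conf_set U' s = used (Ts ! i) ch s \<union> conf_set U s" "stage_ok E (Ts ! i) ?k R (conf_set U) ch"
    using stage_result by blast
  have nth: "(chs @ [ch]) ! j = chs ! j" if "j < i" for j
    using that IH(1) by (simp add: nth_append)
  have last: "(chs @ [ch]) ! i = ch" using IH(1) by (simp add: nth_append)
  have "conf_set U' s = (\<Union>j<Suc i. used (Ts ! j) ((chs @ [ch]) ! j) s)" for s
    using nth by (auto simp: ch(2) IH(4) lessThan_Suc last)
  moreover have "run_ok E ?k R Ts (chs @ [ch])"
    unfolding run_ok_def
  proof (intro allI impI)
    fix j assume j: "j < length (chs @ [ch])"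
    have eq: "(\<lambda>s. \<Union>l<j. used (Ts ! l) ((chs @ [ch]) ! l) s) = (\<lambda>s. \<Union>l<j. used (Ts ! l) (chs ! l) s)"
      using nth j IH(1) by (intro ext) (auto simp: nth_append)
    show "stage_ok E (Ts ! j) ?k R (\<lambda>s. \<Union>l<j. used (Ts ! l) ((chs @ [ch]) ! l) s) ((chs @ [ch]) ! j)"
    proof (cases "j < i")
      case True
      then show ?thesis unfolding eq using IH(1,5) nth[OF True] by (simp add: run_ok_def)
    next
      case False
      then have "j = i" using j IH(1) by simp
      moreover have "conf_set U = (\<lambda>s. \<Union>l<i. used (Ts ! l) (chs ! l) s)" by (rule ext) (rule IH(4))
      ultimately show ?thesis unfolding eq using ch(3) last by simp
    qed
  qed
  moreover have "foldl (stage_alg ?k es R) ([], []) (take (Suc i) ts) = (U', map snd ch @ out)"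
    using i IH(2) ch(1) by (simp add: take_Suc_conv_app_nth)
  moreover have "mset (map snd ch @ out) = mset (concat (map (map snd) (chs @ [ch])))"
    using IH(3) by simp
  ultimately show ?case
    using IH(1) by (intro exI[of _ "chs @ [ch]"] exI[of _ U'] exI[of _ "map snd ch @ out"]) simp
qed

section \<open>The cycle cover\<close>

lemma cycle_edges_closing:
  assumes "c \<noteq> []"
  shows "cycle_edges c = ends ` set (path_edges c) \<union> {{last c, hd c}}"
proof -
  have c: "c = butlast c @ [last c]" using assms by simp
  have "path_edges (c @ [hd c]) = path_edges c @ [(last c, hd c)]"
    using path_edges_append[of "butlast c" "last c" "[hd c]"] c
    by (metis append.assoc append_Cons append_Nil path_edges_simps(2,3))
  then show ?thesis using cycle_edges_path_edges[OF assms] by auto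
qed

lemma card_edges_le:
  assumes "simple_graph V E"
  shows "card E \<le> card V * card V"
proof -
  have V: "finite V" using assms by (simp add: simple_graph_def)
  have "E \<subseteq> ends ` (V \<times> V)"
  proof
    fix e assume "e \<in> E"
    then obtain u v where "e = {u, v}" "u \<in> V" "v \<in> V"
      using assms unfolding simple_graph_def by (metis card_2_iff insert_subset)
    then show "e \<in> ends ` (V \<times> V)" by (intro image_eqI[of _ _ "(u, v)"]) auto
  qed
  then have "card E \<le> card (ends ` (V \<times> V))" using V by (intro card_mono) auto
  also have "\<dots> \<le> card (V \<times> V)" using V by (intro card_image_le) simp
  finally show ?thesis by (simp add: card_cartesian_product)
qed

text \<open>The vertex list of the path is itself the cycle, closed by the covered edge. It has at
  least three vertices: one vertex cannot be both ends of an edge, and with two the path would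
  consist of the covered edge, which it avoids.\<close>

lemma stage_cycle:
  assumes graph: "simple_graph V E" and T: "T \<subseteq> E" and st: "stage_ok E T k R cf ch" and x: "x \<in> set ch"
  shows "cycle_edges (snd x) = insert (ends (fst x)) (ends ` set (path_edges (snd x)))"
    and "simple_cycle E (snd x)" and "set (snd x) \<subseteq> V" and "snd x \<noteq> []"
proof -
  let ?p = "snd x" and ?s = "ends (fst x)"
  have p: "walk (T \<union> (E - T - {?s} - cf ?s)) ?p" "{last ?p, hd ?p} = ?s" "distinct ?p"
    using st x by (auto simp: stage_ok_def)
  have s: "?s \<in> E - T" using st x unfolding stage_ok_def by blast
  show ne: "?p \<noteq> []" using p(1) by (auto simp: walk_def)
  show cyc: "cycle_edges ?p = insert ?s (ends ` set (path_edges ?p))"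
    using cycle_edges_closing[OF ne] p(2) by simp
  have path: "ends ` set (path_edges ?p) \<subseteq> E - {?s}"
    using p(1) T s by (auto simp: walk_def simp del: ends_pair)
  have card: "card ?s = 2" "?s \<subseteq> V" using s graph by (auto simp: simple_graph_def)
  have "3 \<le> length ?p"
  proof (rule ccontr)
    assume "\<not> 3 \<le> length ?p"
    moreover have "length ?p \<noteq> 0" using ne by simp
    ultimately have "length ?p = 1 \<or> length ?p = 2" by linarith
    then show False
    proof
      assume "length ?p = 1"
      then obtain a where "?p = [a]" by (auto simp: length_Suc_conv)
      then show False using p(2) card(1) by (simp flip: p(2))
    next
      assume "length ?p = 2"
      then obtain a b where "?p = [a, b]" by (auto simp: length_Suc_conv numeral_2_eq_2)
      then show False using p(2) path by (auto simp: insert_commute)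
    qed
  qed
  then show "simple_cycle E ?p" using p(3) path s by (auto simp: simple_cycle_def cyc)
  have sub: "e \<subseteq> V" if "e \<in> T \<union> (E - T - {?s} - cf ?s)" for e
    using that T graph by (auto simp: simple_graph_def)
  have "hd ?p \<in> V" using p(2) card(2) by blast
  then show "set ?p \<subseteq> V" using walk_vertices[OF p(1) sub] by blast
qed

lemma stage_cycle_length:
  assumes graph: "simple_graph V E" and tree: "spanning_tree V E T" and st: "stage_ok E T k R cf ch"
    and x: "x \<in> set ch"
  shows "length (snd x) \<le> (R + 1) * Suc (diameter V T)"
proof -
  have T: "T \<subseteq> E" using tree by (simp add: spanning_tree_def)
  have "nontree_count T (snd x) \<le> R" "distinct (snd x)" using st x by (auto simp: stage_ok_def)
  moreover have "length (snd x) \<le> (nontree_count T (snd x) + 1) * Suc (diameter V T)"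
  proof (rule path_length_nontree[where V = V])
    show "length s \<le> Suc (diameter V T)" if "walk T s" "distinct s" "set s \<subseteq> V" for s
      by (rule tree_path_length_le_diameter[OF tree graph that(1,2)]) (use that in \<open>cases s; auto\<close>)
  qed (use stage_cycle[OF graph T st x] calculation in auto)
  moreover have "(nontree_count T (snd x) + 1) * Suc (diameter V T) \<le> (R + 1) * Suc (diameter V T)"
    using calculation by (intro mult_le_mono1) simp
  ultimately show ?thesis by linarith
qed

text \<open>Needed to replace the D + 1 vertices of a tree segment by 2D, as the target bound is
  purely multiplicative in D.\<close>

lemma diameter_pos:
  assumes graph: "simple_graph V E" and tree: "spanning_tree V E T" and uv: "u \<in> V" "v \<in> V" "u \<noteq> v"
  shows "1 \<le> diameter V T"
proof -
  obtain p where p: "walk_between V T u p v"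
    using tree uv unfolding spanning_tree_def connected_graph_def by blast
  then have w: "walk T p" "hd p = u" "last p = v" by (auto simp: walk_between_walk)
  then have "p \<noteq> []" by auto
  then obtain q where q: "q \<noteq> []" "hd q = hd p" "last q = last p"
    "mset (path_edges q) \<subseteq># mset (path_edges p)" "distinct q"
    using loop_erasure[of p] by metis
  have "walk T q" by (rule walk_mono[OF q(4,1) w(1)])
  then have "length q \<le> Suc (diameter V T)"
    by (rule tree_path_length_le_diameter[OF tree graph _ q(5)]) (use q w uv in auto)
  moreover have "2 \<le> length q" using q(1-3) w uv(3) by (cases q; cases "tl q") auto
  ultimately show ?thesis by linarith
qed

lemma length_filter_disj:
  "length (filter (\<lambda>x. P x \<or> Q x) xs) \<le> length (filter P xs) + length (filter Q xs)"
  by (induction xs) auto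

text \<open>A cycle through \<open>s\<close> either was built for \<open>s\<close>, which happens at
  most once per stage, or has \<open>s\<close> on its path and is counted by the log.\<close>

lemma stage_congestion:
  assumes graph: "simple_graph V E" and T: "T \<subseteq> E" and st: "stage_ok E T k R cf ch"
  shows "length (filter (\<lambda>x. s \<in> cycle_edges (snd x)) ch) \<le> 1 + uses (chosen_edges ch) s"
proof -
  have "s \<in> cycle_edges (snd x) \<longleftrightarrow> s = ends (fst x) \<or> s \<in> ends ` set (path_edges (snd x))"
    if "x \<in> set ch" for x
    unfolding stage_cycle(1)[OF graph T st that] by blast
  then have "filter (\<lambda>x. s \<in> cycle_edges (snd x)) ch =
     filter (\<lambda>x. s = ends (fst x) \<or> s \<in> ends ` set (path_edges (snd x))) ch"
    by (rule filter_cong[OF refl])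
  then have "length (filter (\<lambda>x. s \<in> cycle_edges (snd x)) ch) =
     length (filter (\<lambda>x. s = ends (fst x) \<or> s \<in> ends ` set (path_edges (snd x))) ch)"
    by (rule arg_cong)
  also have "\<dots> \<le> length (filter (\<lambda>x. s = ends (fst x)) ch) +
     length (filter (\<lambda>x. s \<in> ends ` set (path_edges (snd x))) ch)"
    by (rule length_filter_disj)
  also have "length (filter (\<lambda>x. s = ends (fst x)) ch) \<le> 1"
  proof -
    have "distinct (map (\<lambda>x. ends (fst x)) ch)" using st by (simp add: stage_ok_def)
    then have "distinct (map (\<lambda>x. ends (fst x)) (filter (\<lambda>x. s = ends (fst x)) ch))"
      by (rule distinct_map_filter)
    then have "length (filter (\<lambda>x. s = ends (fst x)) ch) =
        card ((\<lambda>x. ends (fst x)) ` set (filter (\<lambda>x. s = ends (fst x)) ch))"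
      by (metis distinct_card length_map list.set_map)
    also have "\<dots> \<le> card {s}" by (intro card_mono) auto
    finally show ?thesis by simp
  qed
  also have "length (filter (\<lambda>x. s \<in> ends ` set (path_edges (snd x))) ch) \<le> uses (chosen_edges ch) s"
  proof (induction ch)
    case (Cons x ch)
    have "1 \<le> uses (path_edges (snd x)) s" if "s \<in> ends ` set (path_edges (snd x))"
    proof -
      from that have "filter (\<lambda>g. ends g = s) (path_edges (snd x)) \<noteq> []"
        unfolding filter_empty_conv by blast
      then show ?thesis unfolding uses_def by (simp add: Suc_le_eq del: filter_empty_conv)
    qed
    with Cons show ?case
      by (cases "s \<in> ends ` set (path_edges (snd x))") (simp_all del: image_iff)
  qed simp
  finally show ?thesis by simp
qed

lemma mset_concat_sum: "mset (concat xss) = (\<Sum>j<length xss. mset (xss ! j))"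
  by (induction xss rule: rev_induct) (auto simp: nth_append)

lemma image_mset_subset_sum:
  assumes "finite J" "\<And>j. j \<in> J \<Longrightarrow> f j \<in># g j"
  shows "image_mset f (mset_set J) \<subseteq># (\<Sum>j\<in>J. g j)"
  using assms
proof (induction J rule: finite_induct)
  case (insert j J)
  then have "{#f j#} + image_mset f (mset_set J) \<subseteq># g j + (\<Sum>j\<in>J. g j)"
    by (intro subset_mset.add_mono) auto
  with insert show ?case by simp
qed simp

lemma packing_count:
  assumes "packing_congestion_le E (mset Ts) x" "s \<in> E"
  shows "card {j. j < length Ts \<and> s \<in> Ts ! j} \<le> x"
proof -
  have "size {#T \<in># mset Ts. s \<in> T#} = card {j. j < length Ts \<and> s \<in> Ts ! j}"
    by (simp add: length_filter_conv_card flip: mset_filter)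
  moreover have "size {#T \<in># mset Ts. s \<in> T#} \<le> x"
    using assms unfolding packing_congestion_le_def by blast
  ultimately show ?thesis by linarith
qed

section \<open>Covering, congestion and length for the finished run\<close>

locale complete_run =
  fixes n :: nat and E :: "nat set set" and Ts :: "nat set set list" and k \<eta> R :: nat and chs
  assumes graph: "simple_graph {..<n} E" and trees: "\<And>T. T \<in> set Ts \<Longrightarrow> spanning_tree {..<n} E T"
    and k: "length Ts = k" "length chs = k" and \<eta>: "2 \<le> \<eta>" "\<eta> \<le> k + 1"
    and packing: "packing_congestion_le E (mset Ts) (\<eta> - 1)" and run: "run_ok E k R Ts chs"
begin

definition cycles :: "nat list multiset" where
  "cycles = mset (concat (map (map snd) chs))"

lemma cycles_sum: "cycles = (\<Sum>j<k. mset (map snd (chs ! j)))"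
  by (simp add: cycles_def mset_concat_sum k)

lemma stage: "j < k \<Longrightarrow> stage_ok E (Ts ! j) k R (\<lambda>s. \<Union>l<j. used (Ts ! l) (chs ! l) s) (chs ! j)"
  using run k by (simp add: run_ok_def)

lemma tree: "j < k \<Longrightarrow> spanning_tree {..<n} E (Ts ! j)"
  using trees k by simp

lemma tree_sub: "j < k \<Longrightarrow> Ts ! j \<subseteq> E"
  using tree by (simp add: spanning_tree_def)

lemma cyclesE:
  assumes "c \<in># cycles"
  obtains j x where "j < k" "x \<in> set (chs ! j)" "c = snd x"
proof -
  obtain ch x where ch: "ch \<in> set chs" "x \<in> set ch" "c = snd x"
    using assms by (force simp: cycles_def)
  then obtain j where "j < k" "chs ! j = ch" using k(2) by (metis in_set_conv_nth)
  with ch show thesis using that by blast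
qed

lemma cycle_collection: "cycle_collection E cycles"
  unfolding cycle_collection_def
proof
  fix c assume "c \<in># cycles"
  then obtain j x where j: "j < k" "x \<in> set (chs ! j)" "c = snd x" by (rule cyclesE)
  show "simple_cycle E c"
    unfolding j(3) by (rule stage_cycle(2)[OF graph tree_sub[OF j(1)] stage[OF j(1)] j(2)])
qed

text \<open>Every tree that misses \<open>s\<close> supplies one cycle for it. Writing
  \<open>k + 1 - \<eta>\<close> in this order avoids truncated subtraction in the extreme case
  \<eta> = k + 1.\<close>

lemma covers:
  assumes s: "s \<in> E"
  shows "covers_edge E \<eta> (k + 1 - \<eta>) cycles s"
proof -
  define J where "J = {j. j < k \<and> s \<notin> Ts ! j}"
  have "\<exists>x. x \<in> set (chs ! j) \<and> ends (fst x) = s" if "j \<in> J" for j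
  proof -
    have "s \<in> (\<lambda>x. ends (fst x)) ` set (chs ! j)"
      using stage[of j] that s by (auto simp: J_def stage_ok_def)
    then show ?thesis by blast
  qed
  then obtain x where x: "\<And>j. j \<in> J \<Longrightarrow> x j \<in> set (chs ! j) \<and> ends (fst (x j)) = s" by metis
  have "{..<k} = J \<union> {j. j < length Ts \<and> s \<in> Ts ! j}" by (auto simp: J_def k)
  then have "k \<le> card J + card {j. j < length Ts \<and> s \<in> Ts ! j}"
    by (metis card_Un_le card_lessThan)
  \<comment> \<open>At most \<eta> - 1 of the \<open>k\<close> trees contain \<open>s\<close>, so
    enough trees miss it.\<close>
  then have "k + 1 - \<eta> \<le> card J" using packing_count[OF packing s] \<eta> by linarith
  then obtain J' where J': "J' \<subseteq> J" "card J' = k + 1 - \<eta>" "finite J'"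
    by (metis obtain_subset_with_card_n)
  have J'k: "j < k" if "j \<in> J'" for j using that J' by (auto simp: J_def)
  define \<C> where "\<C> = image_mset (\<lambda>j. snd (x j)) (mset_set J')"
  have cyc: "cycle_edges (snd (x j)) = insert s (ends ` set (path_edges (snd (x j))))" if "j \<in> J'" for j
    using stage_cycle(1)[OF graph tree_sub stage, of j "x j"] x[of j] J'k[OF that] that J' by auto
  have "\<C> \<subseteq># (\<Sum>j\<in>J'. mset (map snd (chs ! j)))"
    unfolding \<C>_def using J' x by (intro image_mset_subset_sum) auto
  also have "\<dots> \<subseteq># cycles"
  proof -
    have "J' \<subseteq> {..<k}" using J'k by blast
    then show ?thesis unfolding cycles_sum by (subst sum.subset_diff[of J' "{..<k}"]) auto
  qed
  finally have "\<C> \<subseteq># cycles" .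
  moreover have "size \<C> = k + 1 - \<eta>" using J' by (simp add: \<C>_def)
  moreover have "s \<in> cycle_edges c" if "c \<in># \<C>" for c
    using that cyc J' by (auto simp: \<C>_def simp del: ends_pair)
  moreover have "size {#c \<in># \<C>. e \<in> cycle_edges c#} \<le> \<eta>" if e: "e \<in> E - {s}" for e
  proof -
    define N where "N = {j\<in>J'. e \<notin> Ts ! j \<and> e \<in> ends ` set (path_edges (snd (x j)))}"
    have "size {#c \<in># \<C>. e \<in> cycle_edges c#} = card {j\<in>J'. e \<in> cycle_edges (snd (x j))}"
      using J' by (simp add: \<C>_def filter_mset_image_mset)
    also have "\<dots> \<le> card ({j. j < length Ts \<and> e \<in> Ts ! j} \<union> N)"
    proof (rule card_mono)
      show "{j\<in>J'. e \<in> cycle_edges (snd (x j))} \<subseteq> {j. j < length Ts \<and> e \<in> Ts ! j} \<union> N"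
        using e cyc J'k k unfolding N_def by auto
    qed (use J' in \<open>simp add: N_def\<close>)
    also have "\<dots> \<le> card {j. j < length Ts \<and> e \<in> Ts ! j} + card N" by (rule card_Un_le)
    also have "card {j. j < length Ts \<and> e \<in> Ts ! j} \<le> \<eta> - 1"
      using packing_count[OF packing] e by simp
    also have "card N \<le> 1"
    proof -
      \<comment> \<open>The earlier of two such stages would have put \<open>e\<close> among the
        edges forbidden for \<open>s\<close> in the later one.\<close>
      have less: False if N: "j \<in> N" "l \<in> N" "j < l" for j l
      proof -
        have jl: "j \<in> J'" "l \<in> J'" "j < k" "l < k" using N J'k by (auto simp: N_def)
        have xj: "x j \<in> set (chs ! j)" "ends (fst (x j)) = s" and xl: "x l \<in> set (chs ! l)" "ends (fst (x l)) = s"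
          using x jl J' by auto
        obtain f where f: "f \<in> set (path_edges (snd (x j)))" "ends f = e" using N(1) unfolding N_def by blast
        have "e \<notin> Ts ! j" using N(1) by (simp add: N_def)
        with f xj have "e \<in> used (Ts ! j) (chs ! j) s" unfolding used_def by blast
        then have in_used: "e \<in> (\<Union>i<l. used (Ts ! i) (chs ! i) s)" using N(3) by blast
        obtain g where g: "g \<in> set (path_edges (snd (x l)))" "ends g = e" using N(2) unfolding N_def by blast
        have "walk (Ts ! l \<union> (E - Ts ! l - {s} - (\<Union>i<l. used (Ts ! i) (chs ! i) s))) (snd (x l))"
          using stage[OF jl(4)] xl unfolding stage_ok_def by blast
        then have "ends g \<in> Ts ! l \<union> (E - Ts ! l - {s} - (\<Union>i<l. used (Ts ! i) (chs ! i) s))"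
          using g(1) unfolding walk_def by blast
        moreover have "e \<notin> Ts ! l" using N(2) by (simp add: N_def)
        ultimately show False using in_used g(2) by blast
      qed
      have "finite N" using J' by (simp add: N_def)
      then show ?thesis using less by (metis One_nat_def card_le_Suc0_iff_eq nat_neq_iff)
    qed
    finally show ?thesis using \<eta>(1) by simp
  qed
  ultimately show ?thesis unfolding covers_edge_def by blast
qed

text \<open>Each of the \<open>k\<close> stages contributes at most 1 + \<Lambda>, and the at most
  \<eta> - 1 stages whose tree contains \<open>s\<close> another k\<Lambda> each: in total k +
  k\<eta>\<Lambda>.\<close>

lemma congestion:
  assumes s: "s \<in> E" and \<Lambda>: "\<Lambda> = load_bound (card E) R" "0 \<le> \<Lambda>"
  shows "real (size {#c \<in># cycles. s \<in> cycle_edges c#}) \<le> real k * real \<eta> * (\<Lambda> + 1)"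
proof -
  have sz: "size {#c \<in># cycles. s \<in> cycle_edges c#} = (\<Sum>j<k. length (filter (\<lambda>x. s \<in> cycle_edges (snd x)) (chs ! j)))"
  proof -
    have "size {#c \<in># (\<Sum>j\<in>J. f j). Q c#} = (\<Sum>j\<in>J. size {#c \<in># f j. Q c#})" if "finite J"
      for J and f :: "nat \<Rightarrow> nat list multiset" and Q
      using that by (induction J rule: finite_induct) auto
    moreover have "size {#c \<in># image_mset snd (mset ch). s \<in> cycle_edges c#} =
        length (filter (\<lambda>x. s \<in> cycle_edges (snd x)) ch)" for ch :: "selection"
      by (simp add: filter_mset_image_mset flip: mset_filter)
    ultimately show ?thesis by (simp add: cycles_sum)
  qed
  have "real (length (filter (\<lambda>x. s \<in> cycle_edges (snd x)) (chs ! j))) \<le> 1 + (if s \<in> Ts ! j then real k else 0) * \<Lambda> + \<Lambda>"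
    if j: "j < k" for j
  proof -
    have "real (uses (chosen_edges (chs ! j)) s) \<le> (if s \<in> Ts ! j then real k else 1) * \<Lambda>"
      using stage[OF j] s by (simp add: stage_ok_def \<Lambda>)
    also have "\<dots> \<le> (if s \<in> Ts ! j then real k else 0) * \<Lambda> + \<Lambda>" using \<Lambda> by simp
    finally show ?thesis using stage_congestion[OF graph tree_sub[OF j] stage[OF j], of s] by linarith
  qed
  then have "real (size {#c \<in># cycles. s \<in> cycle_edges c#}) \<le>
      (\<Sum>j<k. 1 + (if s \<in> Ts ! j then real k else 0) * \<Lambda> + \<Lambda>)"
    unfolding sz of_nat_sum by (intro sum_mono) simp
  also have "\<dots> = real k + (\<Sum>j<k. if s \<in> Ts ! j then real k else 0) * \<Lambda> + real k * \<Lambda>"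
    by (simp add: sum.distrib sum_distrib_right)
  also have "(\<Sum>j<k. if s \<in> Ts ! j then real k else 0) = real (card {j. j < length Ts \<and> s \<in> Ts ! j}) * real k"
  proof -
    have "(\<Sum>j<k. if s \<in> Ts ! j then real k else 0) = (\<Sum>j\<in>{..<k} \<inter> {j. s \<in> Ts ! j}. real k)"
      using sum.inter_restrict[of "{..<k}" "\<lambda>_. real k" "{j. s \<in> Ts ! j}"] by simp
    moreover have "{..<k} \<inter> {j. s \<in> Ts ! j} = {j. j < length Ts \<and> s \<in> Ts ! j}" by (auto simp: k)
    ultimately show ?thesis by (simp only: sum_constant)
  qed
  also have "real k + real (card {j. j < length Ts \<and> s \<in> Ts ! j}) * real k * \<Lambda> + real k * \<Lambda> \<le>
      real k + real (\<eta> - 1) * real k * \<Lambda> + real k * \<Lambda>"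
    using packing_count[OF packing s] \<Lambda>(2) by (intro add_mono mult_right_mono) auto
  also have "\<dots> = real k + real k * real \<eta> * \<Lambda>" using \<eta>(1) by (simp add: algebra_simps of_nat_diff)
  also have "\<dots> \<le> real k * real \<eta> + real k * real \<eta> * \<Lambda>"
    using mult_left_mono[of 1 "real \<eta>" "real k"] \<eta>(1) by simp
  finally show ?thesis by (simp add: algebra_simps)
qed

lemma cycle_length:
  assumes D: "packing_diameter {..<n} (mset Ts) = D" and c: "c \<in># cycles"
  shows "length c \<le> 2 * D * (R + 1)" and "2 \<le> n"
proof -
  obtain j x where j: "j < k" "x \<in> set (chs ! j)" "c = snd x" using c by (rule cyclesE)
  have "length c \<le> (R + 1) * Suc (diameter {..<n} (Ts ! j))"
    unfolding j(3) by (rule stage_cycle_length[OF graph tree stage j(2)]) (use j in auto)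
  moreover have "diameter {..<n} (Ts ! j) \<le> D"
    unfolding D[symmetric] packing_diameter_def using j(1) k by (intro Max_ge) auto
  ultimately have len: "length c \<le> (R + 1) * Suc D" by (meson Suc_le_mono mult_le_mono2 order.trans)
  have cyc: "simple_cycle E c" "set c \<subseteq> {..<n}"
    unfolding j(3) using stage_cycle(2,3)[OF graph tree_sub stage j(2)] j(1) by auto
  then have "card (set c) \<le> card {..<n}" by (intro card_mono) auto
  \<comment> \<open>The existence of a cycle excludes tiny graphs, so the diameter is positive and
    the logarithmic bounds apply.\<close>
  then have n: "3 \<le> n" using cyc(1) distinct_card[of c] by (simp add: simple_cycle_def)
  then show "2 \<le> n" by simp
  have "1 \<le> diameter {..<n} (Ts ! j)"
    by (rule diameter_pos[OF graph tree[OF j(1)], of 0 1]) (use n in auto)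
  then have "1 \<le> D" using \<open>diameter {..<n} (Ts ! j) \<le> D\<close> by linarith
  then have "(R + 1) * Suc D \<le> (R + 1) * (2 * D)" by (intro mult_le_mono2) simp
  then show "length c \<le> 2 * D * (R + 1)" using len by (simp add: algebra_simps)
qed

end

section \<open>Explicit constants\<close>

lemma ln_ge_two_thirds:
  assumes "2 \<le> (n :: nat)"
  shows "2 / 3 \<le> ln (real n)"
proof -
  have "ln 2 \<le> ln (real n)" using assms by (subst ln_le_cancel_iff) auto
  then show ?thesis using ln2_ge_two_thirds by linarith
qed

lemma rounds_bound:
  assumes "2 \<le> n" "2 ^ L < 2 * n"
  shows "real L \<le> 3 * ln (real n)"
proof -
  have ln: "2 / 3 \<le> ln (real n)"
    using ln_ge_two_thirds[OF assms(1)] .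
  have "real (2 ^ L) < real (2 * n)" using assms(2) by (rule of_nat_less_iff[THEN iffD2])
  then have "ln ((2 :: real) ^ L) \<le> ln (2 * real n)" using assms(1) by simp
  then have "real L * ln 2 \<le> ln 2 + ln (real n)" using assms(1) by (simp add: ln_realpow ln_mult)
  then have *: "(real L - 1) * ln 2 \<le> ln (real n)" by (simp add: algebra_simps)
  show ?thesis
  proof (cases L)
    case 0
    then show ?thesis using ln by simp
  next
    case (Suc j)
    then have "0 \<le> real L - 1" by simp
    then have "(real L - 1) * (2 / 3) \<le> (real L - 1) * ln 2"
      using mult_left_mono[OF ln2_ge_two_thirds] by blast
    then have "(real L - 1) * (2 / 3) \<le> ln (real n)" using * by linarith
    then show ?thesis using ln by (simp add: algebra_simps)
  qed
qed

text \<open>With l = ln n, \<open>1 + ln m\<close> is at most 7/2 l, and 48 * 81 * 7/2 = 13608; the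
  factor 1 / ln 2 is at most 3/2, giving 20412. Lower-order terms are lifted to l^3 using l \<ge>
  2/3, and 30000 rounds the sum up.\<close>

lemma load_bound_le:
  assumes n: "2 \<le> n" and m: "1 \<le> m" "m \<le> n * n" and R: "real R \<le> 9 * ln (real n)"
  shows "0 \<le> load_bound m R" "load_bound m R + 1 \<le> 30000 * ln (real n) ^ 3"
proof -
  define l where "l = ln (real n)"
  have l: "2 / 3 \<le> l"
    using ln_ge_two_thirds[OF n] by (simp add: l_def)
  have "ln (real m) \<le> ln (real (n * n))" using m n by (subst ln_le_cancel_iff) (auto simp flip: of_nat_mult)
  then have lm: "0 \<le> ln (real m)" "ln (real m) \<le> 2 * l" using m n by (auto simp: ln_mult l_def)
  have l2: "4 / 9 \<le> l\<^sup>2" using power_mono[OF l, of 2] by (simp add: power2_eq_square)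
  have R2: "(real R)\<^sup>2 \<le> 81 * l\<^sup>2" using power_mono[OF R, of 2] by (simp add: l_def power_mult_distrib)
  have X0: "0 \<le> ln (real m) + 48 * (real R)\<^sup>2 * (1 + ln (real m))" using lm by simp
  then show "0 \<le> load_bound m R" by (simp add: load_bound_def)
  have l1: "1 \<le> 3 / 2 * l" using l by simp
  have "48 * (real R)\<^sup>2 * (1 + ln (real m)) \<le> 48 * (81 * l\<^sup>2) * (7 / 2 * l)"
    using R2 lm l1 by (intro mult_mono) auto
  then have X: "ln (real m) + 48 * (real R)\<^sup>2 * (1 + ln (real m)) \<le> 2 * l + 13608 * l ^ 3"
    using lm by (simp add: power3_eq_cube power2_eq_square)
  define Y where "Y = ln (real m) + 48 * (real R)\<^sup>2 * (1 + ln (real m))"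
  have "Y / ln 2 \<le> Y / (2 / 3)"
    using ln2_ge_two_thirds X0 unfolding Y_def[symmetric] by (intro divide_left_mono) auto
  also have "\<dots> = 3 / 2 * Y" by simp
  also have "\<dots> \<le> 3 / 2 * (2 * l + 13608 * l ^ 3)" using X unfolding Y_def[symmetric] by (intro mult_left_mono) auto
  also have "\<dots> = 3 * l + 20412 * l ^ 3" by simp
  finally have "load_bound m R + 1 \<le> 3 * l + 20412 * l ^ 3 + 2"
    unfolding load_bound_def Y_def[symmetric] by linarith
  moreover have l3: "l \<le> 9 / 4 * l ^ 3"
  proof -
    have "l * (4 / 9) \<le> l * l\<^sup>2" using l2 l by (intro mult_left_mono) auto
    then show ?thesis by (simp add: power3_eq_cube power2_eq_square)
  qed
  ultimately show "load_bound m R + 1 \<le> 30000 * ln (real n) ^ 3"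
    using l1 unfolding l_def[symmetric] by linarith
qed

lemma main_alg_cover:
  assumes graph: "simple_graph {..<n} E" and packing: "tree_packing {..<n} E (mset Ts)"
    and k: "length Ts = k" and \<eta>: "2 \<le> \<eta>" "\<eta> \<le> k + 1"
    and cong: "packing_congestion_le E (mset Ts) (\<eta> - 1)" and D: "packing_diameter {..<n} (mset Ts) = D"
    and es: "edge_list es E" and ts: "list_all2 edge_list ts Ts"
  shows "cycle_cover (22 * real D * ln (real n)) (30000 * real k * real \<eta> * ln (real n) ^ 3) \<eta> (k + 1 - \<eta>) E
    (mset (main_alg n es ts))"
proof -
  have trees: "\<And>T. T \<in> set Ts \<Longrightarrow> spanning_tree {..<n} E T"
    using packing by (simp add: tree_packing_def)
  have k1: "1 \<le> k" using \<eta> by simp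
  have lts: "length ts = k" using ts k by (simp add: list_all2_lengthD)
  then obtain T where T: "T \<in> set Ts" using k k1 by (cases Ts) auto
  then have T_conn: "connected_graph {..<n} T" "T \<subseteq> E" using trees by (auto simp: spanning_tree_def)
  then have n1: "1 \<le> n" by (cases n) (auto simp: connected_graph_def)
  have finE: "finite E" using es by (auto simp: edge_list_ends)
  have cardE: "card E = length es"
    using es unfolding edge_list_ends by (metis distinct_card length_map list.set_map)
  \<comment> \<open>A connected graph has n - 1 edges or more, so one doubling per edge in
    \<open>rounds_for\<close> is enough to reach \<open>n\<close>.\<close>
  have "card {..<n} \<le> Suc (card T)"
    using T_conn finE by (intro line_embedding(1)) (auto intro: finite_subset)
  also have "card T \<le> card E" using T_conn finE by (intro card_mono)
  finally have "n \<le> Suc (length es)" by (simp add: cardE)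
  also have "\<dots> \<le> 2 ^ length es" by (simp add: Suc_le_eq)
  finally obtain L where L: "rounds_for n (length es) = 2 * L + 2" "n \<le> 2 ^ L" "2 ^ L < 2 * n"
    using rounds_for_spec[OF n1] by blast
  define R where "R = 2 * L + 2"
  have all: "take k ts = ts" by (simp add: lts)
  obtain chs U out where chs: "length chs = k" "foldl (stage_alg k es R) ([], []) ts = (U, out)"
    "mset out = mset (concat (map (map snd) chs))" "run_ok E k R Ts chs"
    using run_stages[OF graph es ts trees L(2) R_def, of k] unfolding lts all by blast
  interpret complete_run n E Ts k \<eta> R chs
    by unfold_locales (use graph trees k chs \<eta> cong in auto)
  have out: "mset (main_alg n es ts) = cycles"
  proof -
    have "rounds_for n (length es) = R" using L(1) by (simp add: R_def)
    then show ?thesis using chs(2,3) by (simp add: main_alg_def lts cycles_def)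
  qed
  \<comment> \<open>From L \<le> 3 ln n and 1 \<le> 3/2 ln n: 2L + 2 is at most 9 ln n, and 4L + 6
    at most 21 ln n.\<close>
  have R9: "real R \<le> 9 * ln (real n)" "22 * ln (real n) \<ge> 2 * (real R + 1)" if "2 \<le> n"
  proof -
    have "2 / 3 \<le> ln (real n)" using that by (rule ln_ge_two_thirds)
    then show "real R \<le> 9 * ln (real n)" "22 * ln (real n) \<ge> 2 * (real R + 1)"
      using rounds_bound[OF that L(3)] by (auto simp: R_def)
  qed
  have "length_bound (22 * real D * ln (real n)) cycles"
    unfolding length_bound_def
  proof
    fix c assume c: "c \<in># cycles"
    have "real (length c) \<le> real (2 * D * (R + 1))" using cycle_length(1)[OF D c] by (rule of_nat_mono)
    also have "\<dots> = real D * (2 * (real R + 1))" by (simp add: algebra_simps)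
    also have "\<dots> \<le> real D * (22 * ln (real n))" using R9(2)[OF cycle_length(2)[OF D c]] by (intro mult_left_mono) auto
    finally show "real (length c) \<le> 22 * real D * ln (real n)" by (simp add: algebra_simps)
  qed
  moreover have "cycle_congestion_le E cycles (30000 * real k * real \<eta> * ln (real n) ^ 3)"
    unfolding cycle_congestion_le_def
  proof
    fix s assume s: "s \<in> E"
    then have "s \<subseteq> {..<n}" "card s = 2" using graph by (auto simp: simple_graph_def)
    then have n: "2 \<le> n" using card_mono[of "{..<n}" s] by simp
    have m: "1 \<le> card E" using s finE by (auto simp: Suc_le_eq card_gt_0_iff)
    have "card E \<le> n * n" using card_edges_le[OF graph] by simp
    note lb = load_bound_le[OF n m this R9(1)[OF n]]
    have "real (size {#c \<in># cycles. s \<in> cycle_edges c#}) \<le> real k * real \<eta> * (load_bound (card E) R + 1)"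
      using congestion[OF s refl lb(1)] .
    also have "\<dots> \<le> real k * real \<eta> * (30000 * ln (real n) ^ 3)" using lb(2) by (intro mult_left_mono) auto
    finally show "real (size {#c \<in># cycles. s \<in> cycle_edges c#}) \<le> 30000 * real k * real \<eta> * ln (real n) ^ 3"
      by (simp add: algebra_simps)
  qed
  ultimately show ?thesis
    using cycle_collection covers unfolding cycle_cover_def out by blast
qed

theorem lemma7p19:
  shows "\<exists>(alg :: com) (p :: nat poly) (A :: real) (B :: real) (a :: real). a > 0 \<and>
    (\<forall>(n :: nat) (E :: nat set set) (\<T> :: nat set set multiset) (k :: nat) (\<eta> :: nat) (D :: nat) (x :: val).
       simple_graph {..<n} E \<longrightarrow>
       tree_packing {..<n} E \<T> \<longrightarrow>
       size \<T> = k \<longrightarrow>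
       2 \<le> \<eta> \<longrightarrow> \<eta> \<le> k + 1 \<longrightarrow>
       packing_congestion_le E \<T> (\<eta> - 1) \<longrightarrow>
       packing_diameter {..<n} \<T> = D \<longrightarrow>
       represents_input n E \<T> x \<longrightarrow>
       (let t = poly p (val_size x);
            k' = k + 1 - \<eta>;
            c = A * real k * real \<eta> * ln (real n) ^ 3;
            d = B * real D * ln (real n)
        in halts_within alg x t \<and>
           (\<forall>v \<in> set_pmf (output_within alg x t).
              \<exists>\<C>. represents_output \<C> v \<and> cycle_collection E \<C> \<and> length_bound d \<C>) \<and>
           measure_pmf.prob (output_within alg x t)
             {v. \<exists>\<C>. represents_output \<C> v \<and> cycle_cover d c \<eta> k' E \<C>}
             \<ge> 1 - 1 / real n powr a))"
proof -
  obtain p where p: "\<And>n es ts. \<exists>s'. run (poly p (val_size (enc_input n es ts))) (initial (compile mainP) (enc_input n es ts)) =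
      return_pmf (Skip, s') \<and> s' 0 = den ((length es + length ts + 2) ^ 8) mainP [enc_input n es ts]"
    using compile_polytime[of mainP] unfolding Let_def by blast
  have main: "let t = poly p (val_size x);
            k' = k + 1 - \<eta>;
            c = 30000 * real k * real \<eta> * ln (real n) ^ 3;
            d = 22 * real D * ln (real n)
        in halts_within (compile mainP) x t \<and>
           (\<forall>v \<in> set_pmf (output_within (compile mainP) x t).
              \<exists>\<C>. represents_output \<C> v \<and> cycle_collection E \<C> \<and> length_bound d \<C>) \<and>
           measure_pmf.prob (output_within (compile mainP) x t)
             {v. \<exists>\<C>. represents_output \<C> v \<and> cycle_cover d c \<eta> k' E \<C>}
             \<ge> 1 - 1 / real n powr 1"
    if graph: "simple_graph {..<n} E" and packing: "tree_packing {..<n} E \<T>" and k: "size \<T> = k"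
      and \<eta>: "2 \<le> \<eta>" "\<eta> \<le> k + 1" and cong: "packing_congestion_le E \<T> (\<eta> - 1)"
      and D: "packing_diameter {..<n} \<T> = D" and x: "represents_input n E \<T> x"
    for n E \<T> k \<eta> D x
  proof -
    obtain es ts Ts where inp: "x = enc_input n es ts" "edge_list es E" "mset Ts = \<T>" "list_all2 edge_list ts Ts"
      using x unfolding represents_input_def by blast
    let ?t = "poly p (val_size x)" and ?out = "main_alg n es ts"
    let ?d = "22 * real D * ln (real n)" and ?c = "30000 * real k * real \<eta> * ln (real n) ^ 3"
    have cover: "cycle_cover ?d ?c \<eta> (k + 1 - \<eta>) E (mset ?out)"
      by (rule main_alg_cover[where Ts = Ts]) (use graph packing k \<eta> cong D inp in auto)
    have finE: "finite E" "card E = length es"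
      using inp(2) unfolding edge_list_ends by (auto, metis distinct_card length_map list.set_map)
    \<comment> \<open>The clock counts edges and trees but not the lengths of the tree lists; these
      are controlled by the edge list of the graph.\<close>
    have "length t \<le> length es" if t: "t \<in> set ts" for t
    proof -
      obtain i where i: "i < length ts" "t = ts ! i" using t by (metis in_set_conv_nth)
      then have T: "edge_list t (Ts ! i)" "Ts ! i \<in> set Ts"
        using inp(4) by (auto simp: list_all2_conv_all_nth)
      then have "Ts ! i \<subseteq> E" using packing inp(3) by (auto simp: tree_packing_def spanning_tree_def)
      moreover have "card (Ts ! i) = length t"
        using T(1) unfolding edge_list_ends by (metis distinct_card length_map list.set_map)
      ultimately show ?thesis using finE by (metis card_mono)
    qed
    then have den: "den ((length es + length ts + 2) ^ 8) mainP [x] = enc_cycles ?out"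
      unfolding inp(1) by (rule den_mainP)
    obtain s' where s': "run ?t (initial (compile mainP) x) = return_pmf (Skip, s')" "s' 0 = enc_cycles ?out"
      using p[of n es ts] den unfolding inp(1) by auto
    have halts: "halts_within (compile mainP) x ?t" by (simp add: halts_within_def s'(1))
    have out_eq: "output_within (compile mainP) x ?t = return_pmf (enc_cycles ?out)"
      by (simp add: output_within_def s')
    have rep: "represents_output (mset ?out) (enc_cycles ?out)" by (auto simp: represents_output_def)
    have "\<exists>\<C>. represents_output \<C> (enc_cycles ?out) \<and> cycle_collection E \<C> \<and> length_bound ?d \<C>"
      using rep cover unfolding cycle_cover_def by blast
    moreover have "\<exists>\<C>. represents_output \<C> (enc_cycles ?out) \<and> cycle_cover ?d ?c \<eta> (k + 1 - \<eta>) E \<C>"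
      using rep cover by blast
    \<comment> \<open>The output distribution is a point mass on a value in the event, so the
      probability is 1.\<close>
    ultimately show ?thesis
      unfolding Let_def out_eq using halts by (simp add: measure_return_pmf)
  qed
  show ?thesis
    by (intro exI[of _ "compile mainP"] exI[of _ p] exI[of _ 30000] exI[of _ 22] exI[of _ 1] conjI allI impI)
       (simp, rule main)
qed

end
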